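(* Let $G=(V,E)$ be a connected finite graph with weight $\omega$ and measure $\mu$. Let $h:V\to\mathbb{R}$ and $c\in\mathbb{R}$ satisfy: 1) if $c>0$, then $h(x)>0$ for some $x\in V$; 2) if $c=0$, then $h$ changes sign (i.e. $h$ is positive at some vertex and negative at some vertex) and $\int_V h\,d\mu<0$; 3) if $c<0$, then $h(x)<0$ for some $x\in V$. Let $d_{h,c}$ be the Brouwer degree of the Kazdan-Warner equation $-\Delta u=he^{u}-c$ on $V$, that is, $d_{h,c}=\lim_{R\to+\infty}\deg(F_{h,c},B_R,0)$ with $F_{h,c}(u)=-\Delta u+c-he^{u}$. Then $$d_{h,c}=\begin{cases}-1,& c\ge 0;\\ 1,& c<0\ \text{and}\ \max_V h\le 0;\\ 0,& c<0\ \text{and}\ \max_V h>0.\end{cases}$$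
   Context: A connected finite graph $G=(V,E)$ has finite vertex set $V$ and edge set $E$, with a weight $\omega:V\times V\to\mathbb{R}$ such that $\omega_{xy}=\omega_{yx}\ge 0$ and $\omega_{xy}>0$ if and only if $xy\in E$; connected means that for all $x,y\in V$ there are $x=x_1,\dots,x_m=y$ in $V$ with $\omega_{x_ix_{i+1}}>0$ for $i=1,\dots,m-1$. The measure is a positive function $\mu:V\to(0,\infty)$, $x\mapsto\mu_x$. The Laplace operator is $\Delta u(x)=\frac{1}{\mu_x}\sum_{y\in V}\omega_{xy}(u(y)-u(x))$ for $u:V\to\mathbb{R}$, and $\int_V f\,d\mu=\sum_{x\in V}f(x)\mu_x$. Let $L^\infty(V)$ be the finite-dimensional space of all functions $V\to\mathbb{R}$ with norm $\max_V|u|$, and $B_R$ the ball of radius $R$ centred at the origin in it. The map $F_{h,c}:L^\infty(V)\to L^\infty(V)$ is $F_{h,c}(u)=-\Delta u+c-he^{u}$ (pointwise on $V$), and $\deg(F_{h,c},B_R,0)$ is the usual Brouwer degree (with the same orientation on source and target; if $0$ is a regular value it equals the sum of the signs of $\det DF_{h,c}(u)$ over the zeros $u\in B_R$). Under hypotheses 1)-3), all zeros of $F_{h,c}$ lie in a fixed bounded set, so $\deg(F_{h,c},B_R,0)$ is well defined and independent of $R$ for all large $R$; $d_{h,c}$ is this common value. *)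

theory Defs
  imports "HOL-Analysis.Analysis"
begin

text \<open>
  The vertex set is the finite type \<open>'v\<close>, so that the space of all functions on the vertices
  is \<open>real ^ 'v\<close>; edges are unordered pairs of vertices.
\<close>

definition connected_weighted_graph ::
  "'v::finite set set \<Rightarrow> ('v \<Rightarrow> 'v \<Rightarrow> real) \<Rightarrow> ('v \<Rightarrow> real) \<Rightarrow> bool" where
  "connected_weighted_graph E \<omega> \<mu> \<longleftrightarrow>
     (\<forall>e\<in>E. \<exists>x y. e = {x, y}) \<and>
     (\<forall>x y. \<omega> x y = \<omega> y x) \<and>
     (\<forall>x y. \<omega> x y \<ge> 0) \<and>
     (\<forall>x y. \<omega> x y > 0 \<longleftrightarrow> {x, y} \<in> E) \<and>
     (\<forall>x y. (\<lambda>a b. \<omega> a b > 0)\<^sup>*\<^sup>* x y) \<and>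
     (\<forall>x. \<mu> x > 0)"

definition graph_laplacian ::
  "('v::finite \<Rightarrow> 'v \<Rightarrow> real) \<Rightarrow> ('v \<Rightarrow> real) \<Rightarrow> real ^ 'v \<Rightarrow> real ^ 'v" where
  "graph_laplacian \<omega> \<mu> u = (\<chi> x. (1 / \<mu> x) * (\<Sum>y\<in>UNIV. \<omega> x y * (u $ y - u $ x)))"

definition graph_integral :: "('v::finite \<Rightarrow> real) \<Rightarrow> ('v \<Rightarrow> real) \<Rightarrow> real" where
  "graph_integral \<mu> f = (\<Sum>x\<in>UNIV. f x * \<mu> x)"

definition kazdan_warner_map ::
  "('v::finite \<Rightarrow> 'v \<Rightarrow> real) \<Rightarrow> ('v \<Rightarrow> real) \<Rightarrow> ('v \<Rightarrow> real) \<Rightarrow> real \<Rightarrow> real ^ 'v \<Rightarrow> real ^ 'v" where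
  "kazdan_warner_map \<omega> \<mu> h c u =
     (\<chi> x. - (graph_laplacian \<omega> \<mu> u $ x) + c - h x * exp (u $ x))"

definition linf_ball :: "real \<Rightarrow> (real ^ 'v::finite) set" where
  "linf_ball R = {u. infnorm u < R}"

definition regular_value_on ::
  "(real ^ 'n \<Rightarrow> real ^ 'n) \<Rightarrow> (real ^ 'n::finite) set \<Rightarrow> real ^ 'n \<Rightarrow> bool" where
  "regular_value_on f \<Omega> q \<longleftrightarrow> (\<forall>x\<in>\<Omega>. f x = q \<longrightarrow> det (jacobian f (at x)) \<noteq> 0)"

text \<open>
  The Brouwer degree \<open>deg(f, \<Omega>, p)\<close> of a map that is continuous on the closure of a bounded
  open set \<open>\<Omega>\<close>, continuously differentiable on \<open>\<Omega>\<close>, and avoids \<open>p\<close> on the boundary: it is the sum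
  of the signs of the Jacobian determinants over the preimages of any regular value sufficiently
  close to \<open>p\<close>.  By Sard's theorem such regular values exist arbitrarily close to \<open>p\<close>, so that at
  most one \<open>d\<close> qualifies; if \<open>p\<close> is itself regular, it may be taken as the regular value.
\<close>

definition has_brouwer_degree ::
  "(real ^ 'n \<Rightarrow> real ^ 'n) \<Rightarrow> (real ^ 'n::finite) set \<Rightarrow> real ^ 'n \<Rightarrow> int \<Rightarrow> bool" where
  "has_brouwer_degree f \<Omega> p d \<longleftrightarrow>
     open \<Omega> \<and> bounded \<Omega> \<and>
     continuous_on (closure \<Omega>) f \<and>
     (\<forall>x\<in>\<Omega>. f differentiable (at x)) \<and>
     continuous_on \<Omega> (\<lambda>x. jacobian f (at x)) \<and>
     p \<notin> f ` frontier \<Omega> \<and>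
     (\<exists>\<epsilon>>0. \<forall>q\<in>ball p \<epsilon>. regular_value_on f \<Omega> q \<longrightarrow>
        of_int d = (\<Sum>x\<in>{x\<in>\<Omega>. f x = q}. sgn (det (jacobian f (at x)))))"

definition brouwer_degree ::
  "(real ^ 'n \<Rightarrow> real ^ 'n) \<Rightarrow> (real ^ 'n::finite) set \<Rightarrow> real ^ 'n \<Rightarrow> int" where
  "brouwer_degree f \<Omega> p = (THE d. has_brouwer_degree f \<Omega> p d)"

end

theory Submission
  imports Defs
begin

text \<open>
Write \<open>F\<^bsub>h,c\<^esub> u = - \<Delta>u + c - h e\<^sup>u\<close>, where \<open>c\<close> may also be a function on the vertices. The degree on a
large ball does not change along a segment of data \<open>(h, c)\<close> on which all zeros stay in one bounded
set, so it suffices to deform each case to an equation whose zeros can be listed.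

\<^item> \<open>c > 0\<close>: let \<open>P = {h > 0}\<close>. Deform to \<open>h = 1\<^sub>P\<close> and \<open>c = \<delta> 1\<^sub>P\<close>. For small \<open>\<delta>\<close> the constant
  \<open>ln \<delta>\<close> is the only zero, and the linearisation \<open>- \<Delta> - \<delta> 1\<^sub>P\<close> has negative determinant: degree -1.
\<^item> \<open>c = 0\<close>: raise \<open>c\<close> to 1. The condition \<open>\<integral> h < 0\<close> keeps zeros from escaping to \<open>- \<infinity>\<close>.
\<^item> \<open>c < 0\<close>, \<open>h \<le> 0\<close>: deform to \<open>h = - 1\<close>; the constant \<open>ln (- c)\<close> is the only zero and the
  linearisation \<open>- \<Delta> - c\<close> has positive determinant: degree 1.
\<^item> \<open>c < 0\<close>, \<open>h > 0\<close> somewhere: lower \<open>c\<close> until no zero is left: degree 0.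

The a priori bounds behind these deformations rest on one maximum principle
(\<open>maximum_principle\<close>): if \<open>\<Delta>u \<ge> - C\<close> off a set \<open>P\<close>, then either \<open>max u\<close> is attained on \<open>P\<close> up to a
multiple of \<open>C\<close>, or the oscillation of \<open>u\<close> is at most that multiple. Applied to \<open>- u\<close> with the set
\<open>{u > 0}\<close>, it shows that a solution that is very negative somewhere is very negative everywhere, with
bounded oscillation; the integrated equation \<open>\<integral> c = \<integral> h e\<^sup>u\<close> excludes this if \<open>\<integral> c\<close> stays away from 0,
or if \<open>c \<ge> 0\<close> and \<open>\<integral> h < 0\<close>. Applied to \<open>u\<close> with the
set \<open>{h > 0}\<close>, it reduces the upper bound to the vertices with \<open>h > 0\<close>, where the equation bounds
\<open>e\<^sup>u\<close> by a linear expression in \<open>u\<close>.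

The degree theory follows the analytic approach. For a bump \<open>\<phi>\<close> supported near 0, the integral
of \<open>\<phi>(f) det Df\<close> over \<open>\<Omega>\<close> is, when 0 is a regular value and the support is small, the sum of the
signs of \<open>det Df\<close> at the zeros times \<open>\<integral> \<phi>\<close> (inverse function theorem and change of variables). Along a
homotopy that does not vanish on the frontier, its time derivative is the integral of a
divergence with compact support, hence 0. The second statement usually needs the vanishing
divergence of the cofactor matrix, and thus second derivatives. Here it is immediate: the
derivative of \<open>F\<^bsub>h,c\<^esub>\<close> depends on \<open>u\<close> only through its diagonal, whose \<open>j\<close>th entry depends only on
\<open>u\<^sub>j\<close>, so a cofactor that omits column \<open>j\<close> does not depend on \<open>u\<^sub>j\<close> at all. The degree theory below
treats exactly this class of maps (\<open>diagonally_nonlinear\<close>).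

Sard's theorem and the change of variables formula are stated for coordinates indexed by a
well-ordered type. The argument is therefore carried out for a well-ordered vertex set and
transferred by relabelling the vertices, which does not affect the degree.
\<close>

section \<open>Cofactors and the derivative of a determinant\<close>

definition row_cofactor :: "real ^ 'n ^ 'n \<Rightarrow> 'n \<Rightarrow> 'n::finite \<Rightarrow> real" where
  "row_cofactor A i j = det (\<chi> k. if k = i then axis j 1 else A $ k)"

lemma det_replace_row:
  fixes A :: "real ^ 'n::finite ^ 'n"
  shows "det (\<chi> k. if k = i then v else A $ k) = (\<Sum>j\<in>UNIV. v $ j * row_cofactor A i j)"
proof -
  have "v = (\<Sum>j\<in>UNIV. v $ j *s axis j 1)"
    by (simp add: basis_expansion)
  then have "det (\<chi> k. if k = i then v else A $ k)
      = det (\<chi> k. if k = i then (\<Sum>j\<in>UNIV. v $ j *s axis j 1) else A $ k)"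
    by (rule arg_cong)
  also have "\<dots> = (\<Sum>j\<in>UNIV. det (\<chi> k. if k = i then v $ j *s axis j 1 else A $ k))"
    by (rule det_linear_row_sum) simp
  also have "\<dots> = (\<Sum>j\<in>UNIV. v $ j * row_cofactor A i j)"
    unfolding row_cofactor_def by (intro sum.cong refl det_row_mul)
  finally show ?thesis .
qed

lemma row_cofactor_expansion:
  fixes A :: "real ^ 'n::finite ^ 'n"
  shows "(\<Sum>j\<in>UNIV. A $ k $ j * row_cofactor A i j) = (if k = i then det A else 0)"
proof (cases "k = i")
  case True
  have "(\<chi> l. if l = i then A $ k else A $ l) = A"
    using True by (simp add: vec_eq_iff)
  then show ?thesis
    using True det_replace_row[of i "A $ k" A] by simp
next
  case False
  let ?B = "\<chi> l. if l = i then A $ k else A $ l"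
  have "row i ?B = row k ?B"
    using False by (simp add: row_def)
  then have "det ?B = 0"
    using False by (intro det_identical_rows[of i k]) auto
  then show ?thesis
    using False det_replace_row[of i "A $ k" A] by simp
qed

text \<open>
The \<open>(i, j)\<close> cofactor ignores column \<open>j\<close>, in particular its diagonal entry. The replaced row is a
unit vector, so changing entry \<open>(j, j)\<close> adds a multiple of that row to row \<open>j\<close>. For a Jacobian
whose nonlinear part is diagonal this says that its cofactors have vanishing divergence.
\<close>

lemma row_cofactor_diagonal_entry:
  fixes A B :: "real ^ 'n::finite ^ 'n"
  assumes "\<And>k l. \<not> (k = j \<and> l = j) \<Longrightarrow> A $ k $ l = B $ k $ l"
  shows "row_cofactor A i j = row_cofactor B i j"
proof (cases "i = j")
  case True
  have "A $ k = B $ k" if "k \<noteq> j" for k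
    using assms that by (simp add: vec_eq_iff)
  then show ?thesis
    unfolding row_cofactor_def using True by (intro arg_cong[of _ _ det]) (auto simp: vec_eq_iff)
next
  case False
  let ?A = "\<chi> k. if k = i then axis j 1 else A $ k"
  let ?B = "\<chi> k. if k = i then axis j 1 else B $ k"
  have "?B = (\<chi> k. if k = j then row j ?A + (B $ j $ j - A $ j $ j) *s row i ?A else row k ?A)"
    using False assms by (auto simp: vec_eq_iff row_def axis_def)
  then show ?thesis
    unfolding row_cofactor_def using det_row_operation[of j i ?A "B $ j $ j - A $ j $ j"] False
    by simp
qed

lemma continuous_on_det [continuous_intros]:
  fixes M :: "'a::topological_space \<Rightarrow> real ^ 'n::finite ^ 'n"
  assumes "continuous_on S M"
  shows "continuous_on S (\<lambda>x. det (M x))"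
  unfolding det_def by (intro continuous_intros assms)

lemma continuous_on_row_cofactor [continuous_intros]:
  fixes M :: "'a::topological_space \<Rightarrow> real ^ 'n::finite ^ 'n"
  assumes "continuous_on S M"
  shows "continuous_on S (\<lambda>x. row_cofactor (M x) i j)"
proof -
  have "continuous_on S (\<lambda>x. if k = i then axis j 1 else M x $ k)" for k
    using assms by (cases "k = i") (simp_all add: continuous_on_component)
  then show ?thesis
    unfolding row_cofactor_def by (intro continuous_on_det continuous_on_vec_lambda)
qed

text \<open>
Jacobi's formula: the product rule for the Leibniz expansion yields one determinant per row, in which
that row is differentiated.
\<close>

lemma has_field_derivative_det:
  fixes M :: "real \<Rightarrow> real ^ 'n::finite ^ 'n"
  assumes M': "\<And>i j. ((\<lambda>t. M t $ i $ j) has_field_derivative M' $ i $ j) (at t)"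
  shows "((\<lambda>t. det (M t)) has_field_derivative
      (\<Sum>i\<in>UNIV. \<Sum>j\<in>UNIV. M' $ i $ j * row_cofactor (M t) i j)) (at t)"
proof -
  let ?P = "{p. p permutes (UNIV :: 'n set)}"
  have "((\<lambda>t. det (M t)) has_field_derivative
      (\<Sum>p\<in>?P. of_int (sign p) * (\<Sum>i\<in>UNIV. M' $ i $ p i * (\<Prod>k\<in>UNIV - {i}. M t $ k $ p k)))) (at t)"
    unfolding det_def
    by (intro DERIV_sum DERIV_cmult has_field_derivative_prod M')
  also have "(\<Sum>p\<in>?P. of_int (sign p) * (\<Sum>i\<in>UNIV. M' $ i $ p i * (\<Prod>k\<in>UNIV - {i}. M t $ k $ p k)))
      = (\<Sum>i\<in>UNIV. \<Sum>p\<in>?P. of_int (sign p) * (M' $ i $ p i * (\<Prod>k\<in>UNIV - {i}. M t $ k $ p k)))"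
    by (subst sum.swap) (simp add: sum_distrib_left)
  also have "\<dots> = (\<Sum>i\<in>UNIV. det (\<chi> k. if k = i then M' $ i else M t $ k))"
  proof (intro sum.cong refl)
    fix i :: 'n
    have *: "M' $ i $ p i * (\<Prod>k\<in>UNIV - {i}. M t $ k $ p k)
        = (\<Prod>k\<in>UNIV. (\<chi> k. if k = i then M' $ i else M t $ k) $ k $ p k)" for p
      by (subst prod.remove[of UNIV i]) (auto intro!: prod.cong)
    show "(\<Sum>p\<in>?P. of_int (sign p) * (M' $ i $ p i * (\<Prod>k\<in>UNIV - {i}. M t $ k $ p k)))
        = det (\<chi> k. if k = i then M' $ i else M t $ k)"
      unfolding * by (simp add: det_def)
  qed
  finally show ?thesis
    unfolding det_replace_row .
qed

section \<open>A bump function of class \<open>C\<^sup>1\<close>\<close>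

text \<open>
The profile need only be \<open>C\<^sup>1\<close> with compact support; the square of the positive part of
\<open>\<epsilon>\<^sup>2 - |y|\<^sup>2\<close> has an explicit gradient.
\<close>

definition bump :: "real \<Rightarrow> real ^ 'n::finite \<Rightarrow> real" where
  "bump \<epsilon> y = (max 0 (\<epsilon>\<^sup>2 - y \<bullet> y))\<^sup>2"

definition bump_deriv :: "real \<Rightarrow> real ^ 'n::finite \<Rightarrow> real ^ 'n \<Rightarrow> real" where
  "bump_deriv \<epsilon> y v = - 4 * max 0 (\<epsilon>\<^sup>2 - y \<bullet> y) * (y \<bullet> v)"

lemma has_field_derivative_max_square:
  "((\<lambda>s::real. (max 0 s)\<^sup>2) has_field_derivative 2 * max 0 s) (at s)"
proof -
  consider "s > 0" | "s < 0" | "s = 0" by linarith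
  then show ?thesis
  proof cases
    case 1
    have "((\<lambda>s. s\<^sup>2) has_field_derivative 2 * max 0 s) (at s)"
      using 1 by (auto intro!: derivative_eq_intros)
    then show ?thesis
      by (rule has_field_derivative_transform_within_open[of _ _ _ "{0<..}"]) (use 1 in auto)
  next
    case 2
    have "((\<lambda>s. 0) has_field_derivative 2 * max 0 s) (at s)"
      using 2 by (auto intro!: derivative_eq_intros)
    then show ?thesis
      by (rule has_field_derivative_transform_within_open[of _ _ _ "{..<0}"]) (use 2 in auto)
  next
    case 3
    have "((\<lambda>h::real. (max 0 h)\<^sup>2 / h) \<longlongrightarrow> 0) (at 0)"
    proof (rule Lim_null_comparison)
      show "\<forall>\<^sub>F h::real in at 0. norm ((max 0 h)\<^sup>2 / h) \<le> \<bar>h\<bar>"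
        by (rule always_eventually) (auto simp: max_def power2_eq_square)
      show "((\<lambda>h::real. \<bar>h\<bar>) \<longlongrightarrow> 0) (at 0)"
        by (intro tendsto_eq_intros) auto
    qed
    then show ?thesis
      using 3 by (simp add: DERIV_def)
  qed
qed

lemma has_field_derivative_bump:
  fixes f :: "real \<Rightarrow> real ^ 'n::finite"
  assumes "(f has_vector_derivative v) (at t within S)"
  shows "((\<lambda>t. bump \<epsilon> (f t)) has_field_derivative bump_deriv \<epsilon> (f t) v) (at t within S)"
proof -
  have "((\<lambda>t. f t \<bullet> f t) has_vector_derivative (f t \<bullet> v + v \<bullet> f t)) (at t within S)"
    by (rule bounded_bilinear.has_vector_derivative[OF bounded_bilinear_inner assms assms])
  then have "((\<lambda>t. \<epsilon>\<^sup>2 - f t \<bullet> f t) has_field_derivative - (2 * (f t \<bullet> v))) (at t within S)"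
    unfolding has_real_derivative_iff_has_vector_derivative
    by (auto intro!: derivative_eq_intros simp: inner_commute)
  from DERIV_chain2[OF has_field_derivative_max_square this] show ?thesis
    by (simp add: bump_def bump_deriv_def mult.assoc)
qed

lemma continuous_on_bump [continuous_intros]:
  "continuous_on S f \<Longrightarrow> continuous_on S (\<lambda>x. bump \<epsilon> (f x))"
  unfolding bump_def by (intro continuous_intros)

lemma continuous_on_bump_deriv [continuous_intros]:
  "continuous_on S f \<Longrightarrow> continuous_on S g \<Longrightarrow> continuous_on S (\<lambda>x. bump_deriv \<epsilon> (f x) (g x))"
  unfolding bump_deriv_def by (intro continuous_intros)

lemma bump_eq_0: "\<epsilon> \<ge> 0 \<Longrightarrow> norm y \<ge> \<epsilon> \<Longrightarrow> bump \<epsilon> y = 0"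
  and bump_deriv_eq_0: "\<epsilon> \<ge> 0 \<Longrightarrow> norm y \<ge> \<epsilon> \<Longrightarrow> bump_deriv \<epsilon> y v = 0"
  using power_mono[of \<epsilon> "norm y" 2]
  by (auto simp: bump_def bump_deriv_def power2_norm_eq_inner max_def)

lemma bump_nonneg: "bump \<epsilon> y \<ge> 0"
  by (simp add: bump_def)

lemma bump_pos: "norm y < \<epsilon> \<Longrightarrow> bump \<epsilon> y > 0"
  using power_strict_mono[of "norm y" \<epsilon> 2]
  by (simp add: bump_def power2_norm_eq_inner)

section \<open>Partial derivatives of compactly supported functions\<close>

text \<open>
The integral of \<open>V\<close> translated by \<open>s\<close> in direction \<open>j\<close> does not depend on \<open>s\<close>; differentiating
under the integral at \<open>s = 0\<close> gives the claim.
\<close>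

lemma has_integral_partial_derivative:
  fixes V W :: "real ^ 'n::finite \<Rightarrow> real"
  assumes V': "\<And>u. ((\<lambda>s. V (u + s *\<^sub>R axis j 1)) has_field_derivative W u) (at 0)"
    and contV: "continuous_on UNIV V" and contW: "continuous_on UNIV W"
    and K: "compact K" and V0: "\<And>u. u \<notin> K \<Longrightarrow> V u = 0" and KT: "K \<subseteq> T"
  shows "(W has_integral 0) T"
proof -
  let ?e = "axis j 1 :: real ^ 'n"
  have W0: "W u = 0" if "u \<notin> K" for u
  proof (rule DERIV_unique[OF V'])
    have "open ((\<lambda>s. u + s *\<^sub>R ?e) -` (- K))"
      using K by (intro open_vimage continuous_intros) (simp add: compact_imp_closed)
    then show "((\<lambda>s. V (u + s *\<^sub>R ?e)) has_field_derivative 0) (at 0)"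
      by (rule has_field_derivative_transform_within_open[OF DERIV_const])
        (use that V0 in auto)
  qed
  obtain r where r: "r > 0" "\<And>u. u \<in> K \<Longrightarrow> norm u \<le> r"
    using compact_imp_bounded[OF K] unfolding bounded_pos by auto
  \<comment> \<open>the margin 1 keeps the support inside the box for all translations with \<open>|s| < 1\<close>\<close>
  obtain a :: "real ^ 'n" where a: "cball 0 (r + 1) \<subseteq> cbox (- a) a"
    using bounded_subset_cbox_symmetric[OF bounded_cball] by blast
  define B where "B = cbox (- a) a"
  have V_shift: "((\<lambda>u. V (u + s *\<^sub>R ?e)) has_integral integral B V) B" if "s \<in> {-1<..<1}" for s
  proof -
    have "(V has_integral integral B V) (cbox (- a) a)"
      unfolding B_def using contV
      by (intro integrable_integral integrable_continuous) (blast intro: continuous_on_subset)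
    from has_integral_affinity[OF this, of 1 "s *\<^sub>R ?e"]
    have "((\<lambda>u. V (u + s *\<^sub>R ?e)) has_integral integral B V) ((\<lambda>x. x - s *\<^sub>R ?e) ` B)"
      by (simp add: B_def)
    moreover have "V (u + s *\<^sub>R ?e) = 0" if "u \<notin> (\<lambda>x. x - s *\<^sub>R ?e) ` B" for u
    proof (rule V0, rule notI)
      assume "u + s *\<^sub>R ?e \<in> K"
      then have "u + s *\<^sub>R ?e \<in> B"
        using r(2)[of "u + s *\<^sub>R ?e"] a by (auto simp: B_def)
      then have "u \<in> (\<lambda>x. x - s *\<^sub>R ?e) ` B"
        by (rule image_eqI[rotated]) simp
      with that show False ..
    qed
    ultimately have "((\<lambda>u. V (u + s *\<^sub>R ?e)) has_integral integral B V) UNIV"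
      using has_integral_on_superset by blast
    moreover have "V (u + s *\<^sub>R ?e) = 0" if "u \<notin> B" for u
    proof (rule V0, rule notI)
      assume "u + s *\<^sub>R ?e \<in> K"
      then have "norm (u + s *\<^sub>R ?e) \<le> r" by (rule r)
      moreover have "norm (s *\<^sub>R ?e) \<le> 1"
        using \<open>s \<in> {-1<..<1}\<close> by (auto simp: norm_axis_1)
      ultimately have "norm u \<le> r + 1"
        using norm_triangle_ineq4[of "u + s *\<^sub>R ?e" "s *\<^sub>R ?e"] by simp
      then show False using that a by (auto simp: B_def)
    qed
    then have "(\<lambda>u. if u \<in> B then V (u + s *\<^sub>R ?e) else 0) = (\<lambda>u. V (u + s *\<^sub>R ?e))"
      by auto
    ultimately show ?thesis
      using has_integral_restrict_UNIV[of B "\<lambda>u. V (u + s *\<^sub>R ?e)" "integral B V"] by simp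
  qed
  have "((\<lambda>s. integral (cbox (- a) a) (\<lambda>u. V (u + s *\<^sub>R ?e))) has_field_derivative
      integral (cbox (- a) a) (\<lambda>u. W (u + 0 *\<^sub>R ?e))) (at 0 within {-1<..<1})"
  proof (rule leibniz_rule_field_derivative[where fx = "\<lambda>s u. W (u + s *\<^sub>R ?e)"])
    fix s :: real and u
    have "((\<lambda>h. V ((u + s *\<^sub>R ?e) + h *\<^sub>R ?e)) has_field_derivative W (u + s *\<^sub>R ?e)) (at 0)"
      by (rule V')
    then have "((\<lambda>h. V (u + (h + s) *\<^sub>R ?e)) has_field_derivative W (u + s *\<^sub>R ?e)) (at 0)"
      by (simp add: algebra_simps)
    then have "((\<lambda>h. V (u + h *\<^sub>R ?e)) has_field_derivative W (u + s *\<^sub>R ?e)) (at s)"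
      by (subst (asm) DERIV_shift[symmetric]) simp
    then show "((\<lambda>h. V (u + h *\<^sub>R ?e)) has_field_derivative W (u + s *\<^sub>R ?e)) (at s within {-1<..<1})"
      by (rule has_field_derivative_at_within)
  next
    show "(\<lambda>u. V (u + s *\<^sub>R ?e)) integrable_on cbox (- a) a" if "s \<in> {-1<..<1}" for s
      using V_shift[OF that] unfolding B_def by (rule has_integral_integrable)
  next
    show "continuous_on ({-1<..<1} \<times> cbox (- a) a) (\<lambda>(s, u). W (u + s *\<^sub>R ?e))"
    proof -
      have "continuous_on ({-1<..<1} \<times> cbox (- a) a) (\<lambda>p. snd p + fst p *\<^sub>R ?e)"
        by (intro continuous_intros)
      from continuous_on_compose2[OF contW this] show ?thesis
        by (simp add: split_def)
    qed
  qed auto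
  moreover have "((\<lambda>s. integral (cbox (- a) a) (\<lambda>u. V (u + s *\<^sub>R ?e))) has_field_derivative 0) (at 0 within {-1<..<1})"
  proof (rule has_field_derivative_transform_within)
    show "((\<lambda>s. integral B V) has_field_derivative 0) (at (0::real) within {-1<..<1})"
      by (rule DERIV_const)
    show "integral B V = integral (cbox (- a) a) (\<lambda>u. V (u + s *\<^sub>R ?e))" if "s \<in> {-1<..<1}" for s
      using integral_unique[OF V_shift[OF that]] by (simp add: B_def)
  qed (rule zero_less_one, simp)
  ultimately have "integral B W = 0"
    by (simp add: B_def at_within_open[of 0 "{-1<..<1}"] DERIV_unique)
  moreover have "W integrable_on B"
    unfolding B_def using contW
    by (intro integrable_continuous) (blast intro: continuous_on_subset)
  ultimately have "(W has_integral 0) B"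
    by (simp add: has_integral_iff)
  moreover have "K \<subseteq> B"
    using r a by (fastforce simp: B_def)
  then have "W u = 0" if "u \<notin> B" for u
    using W0 that by blast
  ultimately have "(W has_integral 0) UNIV"
    using has_integral_on_superset[of W 0 B UNIV] by blast
  moreover have "(\<lambda>u. if u \<in> T then W u else 0) = W"
    using W0 KT by (intro ext) auto
  ultimately show ?thesis
    using has_integral_restrict_UNIV[of T W 0] by simp
qed

section \<open>Homotopy invariance of the bump integral\<close>

text \<open>
\<open>f\<close> is linear up to a map that acts on each coordinate separately: moving \<open>u\<close> along
coordinate \<open>j\<close> changes the Jacobian \<open>M u\<close> in the entry \<open>(j, j)\<close> only.
\<close>

definition diagonally_nonlinear ::
    "(real ^ 'n::finite \<Rightarrow> real ^ 'n) \<Rightarrow> (real ^ 'n \<Rightarrow> real ^ 'n ^ 'n) \<Rightarrow> bool" where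
  "diagonally_nonlinear f M \<longleftrightarrow>
     (\<forall>u. (f has_derivative (*v) (M u)) (at u)) \<and> continuous_on UNIV M \<and>
     (\<forall>u s j k l. \<not> (k = j \<and> l = j) \<longrightarrow> M (u + s *\<^sub>R axis j 1) $ k $ l = M u $ k $ l)"

lemma has_vector_derivative_coordinate_line:
  fixes f :: "real ^ 'n::finite \<Rightarrow> real ^ 'n"
  assumes "(f has_derivative (*v) A) (at u)"
  shows "((\<lambda>s. f (u + s *\<^sub>R axis j 1)) has_vector_derivative column j A) (at 0)"
proof -
  have "((\<lambda>s. u + s *\<^sub>R axis j 1) has_derivative (\<lambda>s. s *\<^sub>R axis j 1)) (at (0::real))"
    by (auto intro!: derivative_eq_intros)
  moreover have "(f has_derivative (*v) A) (at (u + 0 *\<^sub>R axis j 1))"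
    using assms by simp
  ultimately have "((\<lambda>s. f (u + s *\<^sub>R axis j 1)) has_derivative (\<lambda>s. A *v (s *\<^sub>R axis j 1))) (at (0::real))"
    by (rule has_derivative_compose)
  then show ?thesis
    by (simp add: has_vector_derivative_def matrix_vector_mult_scaleR matrix_vector_mult_basis)
qed

text \<open>
With \<open>F\<close> the homotopy, \<open>A\<close> its Jacobian, \<open>G = \<partial>\<^sub>t F\<close> and \<open>C\<close> the cofactors of \<open>A\<close>, the expansions of
the determinant along rows give
\<open>\<partial>\<^sub>t (\<phi>(F) det A) = \<Sum>\<^sub>j \<partial>\<^sub>j (\<phi>(F) \<Sum>\<^sub>i G\<^sub>i C\<^sub>i\<^sub>j)\<close>,
because \<open>C\<^sub>i\<^sub>j\<close> is constant in \<open>u\<^sub>j\<close>. The fields on the right vanish near the frontier, so the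
integral over \<open>\<Omega>\<close> is constant in time.
\<close>

lemma bump_integral_homotopy:
  fixes f g :: "real ^ 'n::finite \<Rightarrow> real ^ 'n"
  assumes f: "diagonally_nonlinear f M" and g: "diagonally_nonlinear g N"
    and \<Omega>: "open \<Omega>" "bounded \<Omega>" and "\<epsilon> > 0"
    and frontier: "\<And>t u. t \<in> {0..1} \<Longrightarrow> u \<in> frontier \<Omega> \<Longrightarrow>
      norm ((1 - t) *\<^sub>R f u + t *\<^sub>R g u) > \<epsilon>"
  shows "integral \<Omega> (\<lambda>u. bump \<epsilon> (f u) * det (M u)) = integral \<Omega> (\<lambda>u. bump \<epsilon> (g u) * det (N u))"
proof -
  define F where "F t u = (1 - t) *\<^sub>R f u + t *\<^sub>R g u" for t u
  define A where "A t u = (1 - t) *\<^sub>R M u + t *\<^sub>R N u" for t u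
  define G where "G u = g u - f u" for u
  define H where "H u = N u - M u" for u
  define P where "P t u = (if u \<in> \<Omega> then bump \<epsilon> (F t u) * det (A t u) else 0)" for t u
  define P' where "P' t u = (if u \<in> \<Omega> then bump_deriv \<epsilon> (F t u) (G u) * det (A t u)
      + bump \<epsilon> (F t u) * (\<Sum>i\<in>UNIV. \<Sum>j\<in>UNIV. H u $ i $ j * row_cofactor (A t u) i j) else 0)" for t u
  define V where "V t j u = (if u \<in> \<Omega> then bump \<epsilon> (F t u) *
      (\<Sum>i\<in>UNIV. G u $ i * row_cofactor (A t u) i j) else 0)" for t j u
  define W where "W t j u = (if u \<in> \<Omega> then bump_deriv \<epsilon> (F t u) (column j (A t u)) *
      (\<Sum>i\<in>UNIV. G u $ i * row_cofactor (A t u) i j)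
      + bump \<epsilon> (F t u) * (\<Sum>i\<in>UNIV. H u $ i $ j * row_cofactor (A t u) i j) else 0)" for t j u

  have f': "(f has_derivative (*v) (M u)) (at u)" and g': "(g has_derivative (*v) (N u)) (at u)" for u
    using f g by (auto simp: diagonally_nonlinear_def)
  have contMN: "continuous_on UNIV M" "continuous_on UNIV N"
    using f g by (auto simp: diagonally_nonlinear_def)
  have contfg: "continuous_on UNIV f" "continuous_on UNIV g"
    using f' g' by (auto intro!: continuous_at_imp_continuous_on has_derivative_continuous)
  have F': "(F t has_derivative (*v) (A t u)) (at u)" for t u
    unfolding F_def A_def matrix_vector_mult_add_rdistrib scaleR_matrix_vector_assoc[symmetric]
    by (intro derivative_intros f' g')
  have G': "(G has_derivative (*v) (H u)) (at u)" for u
    unfolding G_def H_def matrix_vector_mult_diff_rdistrib by (intro derivative_intros f' g')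
  have A_line: "A t (u + s *\<^sub>R axis j 1) $ k $ l = A t u $ k $ l" if "\<not> (k = j \<and> l = j)" for t u s j k l
    using f g that unfolding diagonally_nonlinear_def A_def by simp

  have contF: "continuous_on UNIV (\<lambda>p. F (fst p) (snd p))"
    unfolding F_def by (intro continuous_intros continuous_on_compose2[OF contfg(1)]
      continuous_on_compose2[OF contfg(2)]) auto
  have contA: "continuous_on UNIV (\<lambda>p. A (fst p) (snd p))"
    unfolding A_def by (intro continuous_intros continuous_on_compose2[OF contMN(1)]
      continuous_on_compose2[OF contMN(2)]) auto
  have contG: "continuous_on UNIV (\<lambda>p::real \<times> (real ^ 'n). G (snd p))"
    unfolding G_def by (intro continuous_intros continuous_on_compose2[OF contfg(1)]
      continuous_on_compose2[OF contfg(2)]) auto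
  have contH: "continuous_on UNIV (\<lambda>p::real \<times> (real ^ 'n). H (snd p))"
    unfolding H_def by (intro continuous_intros continuous_on_compose2[OF contMN(1)]
      continuous_on_compose2[OF contMN(2)]) auto

  \<comment> \<open>outside \<open>K\<close> the bump vanishes at all times, and \<open>K\<close> stays away from the frontier,
    so the integrands extended by zero have continuous derivatives\<close>
  define K where "K = snd ` {p \<in> {0..1} \<times> closure \<Omega>. norm (F (fst p) (snd p)) \<le> \<epsilon>}"
  have "compact K"
  proof -
    have "compact (({0..1::real} \<times> closure \<Omega>) \<inter> {p. norm (F (fst p) (snd p)) \<le> \<epsilon>})"
      using \<Omega> by (intro compact_Int_closed compact_Times closed_Collect_le continuous_on_norm contF)
        (auto simp: compact_closure)
    then show ?thesis
      unfolding K_def by (intro compact_continuous_image continuous_intros) (simp add: Collect_conj_eq)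
  qed
  have "K \<subseteq> \<Omega>"
    using frontier \<Omega> by (force simp: K_def F_def frontier_def interior_open)
  have outside: "norm (F t u) > \<epsilon>" if "u \<in> \<Omega> - K" "t \<in> {0..1}" for t u
    using that closure_subset[of \<Omega>] unfolding K_def by force
  have cutoff: "continuous_on ({0..1} \<times> UNIV) (\<lambda>p. if snd p \<in> \<Omega> then Q p else 0)"
    if "continuous_on UNIV Q" and
      "\<And>t u. t \<in> {0..1} \<Longrightarrow> norm (F t u) > \<epsilon> \<Longrightarrow> Q (t, u) = 0" for Q :: "real \<times> (real ^ 'n) \<Rightarrow> real"
  proof -
    have "continuous_on ({0..1} \<times> closure \<Omega> \<union> {0..1} \<times> (- \<Omega>)) (\<lambda>p. if snd p \<in> \<Omega> then Q p else 0)"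
    proof (rule continuous_on_cases)
      show "\<forall>p. p \<in> {0..1} \<times> closure \<Omega> \<and> snd p \<notin> \<Omega> \<or> p \<in> {0..1} \<times> (- \<Omega>) \<and> snd p \<in> \<Omega> \<longrightarrow> Q p = 0"
        using frontier that(2) \<Omega> by (auto simp: F_def frontier_def interior_open)
    qed (use \<Omega> that(1) in \<open>auto intro!: closed_Times continuous_on_subset[of UNIV Q]\<close>)
    moreover have "{0..1} \<times> closure \<Omega> \<union> {0..1} \<times> (- \<Omega>) = {0..1::real} \<times> UNIV"
      using closure_subset by auto
    ultimately show ?thesis by simp
  qed

  have contP: "continuous_on ({0..1} \<times> UNIV) (\<lambda>p. P (fst p) (snd p))"
    unfolding P_def
    by (rule cutoff) (intro continuous_intros contF contA, use \<open>\<epsilon> > 0\<close> in \<open>simp add: bump_eq_0\<close>)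
  have contP': "continuous_on ({0..1} \<times> UNIV) (\<lambda>p. P' (fst p) (snd p))"
    unfolding P'_def
    by (rule cutoff) (intro continuous_intros contF contA contG contH,
        use \<open>\<epsilon> > 0\<close> in \<open>simp add: bump_eq_0 bump_deriv_eq_0\<close>)
  have contV: "continuous_on ({0..1} \<times> UNIV) (\<lambda>p. V (fst p) j (snd p))" for j
    unfolding V_def
    by (rule cutoff) (intro continuous_intros contF contA contG contH,
        use \<open>\<epsilon> > 0\<close> in \<open>simp add: bump_eq_0 bump_deriv_eq_0\<close>)
  have contW: "continuous_on ({0..1} \<times> UNIV) (\<lambda>p. W (fst p) j (snd p))" for j
    unfolding W_def column_def
    by (rule cutoff) (intro continuous_intros contF contA contG contH continuous_on_vec_lambda,
        use \<open>\<epsilon> > 0\<close> in \<open>simp add: bump_eq_0 bump_deriv_eq_0\<close>)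
  have slice: "continuous_on UNIV (Q t)" if "continuous_on ({0..1} \<times> UNIV) (\<lambda>p. Q (fst p) (snd p))"
    "t \<in> {0..1}" for Q :: "real \<Rightarrow> real ^ 'n \<Rightarrow> real" and t
  proof -
    have "continuous_on UNIV (\<lambda>u::real ^ 'n. (t, u))" by (intro continuous_intros)
    from continuous_on_compose2[OF that(1) this] show ?thesis
      using that(2) by (simp add: image_subset_iff)
  qed

  have V': "((\<lambda>s. V t j (u + s *\<^sub>R axis j 1)) has_field_derivative W t j u) (at 0)"
    if t: "t \<in> {0..1}" for t j u
  proof (cases "u \<in> \<Omega>")
    case True
    let ?v = "\<lambda>s. bump \<epsilon> (F t (u + s *\<^sub>R axis j 1)) * (\<Sum>i\<in>UNIV. G (u + s *\<^sub>R axis j 1) $ i * row_cofactor (A t u) i j)"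
    have "((\<lambda>s. G (u + s *\<^sub>R axis j 1) $ i) has_field_derivative H u $ i $ j) (at 0)" for i
    proof -
      have "((\<lambda>s. G (u + s *\<^sub>R axis j 1) $ i) has_vector_derivative column j (H u) $ i) (at 0)"
        by (rule bounded_linear.has_vector_derivative[OF bounded_linear_vec_nth
            has_vector_derivative_coordinate_line[OF G']])
      then show ?thesis
        by (simp add: has_real_derivative_iff_has_vector_derivative column_def)
    qed
    moreover have "((\<lambda>s. bump \<epsilon> (F t (u + s *\<^sub>R axis j 1))) has_field_derivative
        bump_deriv \<epsilon> (F t u) (column j (A t u))) (at 0)"
      using has_field_derivative_bump[OF has_vector_derivative_coordinate_line[OF F'[of t u], of j], of \<epsilon>]
      by simp
    ultimately have "(?v has_field_derivative W t j u) (at 0)"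
      using True by (auto intro!: derivative_eq_intros simp: W_def)
    then show ?thesis
    proof (rule has_field_derivative_transform_within_open)
      show "open ((\<lambda>s. u + s *\<^sub>R axis j 1) -` \<Omega>)"
        using \<Omega> by (intro open_vimage continuous_intros)
      fix s assume "s \<in> (\<lambda>s. u + s *\<^sub>R axis j 1) -` \<Omega>"
      moreover have "row_cofactor (A t (u + s *\<^sub>R axis j 1)) i j = row_cofactor (A t u) i j" for i
        by (rule row_cofactor_diagonal_entry) (rule A_line)
      ultimately show "?v s = V t j (u + s *\<^sub>R axis j 1)"
        by (simp add: V_def)
    qed (use True in simp)
  next
    case False
    have "((\<lambda>s. 0) has_field_derivative W t j u) (at 0)"
      using False by (simp add: W_def)
    then show ?thesis
    proof (rule has_field_derivative_transform_within_open)
      show "open ((\<lambda>s. u + s *\<^sub>R axis j 1) -` (- K))"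
        using \<open>compact K\<close> by (intro open_vimage continuous_intros) (simp add: compact_imp_closed)
      show "0 \<in> (\<lambda>s. u + s *\<^sub>R axis j 1) -` (- K)"
        using False \<open>K \<subseteq> \<Omega>\<close> by auto
      show "0 = V t j (u + s *\<^sub>R axis j 1)" if "s \<in> (\<lambda>s. u + s *\<^sub>R axis j 1) -` (- K)" for s
        using that outside[of "u + s *\<^sub>R axis j 1" t] t \<open>\<epsilon> > 0\<close> by (auto simp: V_def bump_eq_0)
    qed
  qed
  have W_integral: "(W t j has_integral 0) T" if t: "t \<in> {0..1}" and "\<Omega> \<subseteq> T" for t j T
  proof (rule has_integral_partial_derivative[OF V'[OF t] _ _ \<open>compact K\<close>])
    show "V t j u = 0" if "u \<notin> K" for u
      using that outside[of u t] t \<open>\<epsilon> > 0\<close> by (auto simp: V_def bump_eq_0)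
  qed (use slice[OF contV t] slice[OF contW t] \<open>K \<subseteq> \<Omega>\<close> that in auto)

  \<comment> \<open>row \<open>k\<close> of \<open>A\<close> paired with the cofactors of row \<open>i\<close> gives \<open>det A\<close> if \<open>k = i\<close> and 0 otherwise,
    so only the diagonal terms survive\<close>
  have P'_eq: "P' t u = (\<Sum>j\<in>UNIV. W t j u)" for t u
  proof (cases "u \<in> \<Omega>")
    case True
    let ?c = "- 4 * max 0 (\<epsilon>\<^sup>2 - F t u \<bullet> F t u)"
    have "(\<Sum>j\<in>UNIV. (F t u \<bullet> column j (A t u)) * (\<Sum>i\<in>UNIV. G u $ i * row_cofactor (A t u) i j))
        = (\<Sum>j\<in>UNIV. \<Sum>k\<in>UNIV. \<Sum>i\<in>UNIV. F t u $ k * G u $ i * (A t u $ k $ j * row_cofactor (A t u) i j))"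
      by (simp add: inner_vec_def column_def sum_distrib_left sum_distrib_right ac_simps)
    also have "\<dots> = (\<Sum>k\<in>UNIV. \<Sum>i\<in>UNIV. \<Sum>j\<in>UNIV. F t u $ k * G u $ i * (A t u $ k $ j * row_cofactor (A t u) i j))"
      by (subst sum.swap, rule sum.cong[OF refl], rule sum.swap)
    also have "\<dots> = (\<Sum>k\<in>UNIV. \<Sum>i\<in>UNIV. F t u $ k * G u $ i * (if k = i then det (A t u) else 0))"
      by (simp only: sum_distrib_left[symmetric] row_cofactor_expansion)
    also have "\<dots> = (F t u \<bullet> G u) * det (A t u)"
      by (simp add: inner_vec_def sum_distrib_right if_distrib cong: if_cong)
    finally have *: "(\<Sum>j\<in>UNIV. (F t u \<bullet> column j (A t u)) * (\<Sum>i\<in>UNIV. G u $ i * row_cofactor (A t u) i j))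
        = (F t u \<bullet> G u) * det (A t u)" .
    have "(\<Sum>j\<in>UNIV. W t j u) = ?c * (\<Sum>j\<in>UNIV. (F t u \<bullet> column j (A t u)) * (\<Sum>i\<in>UNIV. G u $ i * row_cofactor (A t u) i j))
        + bump \<epsilon> (F t u) * (\<Sum>j\<in>UNIV. \<Sum>i\<in>UNIV. H u $ i $ j * row_cofactor (A t u) i j)"
      using True by (simp add: W_def bump_deriv_def sum.distrib sum_distrib_left mult.assoc)
    also have "\<dots> = P' t u"
      unfolding * using True by (subst sum.swap) (simp add: P'_def bump_deriv_def)
    finally show ?thesis ..
  qed (simp add: P'_def W_def)

  have P_deriv: "((\<lambda>t. P t u) has_field_derivative P' t u) (at t)" for t u
  proof (cases "u \<in> \<Omega>")
    case True
    have "((\<lambda>t. A t u $ i $ j) has_field_derivative H u $ i $ j) (at t)" for i j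
      unfolding A_def H_def by (auto intro!: derivative_eq_intros)
    moreover have "((\<lambda>t. F t u) has_vector_derivative G u) (at t)"
      unfolding F_def G_def by (auto intro!: derivative_eq_intros)
    ultimately have "((\<lambda>t. bump \<epsilon> (F t u) * det (A t u)) has_field_derivative P' t u) (at t)"
      using True by (auto intro!: derivative_eq_intros has_field_derivative_det has_field_derivative_bump simp: P'_def)
    then show ?thesis
      using True by (simp add: P_def)
  qed (simp add: P_def P'_def)

  obtain a b where ab: "\<Omega> \<subseteq> cbox a b"
    using bounded_subset_cbox_symmetric[OF \<Omega>(2)] by blast
  have "((\<lambda>t. integral (cbox a b) (P t)) has_field_derivative 0) (at t within {0..1})"
    if t: "t \<in> {0..1}" for t
  proof -
    have "((\<lambda>t. integral (cbox a b) (P t)) has_field_derivative integral (cbox a b) (P' t)) (at t within {0..1})"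
    proof (rule leibniz_rule_field_derivative)
      show "((\<lambda>t. P t u) has_field_derivative P' t u) (at t within {0..1})" for t u
        by (rule has_field_derivative_at_within[OF P_deriv])
      show "P t integrable_on cbox a b" if "t \<in> {0..1}" for t
        using slice[OF contP that] by (intro integrable_continuous) (blast intro: continuous_on_subset)
      show "continuous_on ({0..1} \<times> cbox a b) (\<lambda>(t, u). P' t u)"
        unfolding split_def by (rule continuous_on_subset[OF contP']) auto
    qed (use t in auto)
    moreover have "(P' t has_integral 0) (cbox a b)"
      unfolding P'_eq using has_integral_sum[of UNIV "\<lambda>j. W t j" "\<lambda>j. 0" "cbox a b"] W_integral[OF t ab]
      by simp
    ultimately show ?thesis
      by (simp add: integral_unique)
  qed
  then obtain d where "integral (cbox a b) (P t) = d" if "t \<in> {0..1}" for t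
    using has_field_derivative_zero_constant[of "{0..1::real}" "\<lambda>t. integral (cbox a b) (P t)"] by auto
  then have "integral (cbox a b) (P 0) = integral (cbox a b) (P 1)"
    by simp
  then show ?thesis
    unfolding P_def F_def A_def by (simp add: Henstock_Kurzweil_Integration.integral_restrict_Int Int_absorb2[OF ab])
qed

section \<open>The bump integral counts zeros with sign\<close>

lemma bump_eq_0_outside:
  assumes "\<epsilon> > 0" and "ball 0 \<epsilon> \<subseteq> S" and "y \<notin> S"
  shows "bump \<epsilon> y = 0"
proof -
  have "y \<notin> ball 0 \<epsilon>" using assms by blast
  then show ?thesis using \<open>\<epsilon> > 0\<close> by (simp add: bump_eq_0)
qed

lemma bump_absolutely_integrable_on:
  fixes S :: "(real ^ 'n::finite) set"
  assumes "\<epsilon> > 0" and "ball 0 \<epsilon> \<subseteq> S"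
  shows "bump \<epsilon> absolutely_integrable_on S"
proof -
  obtain a :: "real ^ 'n" where a: "ball 0 \<epsilon> \<subseteq> cbox (- a) a"
    using bounded_subset_cbox_symmetric[OF bounded_ball] by blast
  have "bump \<epsilon> absolutely_integrable_on cbox (- a) a"
    by (intro absolutely_integrable_continuous continuous_on_bump continuous_on_id)
  moreover have "(\<lambda>y. if y \<in> cbox (- a) a then bump \<epsilon> y else 0) = (\<lambda>y. if y \<in> S then bump \<epsilon> y else 0)"
    using bump_eq_0_outside[OF \<open>\<epsilon> > 0\<close> a] bump_eq_0_outside[OF assms] by (auto simp: fun_eq_iff)
  ultimately show ?thesis
    using absolutely_integrable_restrict_UNIV[of "cbox (- a) a" "bump \<epsilon>"]
      absolutely_integrable_restrict_UNIV[of S "bump \<epsilon>"] by simp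
qed

lemma integral_bump:
  fixes S :: "(real ^ 'n::finite) set"
  assumes "\<epsilon> > 0" and "ball 0 \<epsilon> \<subseteq> S"
  shows "integral S (bump \<epsilon>) = integral UNIV (bump \<epsilon> :: real ^ 'n \<Rightarrow> real)"
proof -
  have "(\<lambda>y. if y \<in> S then bump \<epsilon> y else 0) = bump \<epsilon>"
    using bump_eq_0_outside[OF assms] by (auto simp: fun_eq_iff)
  then show ?thesis
    using Henstock_Kurzweil_Integration.integral_restrict_UNIV[of S "bump \<epsilon>"] by simp
qed

lemma integral_bump_pos:
  assumes "\<epsilon> > 0"
  shows "integral UNIV (bump \<epsilon> :: real ^ 'n::finite \<Rightarrow> real) > 0"
proof -
  obtain a :: "real ^ 'n" where a: "ball 0 \<epsilon> \<subseteq> cbox (- a) a"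
    using bounded_subset_cbox_symmetric[OF bounded_ball] by blast
  have cont: "continuous_on (cbox (- a) a) (bump \<epsilon> :: real ^ 'n \<Rightarrow> real)"
    by (intro continuous_on_bump continuous_on_id)
  have "integral (cbox (- a) a) (bump \<epsilon> :: real ^ 'n \<Rightarrow> real) \<noteq> 0"
  proof
    assume "integral (cbox (- a) a) (bump \<epsilon> :: real ^ 'n \<Rightarrow> real) = 0"
    then have "(bump \<epsilon> has_integral 0) (cbox (- a) a)"
      using cont by (simp add: has_integral_iff integrable_continuous)
    moreover have "(0 :: real ^ 'n) \<in> box (- a) a"
      using interior_maximal[OF a open_ball] \<open>\<epsilon> > 0\<close> centre_in_ball[of 0 \<epsilon>]
      unfolding interior_cbox by blast
    ultimately have "bump \<epsilon> (0 :: real ^ 'n) = 0"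
      using box_subset_cbox[of "- a" a]
      by (intro has_integral_0_cbox_imp_0[OF cont]) (auto simp: bump_nonneg)
    with bump_pos[of "0 :: real ^ 'n" \<epsilon>] \<open>\<epsilon> > 0\<close> show False by simp
  qed
  moreover have "integral (cbox (- a) a) (bump \<epsilon> :: real ^ 'n \<Rightarrow> real) \<ge> 0"
    using cont by (intro integral_nonneg integrable_continuous bump_nonneg)
  ultimately show ?thesis
    using integral_bump[OF assms a] by simp
qed

lemma open_det_sign:
  fixes M :: "real ^ 'n::finite \<Rightarrow> real ^ 'n ^ 'n"
  assumes "continuous_on UNIV M" and "det (M x) \<noteq> 0"
  shows "open {u. sgn (det (M u)) = sgn (det (M x))}"
proof -
  have "{u. sgn (det (M u)) = sgn (det (M x))} = {u. 0 < det (M u) * det (M x)}"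
    using assms(2) by (auto simp: sgn_if zero_less_mult_iff split: if_splits)
  moreover have "open {u. 0 < det (M u) * det (M x)}"
    using assms(1) by (intro open_Collect_less continuous_intros)
  ultimately show ?thesis by simp
qed

text \<open>
Besides injectivity and openness near a nondegenerate point, the neighbourhood is chosen so small
that the Jacobian determinant keeps its sign, so that the absolute value in the change of
variables formula can be resolved.
\<close>

lemma local_diffeomorphism:
  fixes f :: "real ^ 'n::finite \<Rightarrow> real ^ 'n"
  assumes f': "\<And>u. (f has_derivative (*v) (M u)) (at u)" and contM: "continuous_on UNIV M"
    and "det (M x) \<noteq> 0" and "open W" and "x \<in> W"
  obtains U where "open U" "x \<in> U" "U \<subseteq> W" "inj_on f U" "open (f ` U)"
    "\<And>u. u \<in> U \<Longrightarrow> sgn (det (M u)) = sgn (det (M x))"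
proof -
  define f' where "f' u = Blinfun ((*v) (M u))" for u
  have apply_f' [simp]: "blinfun_apply (f' u) = (*v) (M u)" for u
    unfolding f'_def by (intro bounded_linear_Blinfun_apply matrix_vector_mul_bounded_linear)
  have "continuous_on UNIV f'"
    by (rule continuous_on_blinfun_componentwise)
      (use contM in \<open>auto simp: matrix_vector_mult_def intro!: continuous_intros continuous_on_vec_lambda\<close>)
  let ?W = "W \<inter> {u. sgn (det (M u)) = sgn (det (M x))}"
  have openW: "open ?W"
    using open_det_sign[OF contM \<open>det (M x) \<noteq> 0\<close>] \<open>open W\<close> by blast
  obtain B where B: "B ** M x = mat 1"
    using \<open>det (M x) \<noteq> 0\<close> invertible_det_nz[of "M x"] unfolding invertible_def by blast
  have inv: "Blinfun ((*v) B) o\<^sub>L f' x = id_blinfun"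
  proof (rule blinfun_eqI)
    fix v
    show "blinfun_apply (Blinfun ((*v) B) o\<^sub>L f' x) v = blinfun_apply id_blinfun v"
      using B by (simp add: bounded_linear_Blinfun_apply matrix_vector_mul_bounded_linear matrix_vector_mul_assoc)
  qed
  have "x \<in> ?W" using \<open>x \<in> W\<close> by simp
  have der: "\<And>u. u \<in> ?W \<Longrightarrow> (f has_derivative blinfun_apply (f' u)) (at u)"
    using f' by simp
  have cont: "continuous_on ?W f'"
    using \<open>continuous_on UNIV f'\<close> continuous_on_subset by blast
  show ?thesis
  proof (rule inverse_function_theorem[OF openW der cont \<open>x \<in> ?W\<close> inv])
    fix U V g
    assume U: "open U" "U \<subseteq> ?W" "x \<in> U" "open V" and hom: "homeomorphism U V f g"
    have "f ` U = V" and "inj_on f U"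
      using hom by (auto simp: homeomorphism_def intro: inj_on_inverseI)
    then show thesis
      using U by (intro that[of U]) auto
  qed assumption
qed

text \<open>
On \<open>U\<close> the Jacobian determinant is \<open>\<sigma>\<close> times its absolute value, so a change of variables turns the
integral into \<open>\<sigma> \<integral> \<phi>\<close>.
\<close>

lemma integral_bump_diffeomorphism:
  fixes f :: "real ^ 'n::{finite,wellorder} \<Rightarrow> real ^ 'n::_"
  assumes f': "\<And>u. (f has_derivative (*v) (M u)) (at u)"
    and U: "open U" "inj_on f U" and sgn: "\<And>u. u \<in> U \<Longrightarrow> sgn (det (M u)) = \<sigma>"
    and "\<epsilon> > 0" and "ball 0 \<epsilon> \<subseteq> f ` U"
  shows "((\<lambda>u. bump \<epsilon> (f u) * det (M u)) has_integral integral UNIV (bump \<epsilon> :: real ^ 'n::_ \<Rightarrow> real) * \<sigma>) U"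
proof -
  let ?b = "\<lambda>y. vec (bump \<epsilon> y) :: real ^ 1"
  let ?I = "integral UNIV (bump \<epsilon> :: real ^ 'n::_ \<Rightarrow> real)"
  have "?b absolutely_integrable_on f ` U \<and> integral (f ` U) ?b = vec ?I"
    using bump_absolutely_integrable_on[OF \<open>\<epsilon> > 0\<close> \<open>ball 0 \<epsilon> \<subseteq> f ` U\<close>]
      integral_bump[OF \<open>\<epsilon> > 0\<close> \<open>ball 0 \<epsilon> \<subseteq> f ` U\<close>]
    by (simp add: absolutely_integrable_on_1_iff integral_on_1_eq)
  then have "(\<lambda>u. \<bar>det (matrix ((*v) (M u)))\<bar> *\<^sub>R ?b (f u)) absolutely_integrable_on U \<and>
      integral U (\<lambda>u. \<bar>det (matrix ((*v) (M u)))\<bar> *\<^sub>R ?b (f u)) = vec ?I"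
    using U f' by (subst has_absolute_integral_change_of_variables)
      (auto intro: has_derivative_at_withinI)
  then have "((\<lambda>u. \<bar>det (M u)\<bar> * bump \<epsilon> (f u)) has_integral ?I) U"
    by (auto simp: absolutely_integrable_on_1_iff integral_on_1_eq vec_eq_iff has_integral_iff
        dest: set_lebesgue_integral_eq_integral(1))
  then have "((\<lambda>u. \<bar>det (M u)\<bar> * bump \<epsilon> (f u) * \<sigma>) has_integral ?I * \<sigma>) U"
    by (rule has_integral_mult_left)
  then show ?thesis
  proof (rule has_integral_eq[rotated])
    fix u assume "u \<in> U"
    then have "det (M u) = \<sigma> * \<bar>det (M u)\<bar>"
      using sgn[of u] by (metis sgn_mult_abs)
    then show "\<bar>det (M u)\<bar> * bump \<epsilon> (f u) * \<sigma> = bump \<epsilon> (f u) * det (M u)"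
      by (simp add: mult.commute mult.left_commute)
  qed
qed

text \<open>
The zeros are isolated and form a compact set, hence they are finitely many. Around them choose
disjoint neighbourhoods on which \<open>f\<close> is a diffeomorphism. On the rest of the closure \<open>|f|\<close> is
bounded below, so for small \<open>\<epsilon>\<close> only these neighbourhoods contribute, each with \<open>\<plusminus> \<integral> \<phi>\<close>.
\<close>

lemma bump_integral_eq_signed_count:
  fixes f :: "real ^ 'n::{finite,wellorder} \<Rightarrow> real ^ 'n::_"
  assumes f': "\<And>u. (f has_derivative (*v) (M u)) (at u)" and contM: "continuous_on UNIV M"
    and \<Omega>: "open \<Omega>" "bounded \<Omega>" and frontier: "\<And>u. u \<in> frontier \<Omega> \<Longrightarrow> f u \<noteq> 0"
    and regular: "\<And>u. u \<in> \<Omega> \<Longrightarrow> f u = 0 \<Longrightarrow> det (M u) \<noteq> 0"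
  obtains \<epsilon>\<^sub>1 where "\<epsilon>\<^sub>1 > 0" "\<forall>\<epsilon>\<in>{0<..\<epsilon>\<^sub>1}.
    integral \<Omega> (\<lambda>u. bump \<epsilon> (f u) * det (M u))
      = integral UNIV (bump \<epsilon> :: real ^ 'n::_ \<Rightarrow> real) * (\<Sum>x\<in>{x\<in>\<Omega>. f x = 0}. sgn (det (M x)))"
proof -
  define S where "S = {x\<in>\<Omega>. f x = 0}"
  have contf: "continuous_on UNIV f"
    using has_derivative_continuous[OF f'] by (simp add: continuous_at_imp_continuous_on)
  have "closure \<Omega> = \<Omega> \<union> frontier \<Omega>"
    using closure_Un_frontier[of \<Omega>] .
  then have S_eq: "S = closure \<Omega> \<inter> f -` {0}"
    unfolding S_def using frontier by blast
  have "compact (closure \<Omega> \<inter> f -` {0})"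
    by (rule compact_Int_closed[OF _ closed_vimage[OF closed_singleton contf]])
      (simp add: compact_closure \<Omega>)
  then have "compact S"
    by (simp only: S_eq)
  have "finite S"
  proof -
    have "\<exists>U. \<forall>x\<in>S. open (U x) \<and> x \<in> U x \<and> inj_on f (U x)"
    proof (intro bchoice ballI)
      fix x assume "x \<in> S"
      then have "det (M x) \<noteq> 0" using regular by (simp add: S_def)
      then obtain U where "open U" "x \<in> U" "inj_on f U"
        by (rule local_diffeomorphism[OF f' contM _ open_UNIV UNIV_I])
      then show "\<exists>U. open U \<and> x \<in> U \<and> inj_on f U" by blast
    qed
    then obtain U where U: "\<forall>x\<in>S. open (U x) \<and> x \<in> U x \<and> inj_on f (U x)"
      by (rule exE)
    obtain C where "C \<subseteq> S" "finite C" "S \<subseteq> (\<Union>x\<in>C. U x)"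
      by (rule compactE_image[OF \<open>compact S\<close>, of S U]) (use U in auto)
    moreover have "U x \<inter> S \<subseteq> {x}" if "x \<in> S" for x
      using U that by (auto simp: S_def inj_on_def)
    ultimately have "S \<subseteq> C" by blast
    then show ?thesis using \<open>finite C\<close> finite_subset by blast
  qed
  have "\<exists>r. \<forall>x. 0 < r x \<and> (\<forall>y\<in>S. y \<noteq> x \<longrightarrow> 2 * r x \<le> dist x y)"
  proof (intro choice allI)
    fix x
    obtain d where "d > 0" "\<forall>y\<in>S. y \<noteq> x \<longrightarrow> d \<le> dist x y"
      using finite_set_avoid[OF \<open>finite S\<close>, of x] by blast
    then show "\<exists>r. 0 < r \<and> (\<forall>y\<in>S. y \<noteq> x \<longrightarrow> 2 * r \<le> dist x y)"
      by (intro exI[of _ "d / 2"]) simp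
  qed
  then obtain r where "\<forall>x. 0 < r x \<and> (\<forall>y\<in>S. y \<noteq> x \<longrightarrow> 2 * r x \<le> dist x y)"
    by (rule exE)
  then have r: "\<And>x. r x > 0" "\<And>x y. y \<in> S \<Longrightarrow> y \<noteq> x \<Longrightarrow> 2 * r x \<le> dist x y"
    by auto
  have "\<exists>U. \<forall>x\<in>S. open (U x) \<and> x \<in> U x \<and> U x \<subseteq> \<Omega> \<inter> ball x (r x) \<and>
      inj_on f (U x) \<and> open (f ` U x) \<and> (\<forall>u\<in>U x. sgn (det (M u)) = sgn (det (M x)))"
  proof (intro bchoice ballI)
    fix x assume "x \<in> S"
    then have "det (M x) \<noteq> 0" and "open (\<Omega> \<inter> ball x (r x))" and "x \<in> \<Omega> \<inter> ball x (r x)"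
      using regular \<Omega> r(1)[of x] by (auto simp: S_def)
    then obtain U where "open U" "x \<in> U" "U \<subseteq> \<Omega> \<inter> ball x (r x)" "inj_on f U" "open (f ` U)"
        "\<And>u. u \<in> U \<Longrightarrow> sgn (det (M u)) = sgn (det (M x))"
      by (rule local_diffeomorphism[OF f' contM]) blast
    then show "\<exists>U. open (U) \<and> x \<in> U \<and> U \<subseteq> \<Omega> \<inter> ball x (r x) \<and>
      inj_on f (U) \<and> open (f ` U) \<and> (\<forall>u\<in>U. sgn (det (M u)) = sgn (det (M x)))"
      by blast
  qed
  then obtain U where "\<forall>x\<in>S. open (U x) \<and> x \<in> U x \<and> U x \<subseteq> \<Omega> \<inter> ball x (r x) \<and>
      inj_on f (U x) \<and> open (f ` U x) \<and> (\<forall>u\<in>U x. sgn (det (M u)) = sgn (det (M x)))"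
    by (rule exE)
  then have U: "\<And>x. x \<in> S \<Longrightarrow> open (U x) \<and> x \<in> U x \<and> U x \<subseteq> \<Omega> \<inter> ball x (r x) \<and>
      inj_on f (U x) \<and> open (f ` U x) \<and> (\<forall>u\<in>U x. sgn (det (M u)) = sgn (det (M x)))"
    by (rule bspec)
  define C where "C = closure \<Omega> - (\<Union>x\<in>S. U x)"
  have "compact C"
    unfolding C_def using \<Omega> U by (intro compact_diff) (auto simp: compact_closure)
  then have "closed (f ` C)"
    by (intro compact_imp_closed compact_continuous_image continuous_on_subset[OF contf]) auto
  have "0 \<notin> f ` C"
    using U S_eq by (force simp: C_def)
  \<comment> \<open>values in \<open>O'\<close> are taken in every chosen neighbourhood and nowhere else in the closure\<close>
  define O' where "O' = (\<Inter>x\<in>S. f ` U x) \<inter> - (f ` C)"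
  have "open O'"
    unfolding O'_def using \<open>finite S\<close> U \<open>closed (f ` C)\<close> by (intro open_Int open_INT) auto
  moreover have "0 \<in> O'"
    using U \<open>0 \<notin> f ` C\<close> unfolding O'_def S_def by (auto intro: image_eqI[of _ f])
  ultimately obtain e where e: "e > 0" "ball 0 e \<subseteq> O'"
    using open_contains_ball by blast
  show ?thesis
  proof (rule that[OF e(1)], rule ballI)
    fix \<epsilon> :: real assume "\<epsilon> \<in> {0<..e}"
    then have \<epsilon>: "0 < \<epsilon>" "\<epsilon> \<le> e" by simp_all
    have sub: "ball 0 \<epsilon> \<subseteq> O'" using \<epsilon> e by (auto simp: subset_iff)
    let ?Z = "integral UNIV (bump \<epsilon> :: real ^ 'n::_ \<Rightarrow> real)"
    let ?h = "\<lambda>u. bump \<epsilon> (f u) * det (M u)"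
    have pieces: "(?h has_integral ?Z * sgn (det (M x))) (U x)" if "x \<in> S" for x
    proof -
      have Ux: "open (U x)" "inj_on f (U x)" "\<And>u. u \<in> U x \<Longrightarrow> sgn (det (M u)) = sgn (det (M x))"
        using U[OF that] by blast+
      have "ball 0 \<epsilon> \<subseteq> f ` U x"
        using sub that unfolding O'_def by blast
      from integral_bump_diffeomorphism[OF f' Ux \<epsilon>(1) this] show ?thesis .
    qed
    have disjoint: "U x \<inter> U y = {}" if "x \<in> S" "y \<in> S" "x \<noteq> y" for x y
    proof -
      have False if "z \<in> U x" "z \<in> U y" for z
      proof -
        have "dist x z < r x" "dist y z < r y"
          using that U[OF \<open>x \<in> S\<close>] U[OF \<open>y \<in> S\<close>] unfolding mem_ball[symmetric] by blast+
        moreover have "dist x y \<le> dist x z + dist y z"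
          by (metis dist_commute dist_triangle)
        ultimately show False
          using r(2)[of y x] r(2)[of x y] \<open>x \<in> S\<close> \<open>y \<in> S\<close> \<open>x \<noteq> y\<close> by (simp add: dist_commute)
      qed
      then show ?thesis by blast
    qed
    have "pairwise (\<lambda>x y. negligible (U x \<inter> U y)) S"
      by (rule pairwiseI) (simp add: disjoint)
    from has_integral_UN[OF \<open>finite S\<close> pieces this]
    have "(?h has_integral (\<Sum>x\<in>S. ?Z * sgn (det (M x)))) (\<Union>x\<in>S. U x)" .
    moreover have "(\<Union>x\<in>S. U x) \<subseteq> \<Omega>" using U by blast
    ultimately have "((\<lambda>u. if u \<in> (\<Union>x\<in>S. U x) then ?h u else 0) has_integral (\<Sum>x\<in>S. ?Z * sgn (det (M x)))) \<Omega>"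
      by (simp only: has_integral_restrict)
    then have "(?h has_integral (\<Sum>x\<in>S. ?Z * sgn (det (M x)))) \<Omega>"
    proof (rule has_integral_eq[rotated])
      fix u assume "u \<in> \<Omega>"
      show "(if u \<in> (\<Union>x\<in>S. U x) then ?h u else 0) = ?h u"
      proof (cases "u \<in> (\<Union>x\<in>S. U x)")
        case False
        then have "f u \<in> f ` C"
          using \<open>u \<in> \<Omega>\<close> closure_subset[of \<Omega>] unfolding C_def by blast
        then have "f u \<notin> ball 0 \<epsilon>"
          using sub unfolding O'_def by blast
        then show ?thesis
          using \<epsilon> False bump_eq_0[of \<epsilon> "f u"] by simp
      qed simp
    qed
    then show "integral \<Omega> ?h = ?Z * (\<Sum>x\<in>{x \<in> \<Omega>. f x = 0}. sgn (det (M x)))"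
      by (simp add: integral_unique S_def sum_distrib_left)
  qed
qed

section \<open>The degree of diagonally nonlinear maps\<close>

lemma diagonally_nonlinearD:
  assumes "diagonally_nonlinear f M"
  shows "(f has_derivative (*v) (M u)) (at u)" and "continuous_on UNIV M" and "continuous_on UNIV f"
  using assms
  by (auto simp: diagonally_nonlinear_def
      intro!: continuous_at_imp_continuous_on has_derivative_continuous)

lemma diagonally_nonlinear_diff_const:
  "diagonally_nonlinear f M \<Longrightarrow> diagonally_nonlinear (\<lambda>u. f u - q) M"
  unfolding diagonally_nonlinear_def by (auto intro!: derivative_eq_intros)

lemma jacobian_eq:
  fixes f :: "real ^ 'n::finite \<Rightarrow> real ^ 'm::finite"
  shows "(f has_derivative (*v) A) (at u) \<Longrightarrow> jacobian f (at u) = A"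
  by (simp add: jacobian_def frechet_derivative_at[symmetric] matrix_of_matrix_vector_mul)

text \<open>
Compactness of \<open>[0, 1] \<times> frontier \<Omega>\<close> turns pointwise nonvanishing into a uniform gap.
\<close>

lemma homotopy_frontier_gap:
  fixes f g :: "real ^ 'n::finite \<Rightarrow> real ^ 'n"
  assumes "continuous_on UNIV f" and "continuous_on UNIV g" and "bounded \<Omega>"
    and nz: "\<And>t u. t \<in> {0..1} \<Longrightarrow> u \<in> frontier \<Omega> \<Longrightarrow> (1 - t) *\<^sub>R f u + t *\<^sub>R g u \<noteq> 0"
  obtains e where "e > 0" "\<forall>t\<in>{0..1}. \<forall>u\<in>frontier \<Omega>.
    norm ((1 - t) *\<^sub>R f u + t *\<^sub>R g u) > e"
proof -
  let ?F = "\<lambda>p. (1 - fst p) *\<^sub>R f (snd p) + fst p *\<^sub>R g (snd p)"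
  have "continuous_on UNIV (\<lambda>p::real \<times> (real ^ 'n). ?F p)"
    by (intro continuous_intros continuous_on_compose2[OF assms(1)] continuous_on_compose2[OF assms(2)]) auto
  moreover define S where "S = ?F ` ({0..1} \<times> frontier \<Omega>)"
  ultimately have "compact S"
    unfolding S_def using \<open>bounded \<Omega>\<close>
    by (intro compact_continuous_image compact_Times compact_frontier_bounded)
      (auto intro: continuous_on_subset)
  then have "open (- S)"
    by (simp add: compact_imp_closed open_Compl)
  moreover have "0 \<in> - S"
    using nz by (auto simp: S_def)
  ultimately obtain e where e: "e > 0" "cball 0 e \<subseteq> - S"
    unfolding open_contains_cball by blast
  show ?thesis
  proof (rule that[OF e(1)], intro ballI)
    fix t u assume "t \<in> {0..1::real}" "u \<in> frontier \<Omega>"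
    then have "?F (t, u) \<in> S" unfolding S_def by (intro imageI) auto
    then have "?F (t, u) \<notin> cball 0 e" using e(2) by blast
    then show "norm ((1 - t) *\<^sub>R f u + t *\<^sub>R g u) > e" by simp
  qed
qed

lemma regular_value_exists:
  fixes f :: "real ^ 'n::{finite,wellorder} \<Rightarrow> real ^ 'n::_"
  assumes f': "\<And>u. (f has_derivative (*v) (M u)) (at u)" and "e > 0"
  obtains q where "q \<in> ball 0 e" "\<And>u. f u = q \<Longrightarrow> det (M u) \<noteq> 0"
proof -
  have "negligible (f ` {u. det (M u) = 0})"
  proof (rule baby_Sard[where f' = "\<lambda>u. (*v) (M u)"])
    show "(f has_derivative (*v) (M u)) (at u within {u. det (M u) = 0})" for u
      by (rule has_derivative_at_withinI[OF f'])
    show "rank (matrix ((*v) (M u))) < CARD('n)" if "u \<in> {u. det (M u) = 0}" for u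
      using that by (simp add: det_eq_0_rank)
  qed simp
  moreover have "\<not> negligible (ball (0 :: real ^ 'n::_) e)"
    using \<open>e > 0\<close> by (intro open_not_negligible) auto
  ultimately have "\<not> ball 0 e \<subseteq> f ` {u. det (M u) = 0}"
    using negligible_subset by blast
  then show ?thesis using that by blast
qed

text \<open>
The signed count is the bump integral divided by \<open>\<integral> \<phi>\<close> at either end, as soon as \<open>\<epsilon>\<close> is small enough
for both counts and for the homotopy; the bump integral is the same at both ends.
\<close>

lemma signed_count_homotopy:
  fixes f g :: "real ^ 'n::{finite,wellorder} \<Rightarrow> real ^ 'n::_"
  assumes f: "diagonally_nonlinear f M" and g: "diagonally_nonlinear g N"
    and \<Omega>: "open \<Omega>" "bounded \<Omega>"
    and nz: "\<And>t u. t \<in> {0..1} \<Longrightarrow> u \<in> frontier \<Omega> \<Longrightarrow> (1 - t) *\<^sub>R f u + t *\<^sub>R g u \<noteq> 0"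
    and regf: "\<And>u. u \<in> \<Omega> \<Longrightarrow> f u = 0 \<Longrightarrow> det (M u) \<noteq> 0"
    and regg: "\<And>u. u \<in> \<Omega> \<Longrightarrow> g u = 0 \<Longrightarrow> det (N u) \<noteq> 0"
  shows "(\<Sum>x\<in>{x\<in>\<Omega>. f x = 0}. sgn (det (M x))) = (\<Sum>x\<in>{x\<in>\<Omega>. g x = 0}. sgn (det (N x)))"
proof -
  obtain e where e: "e > 0" "\<forall>t\<in>{0..1}. \<forall>u\<in>frontier \<Omega>.
      norm ((1 - t) *\<^sub>R f u + t *\<^sub>R g u) > e"
    by (rule homotopy_frontier_gap[OF diagonally_nonlinearD(3)[OF f] diagonally_nonlinearD(3)[OF g]
        \<Omega>(2) nz]) blast
  have "f u \<noteq> 0" "g u \<noteq> 0" if "u \<in> frontier \<Omega>" for u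
    using nz[of 0 u] nz[of 1 u] that by auto
  note f0 = this(1) and g0 = this(2)
  obtain e\<^sub>f where ef: "e\<^sub>f > 0" "\<forall>\<epsilon>\<in>{0<..e\<^sub>f}.
      integral \<Omega> (\<lambda>u. bump \<epsilon> (f u) * det (M u))
        = integral UNIV (bump \<epsilon> :: real ^ 'n::_ \<Rightarrow> real) * (\<Sum>x\<in>{x\<in>\<Omega>. f x = 0}. sgn (det (M x)))"
    by (rule bump_integral_eq_signed_count[OF diagonally_nonlinearD(1,2)[OF f] \<Omega> f0 regf]) blast
  obtain e\<^sub>g where eg: "e\<^sub>g > 0" "\<forall>\<epsilon>\<in>{0<..e\<^sub>g}.
      integral \<Omega> (\<lambda>u. bump \<epsilon> (g u) * det (N u))
        = integral UNIV (bump \<epsilon> :: real ^ 'n::_ \<Rightarrow> real) * (\<Sum>x\<in>{x\<in>\<Omega>. g x = 0}. sgn (det (N x)))"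
    by (rule bump_integral_eq_signed_count[OF diagonally_nonlinearD(1,2)[OF g] \<Omega> g0 regg]) blast
  define \<epsilon> where "\<epsilon> = min e (min e\<^sub>f e\<^sub>g)"
  have \<epsilon>: "\<epsilon> > 0" "\<epsilon> \<le> e" "\<epsilon> \<le> e\<^sub>f" "\<epsilon> \<le> e\<^sub>g"
    using e(1) ef(1) eg(1) by (auto simp: \<epsilon>_def)
  have "integral \<Omega> (\<lambda>u. bump \<epsilon> (f u) * det (M u)) = integral \<Omega> (\<lambda>u. bump \<epsilon> (g u) * det (N u))"
    using e(2) \<epsilon> by (intro bump_integral_homotopy[OF f g \<Omega> \<epsilon>(1)]) (auto intro: le_less_trans)
  then show ?thesis
    using ef(2)[rule_format, of \<epsilon>] eg(2)[rule_format, of \<epsilon>] \<epsilon> integral_bump_pos[OF \<epsilon>(1), where 'n = 'n]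
    by simp
qed

lemma has_brouwer_degree_iff:
  fixes f :: "real ^ 'n::finite \<Rightarrow> real ^ 'n"
  assumes f: "diagonally_nonlinear f M" and \<Omega>: "open \<Omega>" "bounded \<Omega>"
  shows "has_brouwer_degree f \<Omega> 0 d \<longleftrightarrow> (\<forall>u\<in>frontier \<Omega>. f u \<noteq> 0) \<and>
    (\<exists>\<epsilon>>0. \<forall>q\<in>ball 0 \<epsilon>. (\<forall>u\<in>\<Omega>. f u = q \<longrightarrow> det (M u) \<noteq> 0) \<longrightarrow>
      of_int d = (\<Sum>x\<in>{x\<in>\<Omega>. f x = q}. sgn (det (M x))))"
proof -
  have [simp]: "jacobian f (at u) = M u" for u
    by (rule jacobian_eq[OF diagonally_nonlinearD(1)[OF f]])
  have "continuous_on (closure \<Omega>) f" "continuous_on \<Omega> M" "\<forall>u\<in>\<Omega>. f differentiable (at u)"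
    using diagonally_nonlinearD[OF f] by (auto intro: continuous_on_subset differentiableI)
  then show ?thesis
    using \<Omega> unfolding has_brouwer_degree_def regular_value_on_def by (auto simp: image_iff)
qed

text \<open>
Zero need not be regular for \<open>f\<close> or \<open>g\<close>. Shifting both maps by small regular values \<open>q\<close> and \<open>q'\<close> keeps
the homotopy away from 0 on the frontier and reduces the claim to signed counts; Sard's theorem
provides \<open>q'\<close>.
\<close>

lemma has_brouwer_degree_homotopy:
  fixes f g :: "real ^ 'n::{finite,wellorder} \<Rightarrow> real ^ 'n::_"
  assumes f: "diagonally_nonlinear f M" and g: "diagonally_nonlinear g N"
    and \<Omega>: "open \<Omega>" "bounded \<Omega>"
    and nz: "\<And>t u. t \<in> {0..1} \<Longrightarrow> u \<in> frontier \<Omega> \<Longrightarrow> (1 - t) *\<^sub>R f u + t *\<^sub>R g u \<noteq> 0"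
    and deg: "has_brouwer_degree g \<Omega> 0 d"
  shows "has_brouwer_degree f \<Omega> 0 d"
proof -
  obtain e where e: "e > 0" "\<forall>t\<in>{0..1}. \<forall>u\<in>frontier \<Omega>.
      norm ((1 - t) *\<^sub>R f u + t *\<^sub>R g u) > e"
    by (rule homotopy_frontier_gap[OF diagonally_nonlinearD(3)[OF f] diagonally_nonlinearD(3)[OF g]
        \<Omega>(2) nz]) blast
  obtain \<epsilon> where \<epsilon>: "\<epsilon> > 0" "\<forall>q\<in>ball 0 \<epsilon>. (\<forall>u\<in>\<Omega>. g u = q \<longrightarrow> det (N u) \<noteq> 0) \<longrightarrow>
      of_int d = (\<Sum>x\<in>{x\<in>\<Omega>. g x = q}. sgn (det (N x)))"
    using deg unfolding has_brouwer_degree_iff[OF g \<Omega>] by blast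
  have "min e \<epsilon> > 0" using e(1) \<epsilon>(1) by simp
  then obtain q' where q': "q' \<in> ball 0 (min e \<epsilon>)" "\<And>u. g u = q' \<Longrightarrow> det (N u) \<noteq> 0"
    by (rule regular_value_exists[OF diagonally_nonlinearD(1)[OF g]]) blast
  have "of_int d = (\<Sum>x\<in>{x\<in>\<Omega>. f x = q}. sgn (det (M x)))"
    if q: "q \<in> ball 0 e" and reg: "\<forall>u\<in>\<Omega>. f u = q \<longrightarrow> det (M u) \<noteq> 0" for q
  proof -
    have "(\<Sum>x\<in>{x\<in>\<Omega>. f x - q = 0}. sgn (det (M x))) = (\<Sum>x\<in>{x\<in>\<Omega>. g x - q' = 0}. sgn (det (N x)))"
    proof (rule signed_count_homotopy[OF diagonally_nonlinear_diff_const[OF f]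
          diagonally_nonlinear_diff_const[OF g] \<Omega>])
      fix t :: real and u assume t: "t \<in> {0..1}" and u: "u \<in> frontier \<Omega>"
      have "(1 - t) *\<^sub>R q + t *\<^sub>R q' \<in> ball 0 e"
        using q q'(1) t by (intro convexD_alt[OF convex_ball]) auto
      moreover have "(1 - t) *\<^sub>R f u + t *\<^sub>R g u \<notin> ball 0 e"
        using e(2)[rule_format, OF t u] by simp
      ultimately have "(1 - t) *\<^sub>R f u + t *\<^sub>R g u \<noteq> (1 - t) *\<^sub>R q + t *\<^sub>R q'"
        by metis
      then show "(1 - t) *\<^sub>R (f u - q) + t *\<^sub>R (g u - q') \<noteq> 0"
        by (simp add: algebra_simps)
    qed (use reg q'(2) in auto)
    also have "\<dots> = of_int d"
      using \<epsilon>(2)[rule_format, of q'] q' by simp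
    finally show ?thesis by simp
  qed
  moreover have "f u \<noteq> 0" if "u \<in> frontier \<Omega>" for u
    using nz[of 0 u] that by simp
  ultimately show ?thesis
    unfolding has_brouwer_degree_iff[OF f \<Omega>] using e(1) by blast
qed

lemma has_brouwer_degree_regular:
  fixes f :: "real ^ 'n::{finite,wellorder} \<Rightarrow> real ^ 'n::_"
  assumes f: "diagonally_nonlinear f M" and \<Omega>: "open \<Omega>" "bounded \<Omega>"
    and nz: "\<And>u. u \<in> frontier \<Omega> \<Longrightarrow> f u \<noteq> 0"
    and reg: "\<And>u. u \<in> \<Omega> \<Longrightarrow> f u = 0 \<Longrightarrow> det (M u) \<noteq> 0"
    and d: "of_int d = (\<Sum>x\<in>{x\<in>\<Omega>. f x = 0}. sgn (det (M x)))"
  shows "has_brouwer_degree f \<Omega> 0 d"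
proof -
  have "(1 - t) *\<^sub>R f u + t *\<^sub>R f u \<noteq> 0" if "u \<in> frontier \<Omega>" for t u
    using nz[OF that] by (simp add: algebra_simps)
  note nz' = this
  obtain e where e: "e > 0" "\<forall>t\<in>{0..1}. \<forall>u\<in>frontier \<Omega>.
      norm ((1 - t) *\<^sub>R f u + t *\<^sub>R f u) > e"
    by (rule homotopy_frontier_gap[OF diagonally_nonlinearD(3)[OF f] diagonally_nonlinearD(3)[OF f]
        \<Omega>(2) nz']) blast
  have "of_int d = (\<Sum>x\<in>{x\<in>\<Omega>. f x = q}. sgn (det (M x)))"
    if q: "q \<in> ball 0 e" and regq: "\<forall>u\<in>\<Omega>. f u = q \<longrightarrow> det (M u) \<noteq> 0" for q
  proof -
    have "(\<Sum>x\<in>{x\<in>\<Omega>. f x - q = 0}. sgn (det (M x))) = (\<Sum>x\<in>{x\<in>\<Omega>. f x = 0}. sgn (det (M x)))"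
    proof (rule signed_count_homotopy[OF diagonally_nonlinear_diff_const[OF f] f \<Omega>])
      fix t :: real and u assume t: "t \<in> {0..1}" and u: "u \<in> frontier \<Omega>"
      have "norm ((1 - t) *\<^sub>R q) \<le> 1 * norm q"
        using t unfolding norm_scaleR by (intro mult_right_mono) auto
      moreover have "norm (f u) > e"
        using e(2)[rule_format, OF t u] by (simp add: scaleR_left_distrib[symmetric])
      moreover have "norm q < e"
        using q by simp
      ultimately have "f u \<noteq> (1 - t) *\<^sub>R q"
        by (auto simp del: norm_scaleR)
      then show "(1 - t) *\<^sub>R (f u - q) + t *\<^sub>R f u \<noteq> 0"
        by (simp add: algebra_simps)
    qed (use reg regq in auto)
    then show ?thesis using d by simp
  qed
  then show ?thesis
    unfolding has_brouwer_degree_iff[OF f \<Omega>] using e(1) nz by blast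
qed

text \<open>
Uniqueness of the degree: by Sard's theorem a common regular value is available near 0, and it
determines the count.
\<close>

lemma brouwer_degree_eqI:
  fixes f :: "real ^ 'n::{finite,wellorder} \<Rightarrow> real ^ 'n::_"
  assumes f: "diagonally_nonlinear f M" and d: "has_brouwer_degree f \<Omega> 0 d"
  shows "brouwer_degree f \<Omega> 0 = d"
  unfolding brouwer_degree_def
proof (rule the_equality, rule d)
  fix d' assume d': "has_brouwer_degree f \<Omega> 0 d'"
  have \<Omega>: "open \<Omega>" "bounded \<Omega>"
    using d by (auto simp: has_brouwer_degree_def)
  obtain \<epsilon> where \<epsilon>: "\<epsilon> > 0" "\<forall>q\<in>ball 0 \<epsilon>. (\<forall>u\<in>\<Omega>. f u = q \<longrightarrow> det (M u) \<noteq> 0) \<longrightarrow>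
      of_int d = (\<Sum>x\<in>{x\<in>\<Omega>. f x = q}. sgn (det (M x)))"
    using d unfolding has_brouwer_degree_iff[OF f \<Omega>] by blast
  obtain \<epsilon>' where \<epsilon>': "\<epsilon>' > 0" "\<forall>q\<in>ball 0 \<epsilon>'. (\<forall>u\<in>\<Omega>. f u = q \<longrightarrow> det (M u) \<noteq> 0) \<longrightarrow>
      of_int d' = (\<Sum>x\<in>{x\<in>\<Omega>. f x = q}. sgn (det (M x)))"
    using d' unfolding has_brouwer_degree_iff[OF f \<Omega>] by blast
  have "min \<epsilon> \<epsilon>' > 0" using \<epsilon>(1) \<epsilon>'(1) by simp
  then obtain q where "q \<in> ball 0 (min \<epsilon> \<epsilon>')" "\<And>u. f u = q \<Longrightarrow> det (M u) \<noteq> 0"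
    by (rule regular_value_exists[OF diagonally_nonlinearD(1)[OF f]]) blast
  then have "(of_int d :: real) = of_int d'"
    using \<epsilon>(2)[rule_format, of q] \<epsilon>'(2)[rule_format, of q] by simp
  then show "d' = d" by simp
qed

section \<open>The graph Laplacian and its maximum principle\<close>

text \<open>
The edge set is recovered from the positive weights, so only the weights and the measure remain
as parameters. Functions on the vertices are plain functions here; vectors return with the degree.
\<close>

locale weighted_graph =
  fixes \<omega> :: "'v::finite \<Rightarrow> 'v \<Rightarrow> real" and \<mu> :: "'v \<Rightarrow> real"
  assumes weight_sym: "\<omega> x y = \<omega> y x"
    and weight_nonneg: "\<omega> x y \<ge> 0"
    and connected: "(\<lambda>a b. \<omega> a b > 0)\<^sup>*\<^sup>* x y"
    and measure_pos: "\<mu> x > 0"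
begin

definition lap :: "('v \<Rightarrow> real) \<Rightarrow> 'v \<Rightarrow> real" where
  "lap u x = (1 / \<mu> x) * (\<Sum>y\<in>UNIV. \<omega> x y * (u y - u x))"

lemma measure_times_lap: "\<mu> x * lap u x = (\<Sum>y\<in>UNIV. \<omega> x y * (u y - u x))"
  using measure_pos[of x] by (simp add: lap_def)

lemma lap_uminus: "lap (\<lambda>x. - u x) x = - lap u x"
proof -
  have "(\<Sum>y\<in>UNIV. \<omega> x y * (- u y - - u x)) = - (\<Sum>y\<in>UNIV. \<omega> x y * (u y - u x))"
    unfolding sum_negf[symmetric] by (intro sum.cong refl) (simp add: algebra_simps)
  then show ?thesis by (simp add: lap_def)
qed

lemma lap_add_const: "lap (\<lambda>x. u x + a) x = lap u x"
  by (simp add: lap_def)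

lemma sum_measure_lap: "(\<Sum>x\<in>UNIV. \<mu> x * lap u x) = 0"
proof -
  have "(\<Sum>x\<in>UNIV. \<Sum>y\<in>UNIV. \<omega> x y * u y) = (\<Sum>x\<in>UNIV. \<Sum>y\<in>UNIV. \<omega> x y * u x)"
    by (subst sum.swap) (simp add: weight_sym)
  then show ?thesis
    by (simp add: measure_times_lap algebra_simps sum_subtractf)
qed

lemma dirichlet_energy:
  "(\<Sum>x\<in>UNIV. \<mu> x * lap u x * u x) = - (\<Sum>x\<in>UNIV. \<Sum>y\<in>UNIV. \<omega> x y * (u x - u y)\<^sup>2) / 2"
proof -
  let ?S = "\<lambda>g. \<Sum>x\<in>UNIV. \<Sum>y\<in>UNIV. \<omega> x y * g x y"
  have lhs: "(\<Sum>x\<in>UNIV. \<mu> x * lap u x * u x) = ?S (\<lambda>x y. (u y - u x) * u x)"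
    by (simp add: measure_times_lap sum_distrib_right mult.assoc)
  also have "\<dots> = ?S (\<lambda>x y. (u x - u y) * u y)"
    by (subst sum.swap) (simp add: weight_sym)
  finally have "2 * (\<Sum>x\<in>UNIV. \<mu> x * lap u x * u x)
      = ?S (\<lambda>x y. (u y - u x) * u x) + ?S (\<lambda>x y. (u x - u y) * u y)"
    using lhs by simp
  also have "\<dots> = - ?S (\<lambda>x y. (u x - u y)\<^sup>2)"
    unfolding sum.distrib[symmetric] sum_negf[symmetric]
    by (intro sum.cong refl) (simp add: power2_eq_square algebra_simps)
  finally show ?thesis by simp
qed

lemma const_if_edges_const:
  assumes "\<And>x y. \<omega> x y > 0 \<Longrightarrow> u x = u y"
  shows "u x = u y"
  using connected[of x y] by (induction rule: rtranclp_induct) (auto dest: assms)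

lemma lap_at_max: "(\<And>y. u y \<le> u x) \<Longrightarrow> lap u x \<le> 0"
  unfolding lap_def using measure_pos[of x] weight_nonneg
  by (intro mult_nonneg_nonpos sum_nonpos) (auto simp: mult_nonneg_nonpos less_imp_le)

lemma lap_at_min: "(\<And>y. u x \<le> u y) \<Longrightarrow> lap u x \<ge> 0"
  using lap_at_max[of "\<lambda>x. - u x" x] by (simp add: lap_uminus)

lemma max_vertex:
  fixes u :: "'v \<Rightarrow> real"
  obtains p where "\<And>x. u x \<le> u p"
proof -
  have "Max (range u) \<in> range u" by (intro Max_in) auto
  then obtain p where "u p = Max (range u)" by (metis imageE)
  then show ?thesis using that[of p] by simp
qed

lemma min_vertex:
  fixes u :: "'v \<Rightarrow> real"
  obtains p where "\<And>x. u p \<le> u x"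
  using max_vertex[of "\<lambda>x. - u x"] by (metis neg_le_iff_le)

lemma lap_lower_bound:
  obtains b where "b \<ge> 0" "\<And>(u :: 'v \<Rightarrow> real) x m. (\<And>y. m \<le> u y) \<Longrightarrow> - (b * (u x - m)) \<le> lap u x"
proof -
  define d where "d x = (\<Sum>y\<in>UNIV. \<omega> x y) / \<mu> x" for x
  have d0: "d x \<ge> 0" for x
    unfolding d_def using measure_pos[of x] weight_nonneg by (intro divide_nonneg_pos sum_nonneg)
  define b where "b = (\<Sum>x\<in>UNIV. d x)"
  have "d x \<le> b" for x
    unfolding b_def using d0 by (intro member_le_sum) auto
  show ?thesis
  proof (rule that[of b])
    show "b \<ge> 0" unfolding b_def by (intro sum_nonneg d0)
    fix u :: "'v \<Rightarrow> real" and x and m :: real assume m: "\<And>y. m \<le> u y"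
    have "(\<Sum>y\<in>UNIV. \<omega> x y * (m - u x)) \<le> (\<Sum>y\<in>UNIV. \<omega> x y * (u y - u x))"
      using m weight_nonneg by (intro sum_mono mult_left_mono) auto
    then have "(\<Sum>y\<in>UNIV. \<omega> x y) * (m - u x) / \<mu> x \<le> lap u x"
      unfolding lap_def using measure_pos[of x]
      by (simp add: sum_distrib_right divide_right_mono)
    moreover have "d x * (u x - m) \<le> b * (u x - m)"
      using \<open>d x \<le> b\<close> m[of x] by (intro mult_right_mono) auto
    ultimately show "- (b * (u x - m)) \<le> lap u x"
      by (simp add: d_def algebra_simps diff_divide_distrib)
  qed
qed

text \<open>
In the sum that defines \<open>\<Delta>u(x)\<close> no term exceeds its weight times \<open>m - u(x)\<close>. A lower bound for
the sum therefore bounds each single term from below, which controls \<open>u\<close> at every neighbour.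
\<close>

lemma neighbour_step:
  assumes "\<omega> x y > 0"
  obtains B where "B \<ge> 0"
    "\<And>u m C. (\<And>z. u z \<le> m) \<Longrightarrow> - C \<le> lap u x \<Longrightarrow> C \<ge> 0 \<Longrightarrow> m - u y \<le> B * (m - u x + C)"
proof -
  let ?W = "\<Sum>z\<in>UNIV. \<omega> x z"
  define B where "B = 1 + (?W + \<mu> x) / \<omega> x y"
  have W: "?W \<ge> 0" by (intro sum_nonneg weight_nonneg)
  show ?thesis
  proof (rule that[of B])
    show "B \<ge> 0"
      unfolding B_def using W measure_pos[of x] assms by (intro add_nonneg_nonneg divide_nonneg_pos) auto
    fix u and m C :: real
    assume m: "\<And>z. u z \<le> m" and C: "- C \<le> lap u x" "C \<ge> 0"
    have "\<mu> x * - C \<le> \<mu> x * lap u x"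
      using C measure_pos[of x] by (intro mult_left_mono) auto
    also have "\<dots> = (\<Sum>z\<in>UNIV. \<omega> x z * (u z - m)) + ?W * (m - u x)"
      unfolding measure_times_lap sum_distrib_right sum.distrib[symmetric]
      by (intro sum.cong refl) (simp add: algebra_simps)
    also have "(\<Sum>z\<in>UNIV. \<omega> x z * (u z - m)) \<le> \<omega> x y * (u y - m)"
    proof -
      have "(\<Sum>z\<in>UNIV. \<omega> x z * (u z - m)) = \<omega> x y * (u y - m) + (\<Sum>z\<in>UNIV - {y}. \<omega> x z * (u z - m))"
        by (subst sum.remove[of _ y]) auto
      moreover have "(\<Sum>z\<in>UNIV - {y}. \<omega> x z * (u z - m)) \<le> 0"
        using m weight_nonneg by (intro sum_nonpos mult_nonneg_nonpos) auto
      ultimately show ?thesis by simp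
    qed
    finally have "\<omega> x y * (m - u y) \<le> \<mu> x * C + ?W * (m - u x)"
      by (simp add: algebra_simps)
    also have "\<dots> \<le> (?W + \<mu> x) * (m - u x + C)"
    proof -
      have "0 \<le> ?W * C" and "0 \<le> \<mu> x * (m - u x)"
        using W measure_pos[of x] C m[of x] by simp_all
      then show ?thesis by (simp add: algebra_simps)
    qed
    finally have "m - u y \<le> (?W + \<mu> x) * (m - u x + C) / \<omega> x y"
      using assms by (simp add: pos_le_divide_eq mult.commute)
    also have "\<dots> \<le> B * (m - u x + C)"
      unfolding B_def using m[of x] C by (simp add: algebra_simps)
    finally show "m - u y \<le> B * (m - u x + C)" .
  qed
qed

text \<open>
Walk from a maximum point \<open>p\<close> towards \<open>x\<close>, losing a controlled amount at each edge, until the walk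
ends or first meets \<open>P\<close>. The constant depends on the path only, and the loss is linear in \<open>C\<close>;
the linearity is what gives uniqueness for small data later.
\<close>

lemma maximum_principle_path:
  "\<exists>A\<ge>0. \<forall>P C u. C \<ge> 0 \<longrightarrow> (\<forall>z. u z \<le> u p) \<longrightarrow> (\<forall>z. z \<notin> P \<longrightarrow> - C \<le> lap u z) \<longrightarrow>
    (\<exists>z\<in>P. u p - u z \<le> A * C) \<or> u p - u x \<le> A * C"
  using connected[of p x]
proof (induction rule: rtranclp_induct)
  case base
  show ?case by (intro exI[of _ 0]) auto
next
  case (step x y)
  then obtain A where A: "A \<ge> 0" "\<And>P C u. C \<ge> 0 \<Longrightarrow> (\<forall>z. u z \<le> u p) \<Longrightarrow>
      (\<forall>z. z \<notin> P \<longrightarrow> - C \<le> lap u z) \<Longrightarrow> (\<exists>z\<in>P. u p - u z \<le> A * C) \<or> u p - u x \<le> A * C"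
    by blast
  obtain B where B: "B \<ge> 0" "\<And>u m C. (\<And>z. u z \<le> m) \<Longrightarrow> - C \<le> lap u x \<Longrightarrow> C \<ge> 0 \<Longrightarrow>
      m - u y \<le> B * (m - u x + C)"
    using neighbour_step[OF step.hyps(2)] by blast
  show ?case
  proof (intro exI[of _ "A + B * (A + 1)"] conjI allI impI)
    show "0 \<le> A + B * (A + 1)" using A(1) B(1) by simp
    fix P :: "'v set" and C :: real and u
    assume C: "C \<ge> 0" and m: "\<forall>z. u z \<le> u p" and sub: "\<forall>z. z \<notin> P \<longrightarrow> - C \<le> lap u z"
    have AC: "A * C \<le> (A + B * (A + 1)) * C" "B * (A * C + C) \<le> (A + B * (A + 1)) * C"
      using A(1) B(1) C by (auto simp: algebra_simps)
    show "(\<exists>z\<in>P. u p - u z \<le> (A + B * (A + 1)) * C) \<or> u p - u y \<le> (A + B * (A + 1)) * C"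
    proof (cases "\<exists>z\<in>P. u p - u z \<le> A * C")
      case True
      then show ?thesis using AC(1) by force
    next
      case False
      then have ux: "u p - u x \<le> A * C" and "x \<notin> P"
        using A(2)[OF C m sub] by auto
      then have "u p - u y \<le> B * (u p - u x + C)"
        using B(2)[of u "u p" C] m sub C by blast
      also have "\<dots> \<le> B * (A * C + C)"
        using ux B(1) by (intro mult_left_mono) auto
      finally show ?thesis using AC(2) by linarith
    qed
  qed
qed

text \<open>
If no value on \<open>P\<close> is within \<open>A C\<close> of the maximum of \<open>u\<close>, then the walks from a maximum point show
that \<open>u\<close> is within \<open>A C\<close> of its maximum everywhere. With \<open>P = {}\<close> this bounds the oscillation.
\<close>

lemma maximum_principle:
  obtains A where "A \<ge> 0" "\<And>P C u. C \<ge> 0 \<Longrightarrow> (\<And>z. z \<notin> P \<Longrightarrow> - C \<le> lap u z) \<Longrightarrow>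
    (\<exists>z\<in>P. \<forall>x. u x \<le> u z + A * C) \<or> (\<forall>x y. u x \<le> u y + A * C)"
proof -
  define Q where "Q A p x \<longleftrightarrow> (\<forall>P C u. C \<ge> 0 \<longrightarrow> (\<forall>z. u z \<le> u p) \<longrightarrow>
      (\<forall>z. z \<notin> P \<longrightarrow> - C \<le> lap u z) \<longrightarrow> (\<exists>z\<in>P. u p - u z \<le> A * C) \<or> u p - u x \<le> A * C)" for A p x
  have "\<forall>p x. \<exists>A. A \<ge> 0 \<and> Q A p x"
    unfolding Q_def using maximum_principle_path by blast
  then have "\<exists>A. \<forall>p x. A p x \<ge> 0 \<and> Q (A p x) p x"
    by (intro choice allI) blast
  then obtain A where A: "\<And>p x. A p x \<ge> 0" "\<And>p x. Q (A p x) p x"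
    by blast
  define A' where "A' = (\<Sum>p\<in>UNIV. \<Sum>x\<in>UNIV. A p x)"
  have A': "A p x \<le> A'" for p x
  proof -
    have "A p x \<le> (\<Sum>x\<in>UNIV. A p x)" using A(1) by (intro member_le_sum) auto
    also have "\<dots> \<le> A'" unfolding A'_def using A(1) by (intro member_le_sum sum_nonneg) auto
    finally show ?thesis .
  qed
  show ?thesis
  proof (rule that[of A'])
    show "A' \<ge> 0" unfolding A'_def by (intro sum_nonneg A(1))
    fix P :: "'v set" and C :: real and u
    assume C: "C \<ge> 0" and sub: "\<And>z. z \<notin> P \<Longrightarrow> - C \<le> lap u z"
    obtain p where p: "\<And>z. u z \<le> u p" by (rule max_vertex[of u]) blast
    show "(\<exists>z\<in>P. \<forall>x. u x \<le> u z + A' * C) \<or> (\<forall>x y. u x \<le> u y + A' * C)"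
    proof (cases "\<exists>z\<in>P. u p - u z \<le> A' * C")
      case True
      then obtain z where "z \<in> P" and z: "u p - u z \<le> A' * C" by blast
      have "u x \<le> u z + A' * C" for x
        using p[of x] z by linarith
      with \<open>z \<in> P\<close> show ?thesis by blast
    next
      case False
      have near: "u p - u y \<le> A' * C" for y
      proof -
        have "A p y * C \<le> A' * C" using A' C by (rule mult_right_mono)
        moreover have "(\<exists>z\<in>P. u p - u z \<le> A p y * C) \<or> u p - u y \<le> A p y * C"
          using A(2)[of p y] C p sub unfolding Q_def by blast
        ultimately show ?thesis
          using False order_trans by blast
      qed
      have "u x \<le> u y + A' * C" for x y
        using p[of x] near[of y] by linarith
      then show ?thesis by blast
    qed
  qed
qed

definition solves :: "('v \<Rightarrow> real) \<Rightarrow> ('v \<Rightarrow> real) \<Rightarrow> ('v \<Rightarrow> real) \<Rightarrow> bool" where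
  "solves c h u \<longleftrightarrow> (\<forall>x. lap u x = c x - h x * exp (u x))"

lemma solvesD: "solves c h u \<Longrightarrow> lap u x = c x - h x * exp (u x)"
  by (simp add: solves_def)

lemma solves_integral:
  assumes "solves c h u"
  shows "(\<Sum>x\<in>UNIV. \<mu> x * c x) = (\<Sum>x\<in>UNIV. \<mu> x * (h x * exp (u x)))"
  using sum_measure_lap[of u] by (simp add: solvesD[OF assms] right_diff_distrib sum_subtractf)

end

lemma exp_dominates_affine:
  fixes \<eta> a b :: real
  assumes "\<eta> > 0" "a \<ge> 0" "b \<ge> 0" and s: "\<eta> * exp s \<le> a + b * s"
  shows "s \<le> 1 + 2 * (a + b) / \<eta>"
proof (cases "s \<le> 1")
  case True
  have "2 * (a + b) / \<eta> \<ge> 0" using assms by simp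
  with True show ?thesis by linarith
next
  case False
  have "s\<^sup>2 / 2 \<le> exp s"
    using exp_lower_Taylor_quadratic[of s] False by simp
  then have "\<eta> * (s\<^sup>2 / 2) \<le> a + b * s"
    using s \<open>\<eta> > 0\<close> by (meson mult_left_mono less_imp_le order_trans)
  also have "\<dots> \<le> (a + b) * s"
    using False assms by (simp add: algebra_simps mult_le_cancel_left1)
  finally have "s * (\<eta> * s / 2) \<le> s * (a + b)"
    by (simp add: power2_eq_square algebra_simps)
  then have "\<eta> * s / 2 \<le> a + b"
    using False by (simp add: mult_le_cancel_left)
  then have "s \<le> 2 * (a + b) / \<eta>"
    using \<open>\<eta> > 0\<close> by (simp add: field_simps)
  then show ?thesis by simp
qed

section \<open>A priori bounds for solutions\<close>

lemma ln_le_if_le_exp: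
  fixes a s :: real
  shows "0 < a \<Longrightarrow> a \<le> exp s \<Longrightarrow> ln a \<le> s"
  using ln_le_cancel_iff[of a "exp s"] by simp

context weighted_graph
begin

lemma sum_measure_pos: "(\<Sum>x\<in>UNIV. \<mu> x) > 0"
  by (intro sum_pos measure_pos) auto

lemma abs_weighted_sum_le:
  assumes "\<And>x. \<bar>g x\<bar> \<le> B"
  shows "\<bar>\<Sum>x\<in>UNIV. \<mu> x * g x\<bar> \<le> B * (\<Sum>x\<in>UNIV. \<mu> x)"
proof -
  have "\<bar>\<Sum>x\<in>UNIV. \<mu> x * g x\<bar> \<le> (\<Sum>x\<in>UNIV. \<bar>\<mu> x * g x\<bar>)"
    by (rule sum_abs)
  also have "\<dots> \<le> (\<Sum>x\<in>UNIV. B * \<mu> x)"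
    using assms measure_pos by (intro sum_mono) (simp add: abs_mult mult.commute less_imp_le)
  finally show ?thesis by (simp add: sum_distrib_left)
qed

text \<open>
On \<open>P\<close> the equation gives \<open>\<eta> e\<^sup>u \<le> c - \<Delta>u \<le> a + b u\<close>, since \<open>- \<Delta>u\<close> is at most a multiple of
\<open>u - min u\<close> and \<open>min u\<close> is already bounded; the exponential wins. Off \<open>P\<close> the term \<open>- h e\<^sup>u\<close> is
nonnegative, so \<open>\<Delta>u \<ge> - C\<close> and the maximum principle carries the bound to all vertices.
\<close>

lemma solution_upper_bound:
  assumes "\<eta> > 0" and "C \<ge> 0" and "L \<ge> 0"
  obtains R where "\<And>c h u P. P \<noteq> {} \<Longrightarrow> (\<And>x. x \<in> P \<Longrightarrow> \<eta> \<le> h x) \<Longrightarrow> (\<And>x. x \<notin> P \<Longrightarrow> h x \<le> 0) \<Longrightarrow>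
    (\<And>x. \<bar>c x\<bar> \<le> C) \<Longrightarrow> solves c h u \<Longrightarrow> (\<And>x. - L \<le> u x) \<Longrightarrow> (\<And>x. u x \<le> R)"
proof -
  obtain A where A: "A \<ge> 0" "\<And>P C u. C \<ge> 0 \<Longrightarrow> (\<And>z. z \<notin> P \<Longrightarrow> - C \<le> lap u z) \<Longrightarrow>
      (\<exists>z\<in>P. \<forall>x. u x \<le> u z + A * C) \<or> (\<forall>x y. u x \<le> u y + A * C)"
    using maximum_principle by blast
  obtain b where b: "b \<ge> 0" "\<And>(u :: 'v \<Rightarrow> real) x m. (\<And>y. m \<le> u y) \<Longrightarrow> - (b * (u x - m)) \<le> lap u x"
    using lap_lower_bound by blast
  show ?thesis
  proof (rule that[of "1 + 2 * (C + b * L + b) / \<eta> + A * C"])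
    fix c h u P x
    assume P: "P \<noteq> {}" "\<And>x. x \<in> P \<Longrightarrow> \<eta> \<le> h x" "\<And>x. x \<notin> P \<Longrightarrow> h x \<le> 0"
      and c: "\<And>x. \<bar>c x\<bar> \<le> C" and u: "solves c h u" and L: "\<And>x. - L \<le> u x"
    have on_P: "u z \<le> 1 + 2 * (C + b * L + b) / \<eta>" if "z \<in> P" for z
    proof -
      have "\<eta> * exp (u z) \<le> h z * exp (u z)"
        using P(2)[OF that] by simp
      also have "\<dots> = c z - lap u z"
        using solvesD[OF u, of z] by simp
      also have "\<dots> \<le> C + b * L + b * u z"
        using c[of z] b(2)[of "- L" u z, OF L] by (simp add: algebra_simps)
      finally show ?thesis
        using assms b(1) by (intro exp_dominates_affine) auto
    qed
    have "- C \<le> lap u z" if "z \<notin> P" for z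
    proof -
      have "h z * exp (u z) \<le> 0" using P(3)[OF that] by (simp add: mult_nonpos_nonneg)
      then show ?thesis using solvesD[OF u, of z] c[of z] by simp
    qed
    from A(2)[OF \<open>C \<ge> 0\<close> this] have "\<exists>z\<in>P. \<forall>x. u x \<le> u z + A * C"
      using P(1) by blast
    then obtain z where "z \<in> P" "\<And>x. u x \<le> u z + A * C" by blast
    then show "u x \<le> 1 + 2 * (C + b * L + b) / \<eta> + A * C"
      using on_P[of z] by (meson add_right_mono order_trans)
  qed
qed

text \<open>
Where \<open>u \<le> 0\<close>, the right-hand side of the equation is bounded. So apply the maximum principle to
\<open>- u\<close> with the set \<open>{u > 0}\<close>: either \<open>u\<close> is nowhere far below some positive value that it takes,
or \<open>u\<close> has bounded oscillation.
\<close>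

lemma low_solution_oscillation:
  assumes "C \<ge> 0" and "H \<ge> 0"
  obtains R where "R \<ge> 0" "\<And>c h u. (\<And>x. \<bar>c x\<bar> \<le> C) \<Longrightarrow> (\<And>x. \<bar>h x\<bar> \<le> H) \<Longrightarrow> solves c h u \<Longrightarrow>
    (\<forall>x. - R \<le> u x) \<or> (\<forall>x y. u x \<le> u y + R)"
proof -
  obtain A where A: "A \<ge> 0" "\<And>P C u. C \<ge> 0 \<Longrightarrow> (\<And>z. z \<notin> P \<Longrightarrow> - C \<le> lap u z) \<Longrightarrow>
      (\<exists>z\<in>P. \<forall>x. u x \<le> u z + A * C) \<or> (\<forall>x y. u x \<le> u y + A * C)"
    using maximum_principle by blast
  show ?thesis
  proof (rule that[of "A * (C + H)"])
    show "0 \<le> A * (C + H)" using A(1) assms by simp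
    fix c h u
    assume c: "\<And>x. \<bar>c x\<bar> \<le> C" and h: "\<And>x. \<bar>h x\<bar> \<le> H" and u: "solves c h u"
    have "- (C + H) \<le> lap (\<lambda>x. - u x) z" if "z \<notin> {z. u z > 0}" for z
    proof -
      have "\<bar>h z * exp (u z)\<bar> \<le> H * 1"
        unfolding abs_mult using that h[of z] assms by (intro mult_mono) auto
      then show ?thesis
        using c[of z] by (simp add: lap_uminus solvesD[OF u] abs_le_iff)
    qed
    then have "(\<exists>z\<in>{z. u z > 0}. \<forall>x. - u x \<le> - u z + A * (C + H)) \<or>
        (\<forall>x y. - u x \<le> - u y + A * (C + H))"
      using assms by (intro A(2)) auto
    then show "(\<forall>x. - (A * (C + H)) \<le> u x) \<or> (\<forall>x y. u x \<le> u y + A * (C + H))"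
    proof (elim disjE bexE)
      fix z assume z: "z \<in> {z. u z > 0}" "\<forall>x. - u x \<le> - u z + A * (C + H)"
      have "- (A * (C + H)) \<le> u x" for x
        using z(1) z(2)[rule_format, of x] by simp
      then show ?thesis by blast
    next
      assume osc: "\<forall>x y. - u x \<le> - u y + A * (C + H)"
      have "u x \<le> u y + A * (C + H)" for x y
        using osc[rule_format, of y x] by simp
      then show ?thesis by blast
    qed
  qed
qed

text \<open>
A very low solution has bounded oscillation, so \<open>e\<^sup>u\<close> is tiny everywhere. Then so is
\<open>\<integral> h e\<^sup>u = \<integral> c\<close>, whose absolute value is at least \<open>\<kappa>\<close>.
\<close>

lemma solution_lower_bound:
  assumes "C \<ge> 0" and "H > 0" and "\<kappa> > 0"
  obtains R where "\<And>c h u. (\<And>x. \<bar>c x\<bar> \<le> C) \<Longrightarrow> (\<And>x. \<bar>h x\<bar> \<le> H) \<Longrightarrow>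
    \<kappa> \<le> \<bar>\<Sum>x\<in>UNIV. \<mu> x * c x\<bar> \<Longrightarrow> solves c h u \<Longrightarrow> (\<And>x. - R \<le> u x)"
proof -
  obtain R where R: "R \<ge> 0" "\<And>c h u. (\<And>x. \<bar>c x\<bar> \<le> C) \<Longrightarrow> (\<And>x. \<bar>h x\<bar> \<le> H) \<Longrightarrow> solves c h u \<Longrightarrow>
      (\<forall>x. - R \<le> u x) \<or> (\<forall>x y. u x \<le> u y + R)"
    using low_solution_oscillation[of C H] assms by auto
  define V where "V = (\<Sum>x\<in>UNIV. \<mu> x)"
  have "V > 0" unfolding V_def by (rule sum_measure_pos)
  show ?thesis
  proof (rule that[of "R + \<bar>ln (\<kappa> / (H * V))\<bar>"])
    fix c h u x
    assume c: "\<And>x. \<bar>c x\<bar> \<le> C" and h: "\<And>x. \<bar>h x\<bar> \<le> H"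
      and \<kappa>: "\<kappa> \<le> \<bar>\<Sum>x\<in>UNIV. \<mu> x * c x\<bar>" and u: "solves c h u"
    obtain p where p: "\<And>x. u x \<le> u p" by (rule max_vertex[of u]) blast
    have "\<kappa> \<le> H * exp (u p) * V"
      unfolding V_def
    proof (rule order_trans[OF \<kappa>], unfold solves_integral[OF u], rule abs_weighted_sum_le)
      show "\<bar>h x * exp (u x)\<bar> \<le> H * exp (u p)" for x
        unfolding abs_mult using h p \<open>H > 0\<close> by (intro mult_mono) auto
    qed
    then have "ln (\<kappa> / (H * V)) \<le> u p"
      using assms \<open>V > 0\<close> by (intro ln_le_if_le_exp) (auto simp: field_simps)
    moreover have "- R \<le> u x \<or> u p \<le> u x + R"
      using R(2)[OF c h u] by blast
    ultimately show "- (R + \<bar>ln (\<kappa> / (H * V))\<bar>) \<le> u x"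
      by linarith
  qed
qed

text \<open>
Let \<open>E = e\<^bsup>max u\<^esup>\<close>. From \<open>\<integral> c = \<integral> h e\<^sup>u\<close> one gets \<open>c \<le> H E\<close>, so \<open>\<Delta>u\<close> is of order \<open>E\<close>, and the
oscillation of \<open>u\<close> is \<open>O(E)\<close>. So \<open>e\<^sup>u = E (1 - O(E))\<close> and \<open>0 \<le> \<integral> h e\<^sup>u \<le> E (\<integral> h + O(E))\<close>. As
\<open>\<integral> h < 0\<close>, this bounds \<open>E\<close> from below, uniformly in \<open>c \<in> [0, 1]\<close>.
\<close>

lemma solution_lower_bound_zero:
  assumes "(\<Sum>x\<in>UNIV. \<mu> x * h x) < 0"
  obtains R where "\<And>c u. 0 \<le> c \<Longrightarrow> c \<le> 1 \<Longrightarrow> solves (\<lambda>_. c) h u \<Longrightarrow> (\<And>x. - R \<le> u x)"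
proof -
  define H where "H = (\<Sum>x\<in>UNIV. \<bar>h x\<bar>)"
  have h: "\<bar>h x\<bar> \<le> H" for x
    unfolding H_def by (rule member_le_sum) auto
  have "H \<ge> 0" unfolding H_def by (intro sum_nonneg) auto
  obtain A where A: "A \<ge> 0" "\<And>P C u. C \<ge> 0 \<Longrightarrow> (\<And>z. z \<notin> P \<Longrightarrow> - C \<le> lap u z) \<Longrightarrow>
      (\<exists>z\<in>P. \<forall>x. u x \<le> u z + A * C) \<or> (\<forall>x y. u x \<le> u y + A * C)"
    using maximum_principle by blast
  obtain R where R: "R \<ge> 0" "\<And>c h u. (\<And>x. \<bar>c x\<bar> \<le> 1) \<Longrightarrow> (\<And>x. \<bar>h x\<bar> \<le> H) \<Longrightarrow> solves c h u \<Longrightarrow>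
      (\<forall>x. - R \<le> u x) \<or> (\<forall>x y. u x \<le> u y + R)"
    using low_solution_oscillation[of 1 H] \<open>H \<ge> 0\<close> by auto
  define V where "V = (\<Sum>x\<in>UNIV. \<mu> x)"
  have "V > 0" unfolding V_def by (rule sum_measure_pos)
  define I where "I = - (\<Sum>x\<in>UNIV. \<mu> x * h x)"
  have "I > 0" using assms by (simp add: I_def)
  define K where "K = H * (A * (2 * H)) * V"
  show ?thesis
  proof (rule that[of "R + \<bar>ln (I / (K + 1))\<bar>"])
    fix c u x
    assume c: "0 \<le> c" "c \<le> 1" and u: "solves (\<lambda>_. c) h u"
    obtain p where p: "\<And>x. u x \<le> u p" by (rule max_vertex[of u]) blast
    have osc: "(\<forall>x. - R \<le> u x) \<or> (\<forall>x y. u x \<le> u y + R)"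
      using R(2)[of "\<lambda>_. c" h u] c h u by simp
    define E where "E = exp (u p)"
    have hE: "\<bar>h x * exp (u x)\<bar> \<le> H * E" for x
      unfolding abs_mult E_def using h p \<open>H \<ge> 0\<close> by (intro mult_mono) auto
    have "c * V = (\<Sum>x\<in>UNIV. \<mu> x * (h x * exp (u x)))"
      using solves_integral[OF u] by (simp add: V_def sum_distrib_left mult.commute)
    also have "\<dots> \<le> H * E * V"
      unfolding V_def using abs_weighted_sum_le[of "\<lambda>x. h x * exp (u x)", OF hE] by (simp only: abs_le_iff)
    finally have "c \<le> H * E"
      using \<open>V > 0\<close> by simp
    have "- (2 * H * E) \<le> lap u z" for z
    proof -
      have "0 \<le> H * E" using \<open>H \<ge> 0\<close> by (simp add: E_def)
      then show ?thesis
        using solvesD[OF u, of z] abs_le_D1[OF hE[of z]] c(1) by linarith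
    qed
    then have "\<forall>x y. u x \<le> u y + A * (2 * H * E)"
      using A(2)[of "2 * H * E" "{}" u] \<open>H \<ge> 0\<close> by (simp add: E_def)
    then have close: "0 \<le> u p - u x" "u p - u x \<le> A * (2 * H) * E" for x
      using p by (auto simp: algebra_simps)
    have "0 \<le> c * V" using c \<open>V > 0\<close> by simp
    also have "c * V = (\<Sum>x\<in>UNIV. \<mu> x * (h x * exp (u x)))"
      by fact
    also have "\<dots> = (\<Sum>x\<in>UNIV. E * (\<mu> x * h x) - E * (\<mu> x * (h x * (1 - exp (u x - u p)))))"
      by (intro sum.cong refl) (simp add: E_def exp_diff algebra_simps)
    also have "\<dots> = E * (- I) - E * (\<Sum>x\<in>UNIV. \<mu> x * (h x * (1 - exp (u x - u p))))"
      by (simp add: sum_subtractf sum_distrib_left I_def)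
    finally have "E * I \<le> E * (- (\<Sum>x\<in>UNIV. \<mu> x * (h x * (1 - exp (u x - u p)))))"
      by (simp add: algebra_simps)
    then have "I \<le> - (\<Sum>x\<in>UNIV. \<mu> x * (h x * (1 - exp (u x - u p))))"
      unfolding E_def by (rule mult_left_le_imp_le) simp
    also have "\<dots> \<le> \<bar>\<Sum>x\<in>UNIV. \<mu> x * (h x * (1 - exp (u x - u p)))\<bar>"
      by (rule abs_ge_minus_self)
    also have "\<dots> \<le> H * (A * (2 * H) * E) * V"
      unfolding V_def
    proof (rule abs_weighted_sum_le)
      fix x
      have "\<bar>1 - exp (u x - u p)\<bar> \<le> A * (2 * H) * E"
      proof -
        have "1 + (u x - u p) \<le> exp (u x - u p)"
          by (rule exp_ge_add_one_self)
        then have "1 - exp (u x - u p) \<le> A * (2 * H) * E"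
          using close(2)[of x] by linarith
        moreover have "exp (u x - u p) \<le> 1"
          using close(1)[of x] by simp
        ultimately show ?thesis by simp
      qed
      then show "\<bar>h x * (1 - exp (u x - u p))\<bar> \<le> H * (A * (2 * H) * E)"
        unfolding abs_mult using h \<open>H \<ge> 0\<close> by (intro mult_mono) auto
    qed
    also have "\<dots> \<le> (K + 1) * E"
      by (simp add: K_def E_def algebra_simps)
    finally have "I \<le> (K + 1) * E" .
    moreover have "K \<ge> 0"
      unfolding K_def using \<open>H \<ge> 0\<close> A(1) \<open>V > 0\<close> by simp
    ultimately have "I / (K + 1) \<le> exp (u p)"
      by (simp add: E_def field_simps)
    then have "ln (I / (K + 1)) \<le> u p"
      using \<open>I > 0\<close> \<open>K \<ge> 0\<close> by (intro ln_le_if_le_exp) auto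
    moreover have "- R \<le> u x \<or> u p \<le> u x + R"
      using osc by blast
    ultimately show "- (R + \<bar>ln (I / (K + 1))\<bar>) \<le> u x"
      by linarith
  qed
qed

text \<open>
For \<open>h \<le> 0\<close> there are no vertices to which the upper bound could be reduced, but now \<open>\<Delta>u \<ge> c\<close>
everywhere bounds the oscillation, and \<open>\<integral> h e\<^sup>u = \<integral> c\<close> with \<open>\<integral> h \<le> - I\<close> bounds \<open>min u\<close>.
\<close>

lemma solution_bound_nonpositive:
  assumes "c < 0" and "I > 0"
  obtains R where "\<And>h u. (\<And>x. h x \<le> 0) \<Longrightarrow> (\<Sum>x\<in>UNIV. \<mu> x * h x) \<le> - I \<Longrightarrow>
    solves (\<lambda>_. c) h u \<Longrightarrow> (\<And>x. u x \<le> R)"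
proof -
  obtain A where A: "A \<ge> 0" "\<And>P C u. C \<ge> 0 \<Longrightarrow> (\<And>z. z \<notin> P \<Longrightarrow> - C \<le> lap u z) \<Longrightarrow>
      (\<exists>z\<in>P. \<forall>x. u x \<le> u z + A * C) \<or> (\<forall>x y. u x \<le> u y + A * C)"
    using maximum_principle by blast
  define V where "V = (\<Sum>x\<in>UNIV. \<mu> x)"
  have "V > 0" unfolding V_def by (rule sum_measure_pos)
  show ?thesis
  proof (rule that[of "ln (- c * V / I) + A * (- c)"])
    fix h u x
    assume h: "\<And>x. h x \<le> 0" "(\<Sum>x\<in>UNIV. \<mu> x * h x) \<le> - I" and u: "solves (\<lambda>_. c) h u"
    obtain p where p: "\<And>x. u p \<le> u x" by (rule min_vertex[of u]) blast
    have "- (- c) \<le> lap u z" for z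
      using h(1)[of z] by (simp add: solvesD[OF u] mult_nonpos_nonneg)
    then have osc: "\<forall>x y. u x \<le> u y + A * (- c)"
      using A(2)[of "- c" "{}" u] \<open>c < 0\<close> by simp
    have "I * exp (u p) \<le> - (\<Sum>x\<in>UNIV. \<mu> x * h x) * exp (u p)"
      using h(2) by (intro mult_right_mono) auto
    also have "\<dots> = (\<Sum>x\<in>UNIV. \<mu> x * (- h x) * exp (u p))"
      by (simp add: sum_distrib_right sum_negf)
    also have "\<dots> \<le> (\<Sum>x\<in>UNIV. \<mu> x * (- h x) * exp (u x))"
      using p h(1) measure_pos by (intro sum_mono mult_left_mono) (auto simp: mult_nonneg_nonpos less_imp_le)
    also have "\<dots> = - c * V"
      using solves_integral[OF u] by (simp add: V_def sum_distrib_left sum_negf mult.commute mult.left_commute)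
    finally have "exp (u p) \<le> - c * V / I"
      using \<open>I > 0\<close> by (simp add: field_simps)
    then have "u p \<le> ln (- c * V / I)"
      using \<open>I > 0\<close> \<open>V > 0\<close> \<open>c < 0\<close> by (subst ln_ge_iff) (auto simp: mult_neg_pos divide_neg_pos)
    then show "u x \<le> ln (- c * V / I) + A * (- c)"
      using osc by (meson add_right_mono order_trans)
  qed
qed

text \<open>
At a minimum point the equation forces \<open>H e\<^bsup>min u\<^esup> \<ge> |c|\<close>. At \<open>x\<^sub>0\<close>, with \<open>w = u(x\<^sub>0) - min u\<close>, it gives
\<open>h(x\<^sub>0) e\<^bsup>min u\<^esup> e\<^sup>w \<le> b w \<le> b e\<^sup>w\<close>. Together these bound \<open>|c|\<close> by \<open>b H / h(x\<^sub>0)\<close>.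
\<close>

lemma no_solution_very_negative:
  assumes "h x\<^sub>0 > 0"
  obtains C where "C > 0" "\<And>c u. c \<le> - C \<Longrightarrow> \<not> solves (\<lambda>_. c) h u"
proof -
  define H where "H = (\<Sum>x\<in>UNIV. \<bar>h x\<bar>)"
  have h: "\<bar>h x\<bar> \<le> H" for x
    unfolding H_def by (rule member_le_sum) auto
  have "H > 0" using h[of x\<^sub>0] assms by linarith
  obtain b where b: "b \<ge> 0" "\<And>(u :: 'v \<Rightarrow> real) x m. (\<And>y. m \<le> u y) \<Longrightarrow> - (b * (u x - m)) \<le> lap u x"
    using lap_lower_bound by blast
  show ?thesis
  proof (rule that[of "b * H / h x\<^sub>0 + 1"])
    show "b * H / h x\<^sub>0 + 1 > 0"
      using b(1) \<open>H > 0\<close> assms by (intro add_nonneg_pos) auto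
    fix c u assume c: "c \<le> - (b * H / h x\<^sub>0 + 1)"
    show "\<not> solves (\<lambda>_. c) h u"
    proof
      assume u: "solves (\<lambda>_. c) h u"
      obtain p where p: "\<And>x. u p \<le> u x" by (rule min_vertex[of u]) blast
      have "0 \<le> c - h p * exp (u p)"
        using lap_at_min[of u p] p by (simp add: solvesD[OF u])
      moreover have "- h p * exp (u p) \<le> H * exp (u p)"
        using abs_le_D2[OF h[of p]] by (intro mult_right_mono) auto
      ultimately have low: "- c \<le> H * exp (u p)" by linarith
      define w where "w = u x\<^sub>0 - u p"
      have "w \<ge> 0" using p by (simp add: w_def)
      have "- (b * w) \<le> c - h x\<^sub>0 * exp (u x\<^sub>0)"
        using b(2)[of "u p" u x\<^sub>0, OF p] by (simp add: solvesD[OF u] w_def)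
      moreover have "b * H / h x\<^sub>0 \<ge> 0" using b(1) \<open>H > 0\<close> assms by simp
      ultimately have "h x\<^sub>0 * exp (u x\<^sub>0) \<le> b * w" using c by linarith
      also have "\<dots> \<le> b * exp w"
        using b(1) exp_ge_add_one_self[of w] by (intro mult_left_mono) linarith+
      finally have "h x\<^sub>0 * exp (u p) * exp w \<le> b * exp w"
        by (simp add: w_def exp_diff)
      then have "h x\<^sub>0 * exp (u p) \<le> b" by simp
      then have "H * exp (u p) \<le> b * H / h x\<^sub>0"
        using assms \<open>H > 0\<close> by (simp add: field_simps)
      with low c show False by linarith
    qed
  qed
qed

end

section \<open>Signs of determinants of linearised equations\<close>

lemma det_nonzero_if_kernel_trivial:
  fixes A :: "real ^ 'n::finite ^ 'n"
  assumes "\<And>v. A *v v = 0 \<Longrightarrow> v = 0"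
  shows "det A \<noteq> 0"
  using assms by (simp add: invertible_det_nz[symmetric] invertible_left_inverse matrix_left_invertible_ker)

lemma sgn_det_segment:
  fixes A B :: "real ^ 'n::finite ^ 'n"
  assumes "\<And>t v. t \<in> {0..1} \<Longrightarrow> ((1 - t) *\<^sub>R A + t *\<^sub>R B) *v v = 0 \<Longrightarrow> v = 0"
  shows "sgn (det A) = sgn (det B)"
proof -
  define g where "g t = det ((1 - t) *\<^sub>R A + t *\<^sub>R B)" for t
  have g_nz: "g t \<noteq> 0" if "t \<in> {0..1}" for t
    unfolding g_def using assms[OF that] by (rule det_nonzero_if_kernel_trivial)
  have "connected (g ` {0..1})"
    unfolding g_def by (intro connected_continuous_image continuous_intros) auto
  moreover have "0 \<notin> g ` {0..1}" using g_nz by force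
  moreover have "g 0 \<in> g ` {0..1}" "g 1 \<in> g ` {0..1}" by auto
  ultimately have "\<not> (g 0 \<le> 0 \<and> 0 \<le> g 1)" "\<not> (g 1 \<le> 0 \<and> 0 \<le> g 0)"
    by (meson connectedD_interval)+
  then have "sgn (g 0) = sgn (g 1)"
    by (auto simp: sgn_if)
  then show ?thesis by (simp add: g_def)
qed

context weighted_graph
begin

text \<open>
The matrix of \<open>- \<Delta>\<close>.
\<close>

definition lap_matrix :: "real ^ 'v ^ 'v" where
  "lap_matrix = (\<chi> x y. (if x = y then (\<Sum>z\<in>UNIV. \<omega> x z) / \<mu> x else 0) - \<omega> x y / \<mu> x)"

definition diag :: "('v \<Rightarrow> real) \<Rightarrow> real ^ 'v ^ 'v" where
  "diag d = (\<chi> x y. if x = y then d x else 0)"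

lemma lap_matrix_mult: "(lap_matrix *v u) $ x = - lap (($) u) x"
proof -
  have "(lap_matrix *v u) $ x = (\<Sum>y\<in>UNIV. (if x = y then (\<Sum>z\<in>UNIV. \<omega> x z) / \<mu> x * u $ y else 0) - \<omega> x y / \<mu> x * u $ y)"
    unfolding lap_matrix_def matrix_vector_mult_def by (auto simp: left_diff_distrib intro!: sum.cong)
  also have "\<dots> = (\<Sum>z\<in>UNIV. \<omega> x z) / \<mu> x * u $ x - (\<Sum>y\<in>UNIV. \<omega> x y / \<mu> x * u $ y)"
    by (simp add: sum_subtractf)
  also have "\<dots> = - lap (($) u) x"
    by (simp add: lap_def right_diff_distrib sum_subtractf sum_distrib_right sum_divide_distrib diff_divide_distrib)
  finally show ?thesis .
qed

lemma diag_mult: "(diag d *v u) $ x = d x * u $ x"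
  unfolding diag_def matrix_vector_mult_def by (simp add: if_distrib[of "\<lambda>a. a * _"] cong: if_cong)

lemma energy_zero_imp_const:
  assumes "(\<Sum>x\<in>UNIV. \<mu> x * lap u x * u x) = 0"
  shows "u x = u y"
proof (rule const_if_edges_const)
  have "(\<Sum>x\<in>UNIV. \<Sum>y\<in>UNIV. \<omega> x y * (u x - u y)\<^sup>2) = 0"
    using assms by (simp add: dirichlet_energy)
  then have *: "\<omega> x y * (u x - u y)\<^sup>2 = 0" for x y
    by (simp add: sum_nonneg_eq_0_iff sum_nonneg weight_nonneg)
  show "u x = u y" if "\<omega> x y > 0" for x y
    using *[of x y] that by simp
qed

lemma harmonic_imp_const: "(\<And>x. lap u x = 0) \<Longrightarrow> u x = u y"
  by (rule energy_zero_imp_const) simp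

lemma energy_nonpos: "(\<Sum>x\<in>UNIV. \<mu> x * lap u x * u x) \<le> 0"
  unfolding dirichlet_energy by (simp add: sum_nonneg weight_nonneg)

text \<open>
\<open>- \<Delta> + d\<close> is positive definite for the inner product weighted by \<open>\<mu>\<close>, and so are all its convex
combinations with the identity; hence the determinant keeps the sign of \<open>det I = 1\<close>.
\<close>

lemma det_lap_plus_diag_pos:
  assumes d: "\<And>x. d x \<ge> 0" and "d x\<^sub>0 > 0"
  shows "det (lap_matrix + diag d) > 0"
proof -
  have "sgn (det (lap_matrix + diag d)) = sgn (det (mat 1 :: real ^ 'v ^ 'v))"
  proof (rule sgn_det_segment)
    fix t :: real and v :: "real ^ 'v"
    assume t: "t \<in> {0..1}" and v: "((1 - t) *\<^sub>R (lap_matrix + diag d) + t *\<^sub>R mat 1) *v v = 0"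
    have "(((1 - t) *\<^sub>R (lap_matrix + diag d) + t *\<^sub>R mat 1) *v v) $ x
        = (1 - t) * (d x * v $ x - lap (($) v) x) + t * v $ x" for x
      by (simp add: matrix_vector_mult_add_rdistrib scaleR_matrix_vector_assoc[symmetric]
          lap_matrix_mult diag_mult)
    with v have "(1 - t) * (d x * v $ x - lap (($) v) x) + t * v $ x = 0" for x
      by simp
    then have "\<mu> x * v $ x * ((1 - t) * (d x * v $ x - lap (($) v) x) + t * v $ x) = 0" for x
      by simp
    then have "(\<Sum>x\<in>UNIV. \<mu> x * v $ x * ((1 - t) * (d x * v $ x - lap (($) v) x) + t * v $ x)) = 0"
      by (intro sum.neutral ballI)
    moreover define E where "E = (\<Sum>x\<in>UNIV. \<mu> x * lap (($) v) x * v $ x)"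
    moreover define D where "D = (\<Sum>x\<in>UNIV. \<mu> x * d x * (v $ x)\<^sup>2)"
    moreover define S where "S = (\<Sum>x\<in>UNIV. \<mu> x * (v $ x)\<^sup>2)"
    ultimately have sum0: "(1 - t) * (D - E) + t * S = 0"
      by (simp add: sum_distrib_left sum.distrib sum_subtractf algebra_simps power2_eq_square)
    have "E \<le> 0" unfolding E_def by (rule energy_nonpos)
    have "D \<ge> 0" unfolding D_def using d measure_pos by (intro sum_nonneg) (simp add: less_imp_le)
    have "S \<ge> 0" unfolding S_def using measure_pos by (intro sum_nonneg) (simp add: less_imp_le)
    have "(1 - t) * (D - E) \<ge> 0" "t * S \<ge> 0"
      using t \<open>E \<le> 0\<close> \<open>D \<ge> 0\<close> \<open>S \<ge> 0\<close> by auto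
    with sum0 have zero: "(1 - t) * (D - E) = 0" "t * S = 0" by linarith+
    show "v = 0"
    proof (cases "t = 0")
      case True
      then have "D = 0" "E = 0" using zero(1) \<open>E \<le> 0\<close> \<open>D \<ge> 0\<close> by auto
      have "\<mu> x\<^sub>0 * d x\<^sub>0 * (v $ x\<^sub>0)\<^sup>2 = 0"
        using \<open>D = 0\<close> d measure_pos unfolding D_def
        by (subst (asm) sum_nonneg_eq_0_iff) (auto simp: less_imp_le)
      then have "v $ x\<^sub>0 = 0"
        using \<open>d x\<^sub>0 > 0\<close> measure_pos[of x\<^sub>0] by simp
      moreover have "v $ x = v $ x\<^sub>0" for x
        using energy_zero_imp_const[of "($) v" x x\<^sub>0] \<open>E = 0\<close> unfolding E_def by simp
      ultimately have "v $ x = 0" for x by metis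
      then show ?thesis by (simp add: vec_eq_iff)
    next
      case False
      then have "S = 0" using zero(2) by simp
      then have "\<mu> x * (v $ x)\<^sup>2 = 0" for x
        using measure_pos unfolding S_def by (subst (asm) sum_nonneg_eq_0_iff) (auto simp: less_imp_le)
      then have "v $ x = 0" for x
        using measure_pos[of x] by (metis less_irrefl mult_eq_0_iff power_eq_0_iff)
      then show ?thesis by (simp add: vec_eq_iff)
    qed
  qed
  then show ?thesis by (simp add: sgn_if split: if_splits)
qed

lemma det_lap_matrix: "det lap_matrix = 0"
proof -
  have "lap_matrix *v (\<chi> x. 1) = 0"
    by (simp add: vec_eq_iff lap_matrix_mult lap_def)
  moreover have "(\<chi> x. 1) \<noteq> (0 :: real ^ 'v)"
    by (simp add: vec_eq_iff)
  ultimately show ?thesis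
    by (metis invertible_det_nz invertible_left_inverse matrix_left_invertible_ker)
qed

text \<open>
If \<open>\<Delta>v\<close> vanishes at all vertices but \<open>x\<^sub>0\<close>, then it vanishes there too, since \<open>\<integral> \<Delta>v = 0\<close>, and
\<open>v\<close> is constant; the row \<open>w\<close> then forces \<open>v = 0\<close>. So all these matrices are nonsingular, and \<open>w\<close> can be
moved along a segment to the unit vector at \<open>x\<^sub>0\<close>. For that row the determinant equals the one of
\<open>- \<Delta>\<close> plus a nonnegative diagonal matrix, because \<open>det (- \<Delta>) = 0\<close>.
\<close>

lemma det_lap_replace_row_pos:
  assumes w: "\<And>x. w $ x \<ge> 0" "(\<Sum>x\<in>UNIV. w $ x) > 0"
  shows "det (\<chi> x. if x = x\<^sub>0 then w else lap_matrix $ x) > 0"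
proof -
  let ?B = "\<lambda>w. (\<chi> x. if x = x\<^sub>0 then w else lap_matrix $ x) :: real ^ 'v ^ 'v"
  have "lap_matrix + diag (\<lambda>x. if x = x\<^sub>0 then 1 else 0)
      = (\<chi> x. if x = x\<^sub>0 then lap_matrix $ x + axis x 1 else lap_matrix $ x)"
    by (simp add: vec_eq_iff diag_def axis_def)
  moreover have "(\<chi> x. if x = x\<^sub>0 then lap_matrix $ x else lap_matrix $ x) = lap_matrix"
    by (simp add: vec_eq_iff)
  moreover have "(\<chi> x. if x = x\<^sub>0 then axis x 1 else lap_matrix $ x) = ?B (axis x\<^sub>0 1)"
    by (simp add: vec_eq_iff)
  ultimately have "det (lap_matrix + diag (\<lambda>x. if x = x\<^sub>0 then 1 else 0)) = det (?B (axis x\<^sub>0 1))"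
    by (simp only: det_row_add det_lap_matrix add_0_left)
  then have "det (?B (axis x\<^sub>0 1)) > 0"
    using det_lap_plus_diag_pos[of "\<lambda>x. if x = x\<^sub>0 then 1 else 0" x\<^sub>0] by simp
  moreover have "sgn (det (?B w)) = sgn (det (?B (axis x\<^sub>0 1)))"
  proof (rule sgn_det_segment)
    fix t :: real and v :: "real ^ 'v"
    assume t: "t \<in> {0..1}" and v: "((1 - t) *\<^sub>R ?B w + t *\<^sub>R ?B (axis x\<^sub>0 1)) *v v = 0"
    define w' where "w' = (1 - t) *\<^sub>R w + t *\<^sub>R axis x\<^sub>0 1"
    have "(1 - t) *\<^sub>R ?B w + t *\<^sub>R ?B (axis x\<^sub>0 1) = ?B w'"
      by (simp add: vec_eq_iff w'_def algebra_simps)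
    with v have Bv: "?B w' *v v = 0" by simp
    have "lap (($) v) x = 0" if "x \<noteq> x\<^sub>0" for x
    proof -
      have "(?B w' *v v) $ x = (lap_matrix *v v) $ x"
        using that by (simp add: matrix_vector_mult_def)
      then show ?thesis using Bv by (simp add: lap_matrix_mult)
    qed
    note off = this
    have "(\<Sum>x\<in>UNIV. \<mu> x * lap (($) v) x) = \<mu> x\<^sub>0 * lap (($) v) x\<^sub>0"
      using off by (subst sum.remove[of _ x\<^sub>0]) auto
    then have "lap (($) v) x\<^sub>0 = 0"
      using sum_measure_lap[of "($) v"] measure_pos[of x\<^sub>0] by simp
    with off have "lap (($) v) x = 0" for x by metis
    then have const: "v $ x = v $ x\<^sub>0" for x
      using harmonic_imp_const[of "($) v" x x\<^sub>0] by simp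
    have "(?B w' *v v) $ x\<^sub>0 = (\<Sum>x\<in>UNIV. w' $ x * v $ x)"
      by (simp add: matrix_vector_mult_def)
    also have "\<dots> = (\<Sum>x\<in>UNIV. w' $ x * v $ x\<^sub>0)"
      by (rule sum.cong[OF refl arg_cong[OF const]])
    also have "\<dots> = (\<Sum>x\<in>UNIV. w' $ x) * v $ x\<^sub>0"
      by (simp add: sum_distrib_right)
    finally have "(?B w' *v v) $ x\<^sub>0 = (\<Sum>x\<in>UNIV. w' $ x) * v $ x\<^sub>0" .
    moreover have "(\<Sum>x\<in>UNIV. w' $ x) = (1 - t) * (\<Sum>x\<in>UNIV. w $ x) + t"
      by (simp add: w'_def sum.distrib sum_distrib_left axis_def if_distrib[of "(*) t"] cong: if_cong)
    moreover have "(1 - t) * (\<Sum>x\<in>UNIV. w $ x) + t > 0"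
      using t w(2) by (cases "t = 0") (auto simp: add_nonneg_pos)
    ultimately have "v $ x\<^sub>0 = 0" using Bv by simp
    then have "v $ x = 0" for x using const[of x] by simp
    then show "v = 0" by (simp add: vec_eq_iff)
  qed
  ultimately show ?thesis by (simp add: sgn_if split: if_splits)
qed

text \<open>
The \<open>\<mu>\<close>-weighted sum of the rows of \<open>- \<Delta>\<close> is zero. Replacing row \<open>x\<^sub>0\<close> of \<open>- \<Delta> - \<delta> 1\<^sub>P\<close> by the
weighted sum of all rows therefore pulls out a factor \<open>- \<delta>\<close>; what remains tends, as \<open>\<delta>\<close> goes to 0, to a
determinant as in the preceding lemma, which is positive.
\<close>

lemma det_lap_minus_small_neg:
  assumes "P \<noteq> {}"
  obtains \<delta>\<^sub>0 where "\<delta>\<^sub>0 > 0"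
    "\<And>\<delta>. 0 < \<delta> \<Longrightarrow> \<delta> < \<delta>\<^sub>0 \<Longrightarrow> det (lap_matrix - diag (\<lambda>x. \<delta> * indicator P x)) < 0"
proof -
  obtain x\<^sub>0 where "x\<^sub>0 \<in> P" using assms by blast
  define J where "J \<delta> = lap_matrix - diag (\<lambda>x. \<delta> * indicator P x)" for \<delta>
  define w :: "real ^ 'v" where "w = (\<chi> x. \<mu> x * indicator P x)"
  define \<Phi> where "\<Phi> \<delta> = (\<Sum>y\<in>UNIV. w $ y * row_cofactor (J \<delta>) x\<^sub>0 y)" for \<delta>
  have det_J: "det (J \<delta>) = - (\<delta> / \<mu> x\<^sub>0) * \<Phi> \<delta>" for \<delta>
  proof -
    have row: "(\<Sum>x\<in>UNIV. \<mu> x * J \<delta> $ x $ y) = - \<delta> * w $ y" for y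
    proof -
      have "(\<Sum>x\<in>UNIV. \<mu> x * lap_matrix $ x $ y)
          = (\<Sum>x\<in>UNIV. (if x = y then (\<Sum>z\<in>UNIV. \<omega> x z) else 0) - \<omega> x y)"
        using measure_pos by (intro sum.cong refl) (auto simp: lap_matrix_def right_diff_distrib less_imp_neq[symmetric])
      also have "\<dots> = 0"
        by (simp add: sum_subtractf weight_sym)
      finally have "(\<Sum>x\<in>UNIV. \<mu> x * lap_matrix $ x $ y) = 0" .
      moreover have "(\<Sum>x\<in>UNIV. \<mu> x * diag (\<lambda>x. \<delta> * indicator P x) $ x $ y) = \<delta> * w $ y"
        by (simp add: diag_def w_def if_distrib[of "(*) _"] cong: if_cong)
      ultimately show ?thesis
        by (simp add: J_def right_diff_distrib sum_subtractf)
    qed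
    have "\<mu> x\<^sub>0 * det (J \<delta>) = (\<Sum>x\<in>UNIV. \<mu> x * (if x = x\<^sub>0 then det (J \<delta>) else 0))"
      by (simp add: if_distrib[of "(*) _"] cong: if_cong)
    also have "\<dots> = (\<Sum>x\<in>UNIV. \<Sum>y\<in>UNIV. \<mu> x * J \<delta> $ x $ y * row_cofactor (J \<delta>) x\<^sub>0 y)"
      by (simp only: row_cofactor_expansion[symmetric] sum_distrib_left mult.assoc)
    also have "\<dots> = (\<Sum>y\<in>UNIV. (\<Sum>x\<in>UNIV. \<mu> x * J \<delta> $ x $ y) * row_cofactor (J \<delta>) x\<^sub>0 y)"
      by (subst sum.swap) (simp add: sum_distrib_right)
    also have "\<dots> = - \<delta> * \<Phi> \<delta>"
      unfolding row \<Phi>_def by (simp add: sum_distrib_left sum_negf mult.assoc)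
    finally show ?thesis
      using measure_pos[of x\<^sub>0] by (simp add: field_simps)
  qed
  have "continuous_on UNIV (\<lambda>\<delta>. if x = y then \<delta> * indicator P x else 0 :: real)" for x y :: 'v
    by (cases "x = y") (auto intro!: continuous_intros)
  then have "continuous_on UNIV J"
    unfolding J_def diag_def by (intro continuous_on_diff continuous_on_const continuous_on_vec_lambda)
  then have "continuous_on UNIV \<Phi>"
    unfolding \<Phi>_def by (intro continuous_intros)
  then have "open {\<delta>. 0 < \<Phi> \<delta>}"
    by (intro open_Collect_less continuous_intros)
  moreover have "0 < \<Phi> 0"
  proof -
    have "J 0 = lap_matrix" by (simp add: J_def diag_def vec_eq_iff)
    moreover have "w $ x \<ge> 0" for x
      using measure_pos[of x] by (simp add: w_def)
    moreover have "(\<Sum>x\<in>UNIV. w $ x) > 0"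
      using \<open>x\<^sub>0 \<in> P\<close> measure_pos
      by (intro sum_pos2[of _ x\<^sub>0]) (auto simp: w_def less_imp_le)
    ultimately show ?thesis
      using det_lap_replace_row_pos[of w x\<^sub>0] by (simp add: \<Phi>_def det_replace_row)
  qed
  ultimately obtain e where "e > 0" "ball 0 e \<subseteq> {\<delta>. 0 < \<Phi> \<delta>}"
    using open_contains_ball by (metis mem_Collect_eq)
  then have "\<Phi> \<delta> > 0" if "0 < \<delta>" "\<delta> < e" for \<delta>
    using that by (auto simp: subset_iff dist_norm)
  then have "det (J \<delta>) < 0" if "0 < \<delta>" "\<delta> < e" for \<delta>
    using that measure_pos[of x\<^sub>0] by (simp add: det_J)
  then show ?thesis
    using that[of e] \<open>e > 0\<close> unfolding J_def by blast
qed

text \<open>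
Put \<open>v = u - ln \<delta>\<close>, so that \<open>\<Delta>v = \<delta> 1\<^sub>P (1 - e\<^sup>v)\<close>. Integration gives \<open>min v \<le> 0 \<le> max v\<close>. As
\<open>1 - e\<^sup>v \<le> - min v\<close>, the maximum principle for \<open>- v\<close> bounds the oscillation of \<open>v\<close> by \<open>A \<delta> (- min v)\<close>,
which is at most \<open>A \<delta>\<close> times the oscillation. For \<open>A \<delta> < 1\<close> the oscillation is zero.
\<close>

lemma indicator_solution_unique:
  assumes "P \<noteq> {}"
  obtains \<delta>\<^sub>0 where "\<delta>\<^sub>0 > 0"
    "\<And>\<delta> u. 0 < \<delta> \<Longrightarrow> \<delta> < \<delta>\<^sub>0 \<Longrightarrow> solves (\<lambda>x. \<delta> * indicator P x) (indicator P) u \<Longrightarrow> (\<And>x. u x = ln \<delta>)"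
proof -
  obtain A where A: "A \<ge> 0" "\<And>P C u. C \<ge> 0 \<Longrightarrow> (\<And>z. z \<notin> P \<Longrightarrow> - C \<le> lap u z) \<Longrightarrow>
      (\<exists>z\<in>P. \<forall>x. u x \<le> u z + A * C) \<or> (\<forall>x y. u x \<le> u y + A * C)"
    using maximum_principle by blast
  show ?thesis
  proof (rule that[of "1 / (A + 1)"])
    show "1 / (A + 1) > 0" using A(1) by simp
    fix \<delta> u x
    assume \<delta>: "0 < \<delta>" "\<delta> < 1 / (A + 1)" and u: "solves (\<lambda>x. \<delta> * indicator P x) (indicator P) u"
    define v where "v x = u x - ln \<delta>" for x
    have "v = (\<lambda>x. u x + - ln \<delta>)"
      by (simp add: v_def fun_eq_iff)
    then have "lap v x = lap u x" for x
      by (simp only: lap_add_const)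
    then have lap_v: "lap v x = \<delta> * indicator P x * (1 - exp (v x))" for x
      using solvesD[OF u, of x] \<delta>(1) by (simp add: v_def exp_diff algebra_simps)
    obtain p where p: "\<And>x. v p \<le> v x" by (rule min_vertex[of v]) blast
    obtain q where q: "\<And>x. v x \<le> v q" by (rule max_vertex[of v]) blast
    have "(\<Sum>x\<in>P. \<mu> x * \<delta> * (1 - exp (v x)))
        = (\<Sum>x\<in>UNIV. if x \<in> P then \<mu> x * \<delta> * (1 - exp (v x)) else 0)"
      by (simp add: sum.If_cases)
    also have "\<dots> = (\<Sum>x\<in>UNIV. \<mu> x * lap v x)"
      by (intro sum.cong refl) (simp add: lap_v indicator_def)
    also have "\<dots> = 0"
      by (rule sum_measure_lap)
    finally have sum_P: "(\<Sum>x\<in>P. \<mu> x * \<delta> * (1 - exp (v x))) = 0" .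
    have "v p \<le> 0"
    proof (rule ccontr)
      assume "\<not> v p \<le> 0"
      then have "\<mu> x * \<delta> * (1 - exp (v x)) < 0" for x
        using p[of x] measure_pos[of x] \<delta>(1) by (intro mult_pos_neg) auto
      then have "(\<Sum>x\<in>P. - (\<mu> x * \<delta> * (1 - exp (v x)))) > 0"
        using assms by (intro sum_pos) (auto simp del: mult_minus_right)
      then show False unfolding sum_negf sum_P by simp
    qed
    have "0 \<le> v q"
    proof (rule ccontr)
      assume "\<not> 0 \<le> v q"
      then have "\<mu> x * \<delta> * (1 - exp (v x)) > 0" for x
        using q[of x] measure_pos[of x] \<delta>(1) by (intro mult_pos_pos) auto
      then have "(\<Sum>x\<in>P. \<mu> x * \<delta> * (1 - exp (v x))) > 0"
        using assms by (intro sum_pos) auto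
      with sum_P show False by simp
    qed
    have "- (\<delta> * (- v p)) \<le> lap (\<lambda>x. - v x) z" for z
    proof -
      have "1 - exp (v z) \<le> - v p"
        using exp_ge_add_one_self[of "v z"] p[of z] by linarith
      then have "indicator P z * (1 - exp (v z)) \<le> - v p"
        using \<open>v p \<le> 0\<close> by (simp add: indicator_def)
      then have "\<delta> * (indicator P z * (1 - exp (v z))) \<le> \<delta> * (- v p)"
        using \<delta>(1) by (intro mult_left_mono) auto
      then show ?thesis by (simp add: lap_uminus lap_v mult.assoc)
    qed
    then have "\<forall>x y. - v x \<le> - v y + A * (\<delta> * (- v p))"
      using A(2)[of "\<delta> * (- v p)" "{}" "\<lambda>x. - v x"] \<delta>(1) \<open>v p \<le> 0\<close> by (simp add: mult_nonneg_nonpos)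
    from this[rule_format, of p q] have osc: "v q - v p \<le> A * \<delta> * (- v p)"
      by (simp add: algebra_simps)
    have "A * \<delta> < 1"
      using \<delta> A(1) by (simp add: field_simps)
    have "v p = 0"
    proof (rule ccontr)
      assume "v p \<noteq> 0"
      then have "A * \<delta> * (- v p) < 1 * (- v p)"
        using \<open>v p \<le> 0\<close> \<open>A * \<delta> < 1\<close> by (intro mult_strict_right_mono) auto
      with osc \<open>0 \<le> v q\<close> show False by simp
    qed
    with osc \<open>0 \<le> v q\<close> have "v q = 0" by simp
    with \<open>v p = 0\<close> have "v x = 0" using p[of x] q[of x] by simp
    then show "u x = ln \<delta>" by (simp add: v_def)
  qed
qed

end

section \<open>The degree on large balls\<close>

lemma positive_lower_bound:
  fixes h :: "'a::finite \<Rightarrow> real"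
  obtains \<eta> where "\<eta> > 0" "\<And>x. h x > 0 \<Longrightarrow> \<eta> \<le> h x"
proof -
  define \<eta> where "\<eta> = Min (insert 1 (h ` {x. h x > 0}))"
  have "\<eta> > 0" unfolding \<eta>_def by (subst Min_gr_iff) auto
  moreover have "\<eta> \<le> h x" if "h x > 0" for x
    unfolding \<eta>_def using that by (intro Min_le) auto
  ultimately show ?thesis by (rule that)
qed

lemma abs_bound:
  fixes h :: "'a::finite \<Rightarrow> real"
  obtains H where "H > 0" "\<And>x. \<bar>h x\<bar> \<le> H"
proof
  show "1 + (\<Sum>x\<in>UNIV. \<bar>h x\<bar>) > 0" by (intro add_pos_nonneg sum_nonneg) auto
  have "\<bar>h x\<bar> \<le> (\<Sum>x\<in>UNIV. \<bar>h x\<bar>)" for x by (rule member_le_sum) auto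
  then show "\<bar>h x\<bar> \<le> 1 + (\<Sum>x\<in>UNIV. \<bar>h x\<bar>)" for x by (rule add_increasing[OF zero_le_one])
qed

lemma open_linf_ball: "open (linf_ball R)"
  unfolding linf_ball_def by (intro open_Collect_less continuous_intros)

lemma bounded_linf_ball: "bounded (linf_ball R :: (real ^ 'n::finite) set)"
proof (rule boundedI)
  fix u :: "real ^ 'n" assume "u \<in> linf_ball R"
  then have "infnorm u \<le> R" by (simp add: linf_ball_def)
  then have "sqrt DIM(real ^ 'n) * infnorm u \<le> sqrt DIM(real ^ 'n) * R"
    by (intro mult_left_mono) auto
  then show "norm u \<le> sqrt DIM(real ^ 'n) * R"
    using norm_le_infnorm[of u] by linarith
qed

lemma infnorm_frontier_linf_ball:
  assumes "u \<in> frontier (linf_ball R)"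
  shows "infnorm u = R"
proof -
  have "closed {u :: real ^ 'n. infnorm u \<le> R}"
    by (intro closed_Collect_le continuous_intros)
  then have "closure (linf_ball R) \<subseteq> {u :: real ^ 'n. infnorm u \<le> R}"
    by (intro closure_minimal) (auto simp: linf_ball_def)
  moreover have "u \<in> closure (linf_ball R)" and "u \<notin> linf_ball R"
    using assms unfolding frontier_def interior_open[OF open_linf_ball] by auto
  ultimately show ?thesis
    by (auto simp: linf_ball_def)
qed

lemma infnorm_le_if_components_le:
  fixes u :: "real ^ 'n::finite"
  assumes "\<And>x. \<bar>u $ x\<bar> \<le> B"
  shows "infnorm u \<le> B"
  unfolding infnorm_cart using assms by (intro cSup_least) auto

context weighted_graph
begin

text \<open>
The Kazdan-Warner map with \<open>c\<close> a function on the vertices, which the deformation for positive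
\<open>c\<close> needs.
\<close>

definition kw_map :: "('v \<Rightarrow> real) \<Rightarrow> ('v \<Rightarrow> real) \<Rightarrow> real ^ 'v \<Rightarrow> real ^ 'v" where
  "kw_map c h u = (\<chi> x. - lap (($) u) x + c x - h x * exp (u $ x))"

definition kw_jacobian :: "('v \<Rightarrow> real) \<Rightarrow> real ^ 'v \<Rightarrow> real ^ 'v ^ 'v" where
  "kw_jacobian h u = lap_matrix - diag (\<lambda>x. h x * exp (u $ x))"

lemma kw_map_eq_0_iff: "kw_map c h u = 0 \<longleftrightarrow> solves c h (($) u)"
  by (auto simp: kw_map_def solves_def vec_eq_iff algebra_simps)

lemma diagonally_nonlinear_kw_map: "diagonally_nonlinear (kw_map c h) (kw_jacobian h)"
  unfolding diagonally_nonlinear_def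
proof (intro conjI allI impI)
  fix u :: "real ^ 'v"
  have "((\<lambda>u. kw_map c h u $ x) has_derivative (\<lambda>v. (kw_jacobian h u *v v) $ x)) (at u)" for x
  proof -
    have "((\<lambda>u. (lap_matrix *v u) $ x) has_derivative (\<lambda>v. (lap_matrix *v v) $ x)) (at u)"
      by (intro bounded_linear_imp_has_derivative
          bounded_linear_compose[OF bounded_linear_vec_nth matrix_vector_mul_bounded_linear])
    moreover have "((\<lambda>u. u $ x) has_derivative (\<lambda>v. v $ x)) (at u)"
      by (intro bounded_linear_imp_has_derivative bounded_linear_vec_nth)
    ultimately have "((\<lambda>u. (lap_matrix *v u) $ x + c x - h x * exp (u $ x)) has_derivative
        (\<lambda>v. (lap_matrix *v v) $ x - h x * (exp (u $ x) * v $ x))) (at u)"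
      by (auto intro!: derivative_eq_intros simp: fun_eq_iff)
    then show ?thesis
      by (simp add: kw_map_def kw_jacobian_def lap_matrix_mult matrix_vector_mult_diff_rdistrib
          diag_mult mult.assoc)
  qed
  then show "(kw_map c h has_derivative (*v) (kw_jacobian h u)) (at u)"
    by (subst has_derivative_componentwise_within) (auto simp: Basis_vec_def inner_axis)
next
  have "continuous_on UNIV (\<lambda>u :: real ^ 'v. if x = y then h x * exp (u $ x) else 0)" for x y :: 'v
    by (cases "x = y") (auto intro!: continuous_intros)
  then show "continuous_on UNIV (kw_jacobian h)"
    unfolding kw_jacobian_def diag_def
    by (intro continuous_on_diff continuous_on_const continuous_on_vec_lambda)
next
  fix u :: "real ^ 'v" and s :: real and j k l :: 'v
  assume "\<not> (k = j \<and> l = j)"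
  then show "kw_jacobian h (u + s *\<^sub>R axis j 1) $ k $ l = kw_jacobian h u $ k $ l"
    by (auto simp: kw_jacobian_def diag_def axis_def)
qed

text \<open>
A degree is only assigned when no zero lies on the frontier, so this also says that the zeros form
a bounded set.
\<close>

definition large_ball_degree :: "('v \<Rightarrow> real) \<Rightarrow> ('v \<Rightarrow> real) \<Rightarrow> int \<Rightarrow> bool" where
  "large_ball_degree c h d \<longleftrightarrow> (\<exists>B. \<forall>R>B. has_brouwer_degree (kw_map c h) (linf_ball R) 0 d)"

lemma infnorm_solution_le:
  fixes u :: "real ^ 'v"
  assumes "\<And>x. - L \<le> u $ x" and "\<And>x. u $ x \<le> U"
  shows "infnorm u \<le> \<bar>L\<bar> + \<bar>U\<bar>"
proof (rule infnorm_le_if_components_le)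
  show "\<bar>u $ x\<bar> \<le> \<bar>L\<bar> + \<bar>U\<bar>" for x
    using assms(1)[of x] assms(2)[of x] by linarith
qed

end

text \<open>
From here on the degree theory enters, which uses a well-ordered index type.
\<close>

locale ordered_weighted_graph = weighted_graph \<omega> \<mu>
  for \<omega> :: "'v::{finite,wellorder} \<Rightarrow> 'v \<Rightarrow> real" and \<mu> :: "'v \<Rightarrow> real"
begin

text \<open>
The map is affine in \<open>(c, h)\<close>, so the segment between two maps consists of Kazdan-Warner maps,
whose zeros lie inside the ball.
\<close>

lemma large_ball_degree_homotopy:
  assumes bound: "\<And>t u. t \<in> {0..1} \<Longrightarrow>
      solves (\<lambda>x. (1 - t) * c\<^sub>0 x + t * c\<^sub>1 x) (\<lambda>x. (1 - t) * h\<^sub>0 x + t * h\<^sub>1 x) u \<Longrightarrow>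
      \<forall>x. - L \<le> u x \<and> u x \<le> U"
    and deg: "large_ball_degree c\<^sub>1 h\<^sub>1 d"
  shows "large_ball_degree c\<^sub>0 h\<^sub>0 d"
proof -
  obtain B where B: "\<And>R. R > B \<Longrightarrow> has_brouwer_degree (kw_map c\<^sub>1 h\<^sub>1) (linf_ball R) 0 d"
    using deg unfolding large_ball_degree_def by blast
  have "has_brouwer_degree (kw_map c\<^sub>0 h\<^sub>0) (linf_ball R) 0 d" if R: "R > max B (\<bar>L\<bar> + \<bar>U\<bar>)" for R
  proof (rule has_brouwer_degree_homotopy[OF diagonally_nonlinear_kw_map diagonally_nonlinear_kw_map
        open_linf_ball bounded_linf_ball])
    show "has_brouwer_degree (kw_map c\<^sub>1 h\<^sub>1) (linf_ball R) 0 d"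
      using R by (intro B) simp
    fix t :: real and u :: "real ^ 'v::_"
    assume t: "t \<in> {0..1}" and u: "u \<in> frontier (linf_ball R)"
    have "(1 - t) *\<^sub>R kw_map c\<^sub>0 h\<^sub>0 u + t *\<^sub>R kw_map c\<^sub>1 h\<^sub>1 u
        = kw_map (\<lambda>x. (1 - t) * c\<^sub>0 x + t * c\<^sub>1 x) (\<lambda>x. (1 - t) * h\<^sub>0 x + t * h\<^sub>1 x) u"
      by (simp add: kw_map_def vec_eq_iff algebra_simps)
    moreover have "\<not> solves (\<lambda>x. (1 - t) * c\<^sub>0 x + t * c\<^sub>1 x) (\<lambda>x. (1 - t) * h\<^sub>0 x + t * h\<^sub>1 x) (($) u)"
    proof
      assume "solves (\<lambda>x. (1 - t) * c\<^sub>0 x + t * c\<^sub>1 x) (\<lambda>x. (1 - t) * h\<^sub>0 x + t * h\<^sub>1 x) (($) u)"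
      then have "infnorm u \<le> \<bar>L\<bar> + \<bar>U\<bar>"
        using bound[OF t] by (intro infnorm_solution_le) auto
      then show False
        using R infnorm_frontier_linf_ball[OF u] by simp
    qed
    ultimately show "(1 - t) *\<^sub>R kw_map c\<^sub>0 h\<^sub>0 u + t *\<^sub>R kw_map c\<^sub>1 h\<^sub>1 u \<noteq> 0"
      by (simp add: kw_map_eq_0_iff)
  qed
  then show ?thesis unfolding large_ball_degree_def by blast
qed

lemma large_ball_degree_no_solution:
  assumes "\<And>u. \<not> solves c h u"
  shows "large_ball_degree c h 0"
proof -
  have "has_brouwer_degree (kw_map c h) (linf_ball R) 0 0" for R
    by (rule has_brouwer_degree_regular[OF diagonally_nonlinear_kw_map open_linf_ball bounded_linf_ball])
      (simp_all add: kw_map_eq_0_iff assms)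
  then show ?thesis unfolding large_ball_degree_def by blast
qed

lemma large_ball_degree_unique_const:
  assumes sol: "\<And>u. solves c h u \<longleftrightarrow> u = (\<lambda>_. a)"
    and det: "det (lap_matrix - diag (\<lambda>x. h x * exp a)) \<noteq> 0"
    and d: "of_int d = sgn (det (lap_matrix - diag (\<lambda>x. h x * exp a)))"
  shows "large_ball_degree c h d"
proof -
  let ?a = "(\<chi> x. a) :: real ^ 'v::_"
  have zero: "kw_map c h u = 0 \<longleftrightarrow> u = ?a" for u
    unfolding kw_map_eq_0_iff sol by (simp add: vec_eq_iff fun_eq_iff)
  have jac: "kw_jacobian h ?a = lap_matrix - diag (\<lambda>x. h x * exp a)"
    by (simp add: kw_jacobian_def)
  have "has_brouwer_degree (kw_map c h) (linf_ball R) 0 d" if R: "R > \<bar>a\<bar>" for R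
  proof (rule has_brouwer_degree_regular[OF diagonally_nonlinear_kw_map open_linf_ball bounded_linf_ball])
    have "infnorm ?a \<le> \<bar>a\<bar>"
      by (rule infnorm_le_if_components_le) simp
    then have inside: "infnorm ?a < R" using R by simp
    show "kw_map c h u \<noteq> 0" if "u \<in> frontier (linf_ball R)" for u
      using infnorm_frontier_linf_ball[OF that] inside by (auto simp: zero)
    have "{x \<in> linf_ball R. kw_map c h x = 0} = {?a}"
      using inside by (auto simp: zero linf_ball_def)
    then show "of_int d = (\<Sum>x\<in>{x \<in> linf_ball R. kw_map c h x = 0}. sgn (det (kw_jacobian h x)))"
      by (simp add: jac d)
    show "det (kw_jacobian h u) \<noteq> 0" if "kw_map c h u = 0" for u
      using that det by (simp add: zero jac)
  qed
  then show ?thesis unfolding large_ball_degree_def by blast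
qed

lemma large_ball_degree_indicator:
  assumes "P \<noteq> {}"
  obtains \<delta> where "\<delta> > 0" "large_ball_degree (\<lambda>x. \<delta> * indicator P x) (indicator P) (- 1)"
proof -
  obtain \<delta>\<^sub>1 where \<delta>\<^sub>1: "\<delta>\<^sub>1 > 0" "\<And>\<delta>. 0 < \<delta> \<Longrightarrow> \<delta> < \<delta>\<^sub>1 \<Longrightarrow> det (lap_matrix - diag (\<lambda>x. \<delta> * indicator P x)) < 0"
    using det_lap_minus_small_neg[OF assms] by blast
  obtain \<delta>\<^sub>2 where \<delta>\<^sub>2: "\<delta>\<^sub>2 > 0" "\<And>\<delta> u x. 0 < \<delta> \<Longrightarrow> \<delta> < \<delta>\<^sub>2 \<Longrightarrow>
      solves (\<lambda>x. \<delta> * indicator P x) (indicator P) u \<Longrightarrow> u x = ln \<delta>"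
    using indicator_solution_unique[OF assms] by blast
  define \<delta> where "\<delta> = min \<delta>\<^sub>1 \<delta>\<^sub>2 / 2"
  have \<delta>: "0 < \<delta>" "\<delta> < \<delta>\<^sub>1" "\<delta> < \<delta>\<^sub>2" using \<delta>\<^sub>1(1) \<delta>\<^sub>2(1) by (auto simp: \<delta>_def)
  have det: "det (lap_matrix - diag (\<lambda>x. indicator P x * exp (ln \<delta>))) < 0"
    using \<delta>\<^sub>1(2)[OF \<delta>(1,2)] \<delta>(1) by (simp add: mult.commute)
  have "large_ball_degree (\<lambda>x. \<delta> * indicator P x) (indicator P) (- 1)"
  proof (rule large_ball_degree_unique_const[where a = "ln \<delta>"])
    show "solves (\<lambda>x. \<delta> * indicator P x) (indicator P) u \<longleftrightarrow> u = (\<lambda>_. ln \<delta>)" for u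
    proof
      show "solves (\<lambda>x. \<delta> * indicator P x) (indicator P) u \<Longrightarrow> u = (\<lambda>_. ln \<delta>)"
        using \<delta>\<^sub>2(2)[OF \<delta>(1,3)] by blast
      show "u = (\<lambda>_. ln \<delta>) \<Longrightarrow> solves (\<lambda>x. \<delta> * indicator P x) (indicator P) u"
        using \<delta>(1) by (simp add: solves_def lap_def)
    qed
  qed (use det in auto)
  then show ?thesis using that \<delta>(1) by blast
qed

text \<open>
Along the segment to the indicator data the set \<open>P\<close> of vertices with \<open>h > 0\<close> is constant, \<open>h\<close>
stays above a positive constant on it and nonpositive off it, and \<open>\<integral> c\<close> stays above a positive
constant. This is what makes the bounds uniform: solutions can blow up when \<open>h\<close> tends to 0 from
above at a vertex, so \<open>h\<close> is never allowed to become positive at a vertex outside \<open>P\<close>.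
\<close>

lemma large_ball_degree_positive:
  assumes "c > 0" and "h x\<^sub>0 > 0"
  shows "large_ball_degree (\<lambda>_. c) h (- 1)"
proof -
  define P where "P = {x. h x > 0}"
  have "x\<^sub>0 \<in> P" using assms by (simp add: P_def)
  then obtain \<delta> where \<delta>: "\<delta> > 0" "large_ball_degree (\<lambda>x. \<delta> * indicator P x) (indicator P) (- 1)"
    using large_ball_degree_indicator[of P] by blast
  obtain \<eta> where \<eta>: "\<eta> > 0" "\<And>x. h x > 0 \<Longrightarrow> \<eta> \<le> h x"
    by (rule positive_lower_bound[of h]) blast
  obtain H where H: "H > 0" "\<And>x. \<bar>h x\<bar> \<le> H"
    by (rule abs_bound[of h]) blast
  \<comment> \<open>a lower bound for \<open>\<integral> c\<close> along the segment: the contribution of \<open>x\<^sub>0\<close> alone\<close>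
  define \<kappa> where "\<kappa> = \<mu> x\<^sub>0 * min c \<delta>"
  have "\<kappa> > 0" using assms \<delta>(1) measure_pos[of x\<^sub>0] by (simp add: \<kappa>_def)
  obtain L where L: "\<And>c' h u x. (\<And>x. \<bar>c' x\<bar> \<le> c + \<delta>) \<Longrightarrow> (\<And>x. \<bar>h x\<bar> \<le> H + 1) \<Longrightarrow>
      \<kappa> \<le> \<bar>\<Sum>x\<in>UNIV. \<mu> x * c' x\<bar> \<Longrightarrow> solves c' h u \<Longrightarrow> - L \<le> u x"
    by (rule solution_lower_bound[of "c + \<delta>" "H + 1" \<kappa>]) (use assms \<delta>(1) H(1) \<open>\<kappa> > 0\<close> in \<open>simp, simp, simp, blast\<close>)
  obtain U where U: "\<And>c' h u P x. P \<noteq> {} \<Longrightarrow> (\<And>x. x \<in> P \<Longrightarrow> min \<eta> 1 \<le> h x) \<Longrightarrow> (\<And>x. x \<notin> P \<Longrightarrow> h x \<le> 0) \<Longrightarrow>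
      (\<And>x. \<bar>c' x\<bar> \<le> c + \<delta>) \<Longrightarrow> solves c' h u \<Longrightarrow> (\<And>x. - \<bar>L\<bar> \<le> u x) \<Longrightarrow> u x \<le> U"
    by (rule solution_upper_bound[of "min \<eta> 1" "c + \<delta>" "\<bar>L\<bar>"]) (use assms \<delta>(1) \<eta>(1) in \<open>simp, simp, simp, blast\<close>)
  show ?thesis
  proof (rule large_ball_degree_homotopy[OF _ \<delta>(2)])
    fix t :: real and u
    define c' where "c' x = (1 - t) * c + t * (\<delta> * indicator P x)" for x
    define h' where "h' x = (1 - t) * h x + t * indicator P x" for x
    assume t: "t \<in> {0..1}"
      and "solves (\<lambda>x. (1 - t) * c + t * (\<delta> * indicator P x)) (\<lambda>x. (1 - t) * h x + t * indicator P x) u"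
    then have u: "solves c' h' u"
      unfolding c'_def[abs_def] h'_def[abs_def] by blast
    have c'_nonneg: "c' x \<ge> 0" for x
      unfolding c'_def using t assms \<delta>(1) by (intro add_nonneg_nonneg mult_nonneg_nonneg) auto
    have "c' x \<le> c + \<delta>" for x
    proof -
      have "(1 - t) * c \<le> 1 * c" "t * (\<delta> * indicator P x) \<le> 1 * \<delta>"
        using t assms \<delta>(1) by (intro mult_mono; auto simp: indicator_def)+
      then show ?thesis by (simp add: c'_def)
    qed
    then have c': "\<bar>c' x\<bar> \<le> c + \<delta>" for x using c'_nonneg[of x] by simp
    have h': "\<bar>h' x\<bar> \<le> H + 1" for x
    proof -
      have "\<bar>(1 - t) * h x\<bar> \<le> 1 * H" "\<bar>t * indicator P x\<bar> \<le> 1 * 1"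
        unfolding abs_mult using t H by (intro mult_mono; auto simp: indicator_def)+
      then show ?thesis unfolding h'_def by linarith
    qed
    have "\<kappa> \<le> \<mu> x\<^sub>0 * c' x\<^sub>0"
    proof -
      have "min c \<delta> = (1 - t) * min c \<delta> + t * min c \<delta>" by (simp add: algebra_simps)
      also have "\<dots> \<le> (1 - t) * c + t * \<delta>"
        using t by (intro add_mono mult_left_mono) auto
      finally show ?thesis
        unfolding \<kappa>_def using measure_pos[of x\<^sub>0] \<open>x\<^sub>0 \<in> P\<close> by (simp add: c'_def mult_left_mono)
    qed
    also have "\<dots> \<le> (\<Sum>x\<in>UNIV. \<mu> x * c' x)"
      using c'_nonneg measure_pos by (intro member_le_sum) (auto simp: less_imp_le)
    finally have "\<kappa> \<le> \<bar>\<Sum>x\<in>UNIV. \<mu> x * c' x\<bar>" by linarith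
    from L[OF c' h' this u] have low: "- L \<le> u x" for x .
    have h'_P: "min \<eta> 1 \<le> h' x" if "x \<in> P" for x
    proof -
      have "min \<eta> 1 = (1 - t) * min \<eta> 1 + t * min \<eta> 1" by (simp add: algebra_simps)
      also have "\<dots> \<le> (1 - t) * h x + t * 1"
        using t \<eta>(2)[of x] that by (intro add_mono mult_left_mono) (auto simp: P_def)
      finally show ?thesis using that by (simp add: h'_def)
    qed
    have h'_off: "h' x \<le> 0" if "x \<notin> P" for x
      using that t by (simp add: h'_def P_def mult_nonneg_nonpos)
    have "u x \<le> U" for x
    proof (rule U[OF _ h'_P h'_off c' u])
      show "P \<noteq> {}" using \<open>x\<^sub>0 \<in> P\<close> by blast
      show "- \<bar>L\<bar> \<le> u x" for x using low[of x] by linarith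
    qed
    with low show "\<forall>x. - L \<le> u x \<and> u x \<le> U" by blast
  qed
qed

lemma large_ball_degree_zero:
  assumes "h x\<^sub>0 > 0" and "(\<Sum>x\<in>UNIV. \<mu> x * h x) < 0"
  shows "large_ball_degree (\<lambda>_. 0) h (- 1)"
proof -
  define P where "P = {x. h x > 0}"
  obtain \<eta> where \<eta>: "\<eta> > 0" "\<And>x. h x > 0 \<Longrightarrow> \<eta> \<le> h x"
    by (rule positive_lower_bound[of h]) blast
  obtain L where L: "\<And>c u x. 0 \<le> c \<Longrightarrow> c \<le> 1 \<Longrightarrow> solves (\<lambda>_. c) h u \<Longrightarrow> - L \<le> u x"
    by (rule solution_lower_bound_zero[OF assms(2)]) blast
  obtain U where U: "\<And>c' h u P x. P \<noteq> {} \<Longrightarrow> (\<And>x. x \<in> P \<Longrightarrow> \<eta> \<le> h x) \<Longrightarrow> (\<And>x. x \<notin> P \<Longrightarrow> h x \<le> 0) \<Longrightarrow>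
      (\<And>x. \<bar>c' x\<bar> \<le> 1) \<Longrightarrow> solves c' h u \<Longrightarrow> (\<And>x. - \<bar>L\<bar> \<le> u x) \<Longrightarrow> u x \<le> U"
    by (rule solution_upper_bound[of \<eta> 1 "\<bar>L\<bar>"]) (use \<eta>(1) in \<open>simp, simp, simp, blast\<close>)
  have "large_ball_degree (\<lambda>_. 1) h (- 1)"
    by (rule large_ball_degree_positive[of 1 h x\<^sub>0]) (use assms(1) in simp_all)
  then show ?thesis
  proof (rule large_ball_degree_homotopy[rotated])
    fix t :: real and u
    assume t: "t \<in> {0..1}" and "solves (\<lambda>x. (1 - t) * 0 + t * 1) (\<lambda>x. (1 - t) * h x + t * h x) u"
    then have u: "solves (\<lambda>_. t) h u" by (simp add: algebra_simps)
    have low: "- L \<le> u x" for x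
      using L[OF _ _ u] t by simp
    have "u x \<le> U" for x
    proof (rule U[OF _ _ _ _ u])
      show "P \<noteq> {}" using assms(1) by (auto simp: P_def)
      show "- \<bar>L\<bar> \<le> u x" for x using low[of x] by linarith
    qed (use t \<eta>(2) in \<open>auto simp: P_def\<close>)
    with low show "\<forall>x. - L \<le> u x \<and> u x \<le> U" by blast
  qed
qed

lemma large_ball_degree_negative_sign_changing:
  assumes "c < 0" and "h x\<^sub>0 > 0"
  shows "large_ball_degree (\<lambda>_. c) h 0"
proof -
  define P where "P = {x. h x > 0}"
  obtain \<eta> where \<eta>: "\<eta> > 0" "\<And>x. h x > 0 \<Longrightarrow> \<eta> \<le> h x"
    by (rule positive_lower_bound[of h]) blast
  obtain H where H: "H > 0" "\<And>x. \<bar>h x\<bar> \<le> H"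
    by (rule abs_bound[of h]) blast
  obtain C where C: "C > 0" "\<And>c u. c \<le> - C \<Longrightarrow> \<not> solves (\<lambda>_. c) h u"
    by (rule no_solution_very_negative[of h, OF assms(2)]) blast
  \<comment> \<open>a lower bound for \<open>- \<integral> c\<close> along the segment, from the contribution of \<open>x\<^sub>0\<close>\<close>
  define \<kappa> where "\<kappa> = \<mu> x\<^sub>0 * min (- c) C"
  have "\<kappa> > 0" using assms C(1) measure_pos[of x\<^sub>0] by (simp add: \<kappa>_def)
  obtain L where L: "\<And>c' h u x. (\<And>x. \<bar>c' x\<bar> \<le> C - c) \<Longrightarrow> (\<And>x. \<bar>h x\<bar> \<le> H) \<Longrightarrow>
      \<kappa> \<le> \<bar>\<Sum>x\<in>UNIV. \<mu> x * c' x\<bar> \<Longrightarrow> solves c' h u \<Longrightarrow> - L \<le> u x"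
    by (rule solution_lower_bound[of "C - c" H \<kappa>]) (use assms C(1) H(1) \<open>\<kappa> > 0\<close> in \<open>simp, simp, simp, blast\<close>)
  obtain U where U: "\<And>c' h u P x. P \<noteq> {} \<Longrightarrow> (\<And>x. x \<in> P \<Longrightarrow> \<eta> \<le> h x) \<Longrightarrow> (\<And>x. x \<notin> P \<Longrightarrow> h x \<le> 0) \<Longrightarrow>
      (\<And>x. \<bar>c' x\<bar> \<le> C - c) \<Longrightarrow> solves c' h u \<Longrightarrow> (\<And>x. - \<bar>L\<bar> \<le> u x) \<Longrightarrow> u x \<le> U"
    by (rule solution_upper_bound[of \<eta> "C - c" "\<bar>L\<bar>"]) (use assms C(1) \<eta>(1) in \<open>simp, simp, simp, blast\<close>)
  have "large_ball_degree (\<lambda>_. - C) h 0"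
    using C(2) by (intro large_ball_degree_no_solution) simp
  then show ?thesis
  proof (rule large_ball_degree_homotopy[rotated])
    fix t :: real and u
    define c' where "c' = (1 - t) * c + t * (- C)"
    assume t: "t \<in> {0..1}" and "solves (\<lambda>x. (1 - t) * c + t * (- C)) (\<lambda>x. (1 - t) * h x + t * h x) u"
    then have u: "solves (\<lambda>_. c') h u" by (simp add: c'_def algebra_simps)
    have "(1 - t) * (- c) \<le> 1 * (- c)" "t * C \<le> 1 * C"
      using t assms C(1) by (intro mult_right_mono; auto)+
    moreover have "- c' = (1 - t) * (- c) + t * C"
      by (simp add: c'_def)
    ultimately have "- c' \<le> C - c"
      by linarith
    moreover have "min (- c) C \<le> - c'"
    proof -
      have "min (- c) C = (1 - t) * min (- c) C + t * min (- c) C" by (simp add: algebra_simps)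
      also have "\<dots> \<le> (1 - t) * (- c) + t * C"
        using t by (intro add_mono mult_left_mono) auto
      finally show ?thesis by (simp add: c'_def)
    qed
    moreover have "min (- c) C > 0" using assms C(1) by simp
    ultimately have c': "\<bar>c'\<bar> \<le> C - c" and "c' < 0"
      by linarith+
    have "\<kappa> \<le> \<mu> x\<^sub>0 * (- c')"
      unfolding \<kappa>_def using \<open>min (- c) C \<le> - c'\<close> measure_pos[of x\<^sub>0]
      by (intro mult_left_mono) auto
    also have "\<dots> \<le> (\<Sum>x\<in>UNIV. \<mu> x * (- c'))"
      using \<open>c' < 0\<close> measure_pos by (intro member_le_sum) (auto simp: less_imp_le mult_nonneg_nonpos)
    finally have "\<kappa> \<le> \<bar>\<Sum>x\<in>UNIV. \<mu> x * c'\<bar>" by (simp add: sum_negf)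
    from L[OF c' H(2) this u] have low: "- L \<le> u x" for x .
    have "u x \<le> U" for x
    proof (rule U[OF _ _ _ c' u])
      show "P \<noteq> {}" using assms(2) by (auto simp: P_def)
      show "- \<bar>L\<bar> \<le> u x" for x using low[of x] by linarith
    qed (use \<eta>(2) in \<open>auto simp: P_def\<close>)
    with low show "\<forall>x. - L \<le> u x \<and> u x \<le> U" by blast
  qed
qed

text \<open>
At a maximum point \<open>\<Delta>u \<le> 0\<close>, and at a minimum point \<open>\<Delta>u \<ge> 0\<close>; for \<open>h = - 1\<close> this gives
\<open>e\<^bsup>max u\<^esup> \<le> - c \<le> e\<^bsup>min u\<^esup>\<close>.
\<close>

lemma large_ball_degree_const:
  assumes "c < 0"
  shows "large_ball_degree (\<lambda>_. c) (\<lambda>_. - 1) 1"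
proof -
  have "lap_matrix - diag (\<lambda>x. - 1 * exp (ln (- c))) = lap_matrix + diag (\<lambda>_. - c)"
    using assms by (simp add: vec_eq_iff diag_def)
  moreover have "det (lap_matrix + diag (\<lambda>_. - c)) > 0"
    using assms by (intro det_lap_plus_diag_pos) auto
  ultimately have det: "det (lap_matrix - diag (\<lambda>x. - 1 * exp (ln (- c)))) > 0"
    by (simp only:)
  show ?thesis
  proof (rule large_ball_degree_unique_const[where a = "ln (- c)"])
    fix u
    show "solves (\<lambda>_. c) (\<lambda>_. - 1) u \<longleftrightarrow> u = (\<lambda>_. ln (- c))"
    proof
      assume u: "solves (\<lambda>_. c) (\<lambda>_. - 1) u"
      obtain p where p: "\<And>x. u p \<le> u x" by (rule min_vertex[of u]) blast
      obtain q where q: "\<And>x. u x \<le> u q" by (rule max_vertex[of u]) blast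
      have "- c \<le> exp (u p)"
        using lap_at_min[of u p] p by (simp add: solvesD[OF u])
      then have "ln (- c) \<le> u p"
        using assms by (intro ln_le_if_le_exp) auto
      moreover have "exp (u q) \<le> - c"
        using lap_at_max[of u q] q by (simp add: solvesD[OF u])
      then have "u q \<le> ln (- c)"
        using assms by (simp add: ln_ge_iff)
      ultimately have "u x = ln (- c)" for x
        using p[of x] q[of x] by linarith
      then show "u = (\<lambda>_. ln (- c))" by blast
    next
      assume "u = (\<lambda>_. ln (- c))"
      then show "solves (\<lambda>_. c) (\<lambda>_. - 1) u"
        using assms by (simp add: solves_def lap_def)
    qed
  qed (use det in auto)
qed

lemma large_ball_degree_nonpositive:
  assumes "c < 0" and h: "\<And>x. h x \<le> 0" and "h x\<^sub>0 < 0"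
  shows "large_ball_degree (\<lambda>_. c) h 1"
proof -
  obtain H where H: "H > 0" "\<And>x. \<bar>h x\<bar> \<le> H"
    by (rule abs_bound[of h]) blast
  \<comment> \<open>a lower bound for \<open>- \<integral> h\<close> along the segment, from the contribution of \<open>x\<^sub>0\<close>\<close>
  define I where "I = \<mu> x\<^sub>0 * min (- h x\<^sub>0) 1"
  have "I > 0" using assms measure_pos[of x\<^sub>0] by (simp add: I_def)
  define \<kappa> where "\<kappa> = - c * (\<Sum>x\<in>UNIV. \<mu> x)"
  have "\<kappa> > 0" unfolding \<kappa>_def using assms(1) sum_measure_pos by (simp add: mult_neg_pos)
  obtain L where L: "\<And>c' h u x. (\<And>x. \<bar>c' x\<bar> \<le> - c) \<Longrightarrow> (\<And>x. \<bar>h x\<bar> \<le> H + 1) \<Longrightarrow>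
      \<kappa> \<le> \<bar>\<Sum>x\<in>UNIV. \<mu> x * c' x\<bar> \<Longrightarrow> solves c' h u \<Longrightarrow> - L \<le> u x"
    by (rule solution_lower_bound[of "- c" "H + 1" \<kappa>]) (use assms(1) H(1) \<open>\<kappa> > 0\<close> in \<open>simp, simp, simp, blast\<close>)
  obtain U where U: "\<And>h u x. (\<And>x. h x \<le> 0) \<Longrightarrow> (\<Sum>x\<in>UNIV. \<mu> x * h x) \<le> - I \<Longrightarrow>
      solves (\<lambda>_. c) h u \<Longrightarrow> u x \<le> U"
    by (rule solution_bound_nonpositive[OF assms(1) \<open>I > 0\<close>]) blast
  show ?thesis
  proof (rule large_ball_degree_homotopy[OF _ large_ball_degree_const[OF assms(1)]])
    fix t :: real and u
    define h' where "h' x = (1 - t) * h x + t * - 1" for x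
    assume t: "t \<in> {0..1}" and "solves (\<lambda>x. (1 - t) * c + t * c) (\<lambda>x. (1 - t) * h x + t * - 1) u"
    then have u: "solves (\<lambda>_. c) h' u"
      unfolding h'_def[abs_def] by (simp add: left_diff_distrib)
    have h'_nonpos: "h' x \<le> 0" for x
    proof -
      have "(1 - t) * h x \<le> 0" using t h[of x] by (intro mult_nonneg_nonpos) auto
      then show ?thesis using t by (simp add: h'_def)
    qed
    have h': "\<bar>h' x\<bar> \<le> H + 1" for x
    proof -
      have "\<bar>(1 - t) * h x\<bar> \<le> 1 * H"
        unfolding abs_mult using t H by (intro mult_mono) auto
      then show ?thesis using t unfolding h'_def by simp linarith
    qed
    have "I \<le> \<mu> x\<^sub>0 * - h' x\<^sub>0"
    proof -
      have "min (- h x\<^sub>0) 1 = (1 - t) * min (- h x\<^sub>0) 1 + t * min (- h x\<^sub>0) 1" by (simp add: algebra_simps)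
      also have "\<dots> \<le> (1 - t) * (- h x\<^sub>0) + t * 1"
        using t by (intro add_mono mult_left_mono) auto
      finally have "min (- h x\<^sub>0) 1 \<le> - h' x\<^sub>0" by (simp add: h'_def)
      then show ?thesis unfolding I_def using measure_pos[of x\<^sub>0] by (intro mult_left_mono) auto
    qed
    also have "\<dots> \<le> (\<Sum>x\<in>UNIV. \<mu> x * - h' x)"
      using h'_nonpos measure_pos by (intro member_le_sum) (auto simp: less_imp_le mult_nonneg_nonpos)
    finally have I: "(\<Sum>x\<in>UNIV. \<mu> x * h' x) \<le> - I" by (simp add: sum_negf)
    have "- L \<le> u x" for x
    proof (rule L[OF _ h' _ u])
      show "\<kappa> \<le> \<bar>\<Sum>x\<in>UNIV. \<mu> x * c\<bar>"
      proof -
        have "\<kappa> = - (\<Sum>x\<in>UNIV. \<mu> x * c)"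
          by (simp add: \<kappa>_def sum_distrib_left sum_negf mult.commute)
        then show ?thesis by (simp only: abs_ge_minus_self)
      qed
    qed (use assms(1) in simp)
    moreover have "u x \<le> U" for x
      by (rule U[OF h'_nonpos I u])
    ultimately show "\<forall>x. - L \<le> u x \<and> u x \<le> U" by blast
  qed
qed

end

section \<open>Relabelling the coordinates\<close>

text \<open>
A copy of a finite type, ordered by an arbitrary enumeration.
\<close>

typedef 'a ordered_copy = "UNIV :: 'a set" ..

instance ordered_copy :: (finite) finite
proof
  have "(UNIV :: 'a ordered_copy set) = Abs_ordered_copy ` UNIV"
    by (metis Abs_ordered_copy_cases UNIV_eq_I rangeI)
  then show "finite (UNIV :: 'a ordered_copy set)" by (metis finite finite_imageI)
qed

instantiation ordered_copy :: (finite) wellorder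
begin

definition less_eq_ordered_copy :: "'a ordered_copy \<Rightarrow> 'a ordered_copy \<Rightarrow> bool" where
  "a \<le> b \<longleftrightarrow> to_nat_on UNIV (Rep_ordered_copy a) \<le> to_nat_on UNIV (Rep_ordered_copy b)"

definition less_ordered_copy :: "'a ordered_copy \<Rightarrow> 'a ordered_copy \<Rightarrow> bool" where
  "a < b \<longleftrightarrow> to_nat_on UNIV (Rep_ordered_copy a) < to_nat_on UNIV (Rep_ordered_copy b)"

instance
proof
  fix a b c :: "'a ordered_copy"
  show "a < b \<longleftrightarrow> a \<le> b \<and> \<not> b \<le> a"
    by (auto simp: less_eq_ordered_copy_def less_ordered_copy_def)
  show "a \<le> a" by (simp add: less_eq_ordered_copy_def)
  show "a \<le> b \<Longrightarrow> b \<le> c \<Longrightarrow> a \<le> c" by (simp add: less_eq_ordered_copy_def)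
  show "a \<le> b \<or> b \<le> a" by (auto simp: less_eq_ordered_copy_def)
  assume "a \<le> b" "b \<le> a"
  then have "to_nat_on UNIV (Rep_ordered_copy a) = to_nat_on UNIV (Rep_ordered_copy b)"
    by (simp add: less_eq_ordered_copy_def)
  then have "Rep_ordered_copy a = Rep_ordered_copy b"
    using inj_on_to_nat_on[of "UNIV :: 'a set"] by (simp add: inj_on_def countable_finite)
  then show "a = b" by (simp add: Rep_ordered_copy_inject)
next
  fix P :: "'a ordered_copy \<Rightarrow> bool" and a
  assume step: "\<And>x. (\<And>y. y < x \<Longrightarrow> P y) \<Longrightarrow> P x"
  show "P a"
    by (induction a rule: measure_induct_rule[of "\<lambda>a. to_nat_on UNIV (Rep_ordered_copy a)"])
      (rule step, simp add: less_ordered_copy_def)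
qed

end

definition relabel :: "('b \<Rightarrow> 'a) \<Rightarrow> real ^ 'a::finite \<Rightarrow> real ^ 'b::finite" where
  "relabel \<pi> u = (\<chi> i. u $ \<pi> i)"

lemma bounded_linear_relabel: "bounded_linear (relabel \<pi>)"
  unfolding relabel_def
  by (intro linear_conv_bounded_linear[THEN iffD1] linearI) (simp_all add: vec_eq_iff)

lemma relabel_inverse:
  assumes "bij \<pi>"
  shows "relabel (inv \<pi>) (relabel \<pi> u) = u" and "relabel \<pi> (relabel (inv \<pi>) v) = v"
  using assms by (simp_all add: relabel_def bij_is_surj surj_f_inv_f bij_is_inj)

lemma det_relabel:
  fixes A :: "real ^ 'a::finite ^ 'a"
  assumes "bij (\<pi> :: 'b::finite \<Rightarrow> 'a)"
  shows "det (\<chi> i j. A $ \<pi> i $ \<pi> j) = det A"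
proof -
  let ?\<phi> = "map_permutation UNIV \<pi>"
  have inj: "inj \<pi>" and inv: "inv \<pi> (\<pi> i) = i" for i
    using assms by (simp_all add: bij_is_inj)
  have \<phi>: "?\<phi> p x = \<pi> (p (inv \<pi> x))" for p x
    using assms by (simp add: map_permutation_def restrict_id_def bij_is_surj)
  have "bij_betw ?\<phi> {p. p permutes UNIV} {p. p permutes UNIV}"
    using bij_betw_permutations[OF assms] by (simp add: \<phi>[abs_def, symmetric])
  then have "det A = (\<Sum>p\<in>{p. p permutes (UNIV :: 'b set)}. of_int (sign (?\<phi> p)) * (\<Prod>x\<in>UNIV. A $ x $ ?\<phi> p x))"
    unfolding det_def by (rule sum.reindex_bij_betw[symmetric])
  also have "\<dots> = (\<Sum>p\<in>{p. p permutes (UNIV :: 'b set)}. of_int (sign p) * (\<Prod>i\<in>UNIV. A $ \<pi> i $ \<pi> (p i)))"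
  proof (intro sum.cong refl arg_cong2[of _ _ _ _ "(*)"])
    fix p assume "p \<in> {p. p permutes (UNIV :: 'b set)}"
    then show "of_int (sign (?\<phi> p)) = (of_int (sign p) :: real)"
      using inj by (simp add: sign_map_permutation)
    show "(\<Prod>x\<in>UNIV. A $ x $ ?\<phi> p x) = (\<Prod>i\<in>UNIV. A $ \<pi> i $ \<pi> (p i))"
      using prod.reindex_bij_betw[OF assms, of "\<lambda>x. A $ x $ ?\<phi> p x"] by (simp add: \<phi> inv)
  qed
  finally show ?thesis by (simp add: det_def)
qed

text \<open>
Relabelling the coordinates along a bijection is an isometry, and conjugation with it permutes the
rows and columns of the Jacobian in the same way, which leaves its determinant unchanged.
\<close>

lemma has_brouwer_degree_relabel_imp:
  fixes f :: "real ^ 'a::finite \<Rightarrow> real ^ 'a" and \<pi> :: "'b::finite \<Rightarrow> 'a"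
  assumes \<pi>: "bij \<pi>" and deg: "has_brouwer_degree f \<Omega> p d"
  shows "has_brouwer_degree (\<lambda>v. relabel \<pi> (f (relabel (inv \<pi>) v))) (relabel \<pi> ` \<Omega>) (relabel \<pi> p) d"
proof -
  define \<rho> where "\<rho> = relabel \<pi>"
  define \<rho>' where "\<rho>' = relabel (inv \<pi>)"
  define g where "g v = \<rho> (f (\<rho>' v))" for v
  define J where "J v = (\<chi> i j. jacobian f (at (\<rho>' v)) $ \<pi> i $ \<pi> j)" for v
  have inv [simp]: "\<rho>' (\<rho> u) = u" "\<rho> (\<rho>' v) = v" for u v
    unfolding \<rho>_def \<rho>'_def by (simp_all add: relabel_inverse[OF \<pi>])
  have inj: "inj \<rho>" by (metis injI inv(1))
  have lin: "bounded_linear \<rho>" "bounded_linear \<rho>'"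
    unfolding \<rho>_def \<rho>'_def by (rule bounded_linear_relabel)+
  have cont: "continuous_on S \<rho>" "continuous_on T \<rho>'" for S T
    using lin by (simp_all add: linear_continuous_on)
  have image_iff': "v \<in> \<rho> ` S \<longleftrightarrow> \<rho>' v \<in> S" for v S
    by (metis image_iff inv)
  have iso: "dist (\<rho>' v) (\<rho>' w) = dist v w" for v w
  proof -
    have "(\<Sum>i\<in>UNIV. (dist (v $ inv \<pi> i) (w $ inv \<pi> i))\<^sup>2) = (\<Sum>i\<in>UNIV. (dist (v $ i) (w $ i))\<^sup>2)"
      using sum.reindex_bij_betw[OF bij_imp_bij_inv[OF \<pi>], of "\<lambda>i. (dist (v $ i) (w $ i))\<^sup>2"] by simp
    then show ?thesis by (simp add: \<rho>'_def relabel_def dist_vec_def L2_set_def)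
  qed
  have f: "open \<Omega>" "bounded \<Omega>" "continuous_on (closure \<Omega>) f" "\<And>u. u \<in> \<Omega> \<Longrightarrow> f differentiable (at u)"
    "continuous_on \<Omega> (\<lambda>u. jacobian f (at u))" "p \<notin> f ` frontier \<Omega>"
    using deg unfolding has_brouwer_degree_def by auto
  have "\<rho> ` \<Omega> = \<rho>' -` \<Omega>"
    by (auto simp: image_iff')
  then have open': "open (\<rho> ` \<Omega>)"
    using f(1) cont(2) by (simp add: open_vimage)
  have closure: "closure (\<rho> ` \<Omega>) = \<rho> ` closure \<Omega>"
    using lin(1) inj by (intro closure_injective_linear_image[symmetric]) (auto simp: bounded_linear.linear)
  have frontier: "frontier (\<rho> ` \<Omega>) = \<rho> ` frontier \<Omega>"
    unfolding frontier_def closure interior_open[OF open'] interior_open[OF f(1)]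
    by (rule image_set_diff[OF inj, symmetric])
  have g': "(g has_derivative (*v) (J v)) (at v)" if "v \<in> \<rho> ` \<Omega>" for v
  proof -
    have "\<rho>' v \<in> \<Omega>" using that by (simp add: image_iff')
    then have "(f has_derivative (*v) (jacobian f (at (\<rho>' v)))) (at (\<rho>' v))"
      using f(4) by (simp add: jacobian_works[symmetric])
    then have "((\<lambda>v. \<rho> (f (\<rho>' v))) has_derivative (\<lambda>w. \<rho> (jacobian f (at (\<rho>' v)) *v \<rho>' w))) (at v)"
      by (intro bounded_linear.has_derivative[OF lin(1)]
          has_derivative_compose[OF bounded_linear_imp_has_derivative[OF lin(2)]])
    moreover have "\<rho> (jacobian f (at (\<rho>' v)) *v \<rho>' w) = J v *v w" for w
    proof -
      have "(\<Sum>k\<in>UNIV. jacobian f (at (\<rho>' v)) $ \<pi> i $ k * w $ inv \<pi> k)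
          = (\<Sum>j\<in>UNIV. jacobian f (at (\<rho>' v)) $ \<pi> i $ \<pi> j * w $ j)" for i
        using sum.reindex_bij_betw[OF \<pi>, of "\<lambda>k. jacobian f (at (\<rho>' v)) $ \<pi> i $ k * w $ inv \<pi> k"] \<pi>
        by (simp add: bij_is_inj)
      then show ?thesis
        by (simp add: \<rho>_def \<rho>'_def J_def relabel_def matrix_vector_mult_def vec_eq_iff)
    qed
    ultimately show ?thesis
      by (simp add: g_def[abs_def])
  qed
  have jac: "jacobian g (at v) = J v" if "v \<in> \<rho> ` \<Omega>" for v
    by (rule jacobian_eq[OF g'[OF that]])
  have det_J: "det (J (\<rho> u)) = det (jacobian f (at u))" for u
    unfolding J_def inv by (rule det_relabel[OF \<pi>])
  have "continuous_on (\<rho> ` \<Omega>) (\<lambda>v. jacobian f (at (\<rho>' v)))"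
    by (rule continuous_on_compose2[OF f(5) cont(2)]) (auto simp: image_iff')
  then have "continuous_on (\<rho> ` \<Omega>) J"
    unfolding J_def by (intro continuous_on_vec_lambda continuous_on_component)
  then have cont_jac: "continuous_on (\<rho> ` \<Omega>) (\<lambda>v. jacobian g (at v))"
    using jac by (simp cong: continuous_on_cong)
  have cont_g: "continuous_on (\<rho> ` closure \<Omega>) g"
    unfolding g_def by (intro continuous_on_compose2[OF cont(1)[of UNIV]] continuous_on_compose2[OF f(3) cont(2)])
      (auto simp: image_iff')
  have p_frontier: "\<rho> p \<notin> g ` \<rho> ` frontier \<Omega>"
    using f(6) inj by (auto simp: g_def inj_eq)
  obtain \<epsilon> where \<epsilon>: "\<epsilon> > 0" "\<forall>q\<in>ball p \<epsilon>. regular_value_on f \<Omega> q \<longrightarrow>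
      of_int d = (\<Sum>x\<in>{x\<in>\<Omega>. f x = q}. sgn (det (jacobian f (at x))))"
    using deg unfolding has_brouwer_degree_def by blast
  have "of_int d = (\<Sum>v\<in>{v\<in>\<rho> ` \<Omega>. g v = q}. sgn (det (jacobian g (at v))))"
    if q: "q \<in> ball (\<rho> p) \<epsilon>" and reg: "regular_value_on g (\<rho> ` \<Omega>) q" for q
  proof -
    have "\<rho>' q \<in> ball p \<epsilon>"
      using q iso[of "\<rho> p" q] by simp
    moreover have eq: "g (\<rho> u) = q \<longleftrightarrow> f u = \<rho>' q" for u
      unfolding g_def by (metis inv)
    have "regular_value_on f \<Omega> (\<rho>' q)"
      using reg unfolding regular_value_on_def by (auto simp: eq jac det_J)
    ultimately have "of_int d = (\<Sum>x\<in>{x\<in>\<Omega>. f x = \<rho>' q}. sgn (det (jacobian f (at x))))"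
      using \<epsilon>(2) by blast
    also have "\<dots> = (\<Sum>u\<in>{x\<in>\<Omega>. f x = \<rho>' q}. sgn (det (jacobian g (at (\<rho> u)))))"
      by (intro sum.cong refl) (simp add: jac det_J)
    also have "\<dots> = (\<Sum>v\<in>\<rho> ` {x\<in>\<Omega>. f x = \<rho>' q}. sgn (det (jacobian g (at v))))"
      by (rule sum.reindex[OF inj_on_subset[OF inj subset_UNIV], unfolded o_def, symmetric])
    also have "\<rho> ` {x\<in>\<Omega>. f x = \<rho>' q} = {v\<in>\<rho> ` \<Omega>. g v = q}"
    proof -
      have "g v = q \<longleftrightarrow> f (\<rho>' v) = \<rho>' q" for v
        using eq[of "\<rho>' v"] by simp
      then show ?thesis by (simp add: set_eq_iff image_iff')
    qed
    finally show ?thesis .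
  qed
  moreover have "\<forall>v\<in>\<rho> ` \<Omega>. g differentiable (at v)"
    using differentiableI[OF g'] by blast
  moreover have "bounded (\<rho> ` \<Omega>)"
    by (rule bounded_linear_image[OF f(2) lin(1)])
  ultimately have "has_brouwer_degree g (\<rho> ` \<Omega>) (\<rho> p) d"
    unfolding has_brouwer_degree_def frontier closure
    using open' cont_g cont_jac p_frontier \<epsilon>(1) by blast
  then show ?thesis
    unfolding g_def[abs_def] \<rho>_def \<rho>'_def .
qed

lemma brouwer_degree_relabel:
  fixes f :: "real ^ 'a::finite \<Rightarrow> real ^ 'a" and \<pi> :: "'b::finite \<Rightarrow> 'a"
  assumes \<pi>: "bij \<pi>"
  shows "brouwer_degree (\<lambda>v. relabel \<pi> (f (relabel (inv \<pi>) v))) (relabel \<pi> ` \<Omega>) (relabel \<pi> p)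
    = brouwer_degree f \<Omega> p"
proof -
  have "has_brouwer_degree f \<Omega> p d"
    if "has_brouwer_degree (\<lambda>v. relabel \<pi> (f (relabel (inv \<pi>) v))) (relabel \<pi> ` \<Omega>) (relabel \<pi> p) d" for d
    using has_brouwer_degree_relabel_imp[OF bij_imp_bij_inv[OF \<pi>] that]
    by (simp add: relabel_inverse[OF \<pi>] inv_inv_eq[OF \<pi>] image_image)
  then show ?thesis
    unfolding brouwer_degree_def using has_brouwer_degree_relabel_imp[OF \<pi>] by (metis (no_types, lifting))
qed

section \<open>The degree of the Kazdan-Warner equation\<close>

lemma kazdan_warner_degree_ordered:
  fixes \<omega> :: "'v::{finite,wellorder} \<Rightarrow> 'v \<Rightarrow> real" and \<mu> h :: "'v \<Rightarrow> real"
  assumes "weighted_graph \<omega> \<mu>"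
    and "c > 0 \<Longrightarrow> \<exists>x. h x > 0"
    and "c = 0 \<Longrightarrow> (\<exists>x. h x > 0) \<and> graph_integral \<mu> h < 0"
    and "c < 0 \<Longrightarrow> \<exists>x. h x < 0"
  shows "\<forall>\<^sub>F R in at_top. brouwer_degree (kazdan_warner_map \<omega> \<mu> h c) (linf_ball R) 0
    = (if c \<ge> 0 then - 1 else if Max (range h) \<le> 0 then 1 else 0)"
proof -
  interpret weighted_graph \<omega> \<mu> by fact
  interpret ordered_weighted_graph \<omega> \<mu> ..
  have map_eq: "kazdan_warner_map \<omega> \<mu> h c = kw_map (\<lambda>_. c) h"
    by (simp add: fun_eq_iff kazdan_warner_map_def kw_map_def graph_laplacian_def lap_def)
  have max: "Max (range h) \<le> 0 \<longleftrightarrow> (\<forall>x. h x \<le> 0)"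
    by (subst Max_le_iff) auto
  have "large_ball_degree (\<lambda>_. c) h (if c \<ge> 0 then - 1 else if Max (range h) \<le> 0 then 1 else 0)"
  proof -
    consider "c > 0" | "c = 0" | "c < 0" "\<forall>x. h x \<le> 0" | x where "c < 0" "h x > 0"
      by (metis linorder_neqE_linordered_idom not_le)
    then show ?thesis
    proof cases
      case 1
      then show ?thesis using assms(2) large_ball_degree_positive by auto
    next
      case 2
      then show ?thesis
        using assms(3) large_ball_degree_zero by (auto simp: graph_integral_def mult.commute)
    next
      case 3
      then show ?thesis
        using assms(4) large_ball_degree_nonpositive by (auto simp: max)
    next
      case 4
      then have "\<not> Max (range h) \<le> 0"
        unfolding max using not_le by blast
      then show ?thesis
        using 4 large_ball_degree_negative_sign_changing by (simp del: Max_le_iff)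
    qed
  qed
  then obtain B where "\<And>R. R > B \<Longrightarrow> has_brouwer_degree (kw_map (\<lambda>_. c) h) (linf_ball R) 0
      (if c \<ge> 0 then - 1 else if Max (range h) \<le> 0 then 1 else 0)"
    unfolding large_ball_degree_def by blast
  then have "brouwer_degree (kw_map (\<lambda>_. c) h) (linf_ball R) 0
      = (if c \<ge> 0 then - 1 else if Max (range h) \<le> 0 then 1 else 0)" if "R > B" for R
    using that by (intro brouwer_degree_eqI[OF diagonally_nonlinear_kw_map])
  then show ?thesis
    unfolding map_eq eventually_at_top_dense by blast
qed

theorem theorem2p3:
  fixes E :: "'v::finite set set"
    and \<omega> :: "'v \<Rightarrow> 'v \<Rightarrow> real"
    and \<mu> h :: "'v \<Rightarrow> real"
    and c :: real
  assumes "connected_weighted_graph E \<omega> \<mu>"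
    and "c > 0 \<Longrightarrow> \<exists>x. h x > 0"
    and "c = 0 \<Longrightarrow> (\<exists>x. h x > 0) \<and> (\<exists>x. h x < 0) \<and> graph_integral \<mu> h < 0"
    and "c < 0 \<Longrightarrow> \<exists>x. h x < 0"
  shows "((\<lambda>R::real. brouwer_degree (kazdan_warner_map \<omega> \<mu> h c) (linf_ball R) 0) \<longlongrightarrow>
      (if c \<ge> 0 then - 1 else if Max (range h) \<le> 0 then 1 else 0)) at_top"
proof -
  let ?\<pi> = "Rep_ordered_copy :: 'v ordered_copy \<Rightarrow> 'v"
  have \<pi>: "bij ?\<pi>"
    by (metis Abs_ordered_copy_inverse Rep_ordered_copy_inverse UNIV_I bijI')
  have surj: "\<exists>a. ?\<pi> a = x" for x
    using \<pi> by (metis bij_pointE)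
  define \<omega>' where "\<omega>' a b = \<omega> (?\<pi> a) (?\<pi> b)" for a b
  define \<mu>' where "\<mu>' a = \<mu> (?\<pi> a)" for a
  define h' where "h' a = h (?\<pi> a)" for a
  have graph: "weighted_graph \<omega>' \<mu>'"
  proof
    show "\<omega>' x y = \<omega>' y x" "\<omega>' x y \<ge> 0" "\<mu>' x > 0" for x y
      using assms(1) by (auto simp: connected_weighted_graph_def \<omega>'_def \<mu>'_def)
    have "(\<lambda>a b. \<omega>' a b > 0)\<^sup>*\<^sup>* (Abs_ordered_copy x) (Abs_ordered_copy y)" for x y
    proof -
      have "(\<lambda>a b. \<omega> a b > 0)\<^sup>*\<^sup>* x y"
        using assms(1) unfolding connected_weighted_graph_def by blast
      then show ?thesis
        by (induction rule: rtranclp_induct)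
          (auto simp: \<omega>'_def Abs_ordered_copy_inverse intro: rtranclp.rtrancl_into_rtrancl)
    qed
    from this[of "?\<pi> x" "?\<pi> y" for x y] show "(\<lambda>a b. \<omega>' a b > 0)\<^sup>*\<^sup>* x y" for x y
      by (simp add: Rep_ordered_copy_inverse)
  qed
  have sign: "(\<exists>a. h' a > 0) \<longleftrightarrow> (\<exists>x. h x > 0)" "(\<exists>a. h' a < 0) \<longleftrightarrow> (\<exists>x. h x < 0)"
    unfolding h'_def using surj by metis+
  have integral: "graph_integral \<mu>' h' = graph_integral \<mu> h"
    unfolding graph_integral_def \<mu>'_def h'_def by (rule sum.reindex_bij_betw[OF \<pi>])
  have range: "range h' = range h"
    unfolding h'_def using image_image[of h ?\<pi> UNIV] bij_is_surj[OF \<pi>] by simp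
  have "\<forall>\<^sub>F R in at_top. brouwer_degree (kazdan_warner_map \<omega>' \<mu>' h' c) (linf_ball R) 0
      = (if c \<ge> 0 then - 1 else if Max (range h) \<le> 0 then 1 else 0)"
    using kazdan_warner_degree_ordered[OF graph, of c h'] assms(2-4)
    unfolding sign integral range by blast
  moreover have "brouwer_degree (kazdan_warner_map \<omega>' \<mu>' h' c) (linf_ball R) 0
      = brouwer_degree (kazdan_warner_map \<omega> \<mu> h c) (linf_ball R) 0" for R
  proof -
    have "kazdan_warner_map \<omega>' \<mu>' h' c = (\<lambda>v. relabel ?\<pi> (kazdan_warner_map \<omega> \<mu> h c (relabel (inv ?\<pi>) v)))"
    proof
      fix v :: "real ^ 'v ordered_copy"
      have "(\<Sum>b\<in>UNIV. \<omega>' a b * (v $ b - v $ a))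
          = (\<Sum>y\<in>UNIV. \<omega> (?\<pi> a) y * (v $ inv ?\<pi> y - v $ a))" for a
        using sum.reindex_bij_betw[OF \<pi>, of "\<lambda>y. \<omega> (?\<pi> a) y * (v $ inv ?\<pi> y - v $ a)"] \<pi>
        by (simp add: \<omega>'_def bij_is_inj)
      then show "kazdan_warner_map \<omega>' \<mu>' h' c v = relabel ?\<pi> (kazdan_warner_map \<omega> \<mu> h c (relabel (inv ?\<pi>) v))"
        using \<pi> by (simp add: kazdan_warner_map_def graph_laplacian_def relabel_def vec_eq_iff
            \<mu>'_def h'_def bij_is_inj)
    qed
    moreover have "linf_ball R = relabel ?\<pi> ` linf_ball R"
    proof -
      have "infnorm (relabel ?\<pi> u) = infnorm u" for u
      proof -
        have "{\<bar>u $ ?\<pi> a\<bar> |a. a \<in> UNIV} = {\<bar>u $ x\<bar> |x. x \<in> UNIV}"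
          using surj by auto metis
        then show ?thesis by (simp add: infnorm_cart relabel_def)
      qed
      then show ?thesis
        unfolding linf_ball_def using relabel_inverse(2)[OF \<pi>] by (auto intro!: image_eqI[of _ _ "relabel (inv ?\<pi>) _"]) metis
    qed
    moreover have "relabel ?\<pi> 0 = 0" by (simp add: relabel_def vec_eq_iff)
    ultimately show ?thesis
      using brouwer_degree_relabel[OF \<pi>, of "kazdan_warner_map \<omega> \<mu> h c" "linf_ball R" 0] by simp
  qed
  ultimately show ?thesis
    by (intro tendsto_eventually) simp
qed

end
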